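(* The optimal eigenvalues of the path graph $P=[0,1]$ are $$\lambda_k^{\min}(P)=4k^2,\qquad k\in\mathbb{N}_0=\{0,1,2,\dots\}.$$ Moreover, for $k\ge 1$, the unique Borel probability measure $\mu_k$ on $P$ with $\lambda_k^{\min}(P)=\lambda_k(H_{\mu_k})$ is $$\mu_k=\frac{1}{2k}\delta_0+\frac{1}{2k}\delta_1+\sum_{j=1}^{k-1}\frac1k\,\delta_{\frac{j}{k}}.$$
   Context: The path graph $P=[0,1]$ is the metric graph consisting of two vertices joined by one edge of length one, i.e. the unit interval. $H^1(P)=H^1((0,1))$ is viewed as a space of continuous functions on $[0,1]$, and $q(f,g)=\int_0^1 f'g'\,dx$. A function $f\in H^1(P)$ is harmonic on a (relatively) open set $O\subset P$ if $q(f,g)=0$ for all $g\in H^1(P)$ with $g\equiv 0$ on $P\setminus O$. For a Borel probability measure $\mu$ on $P$, let $H^1(P,\mu)=\{f\in H^1(P): f \text{ harmonic on } P\setminus\operatorname{supp}\mu\}$, regarded (injectively) as a dense subspace of $L^2(P,\mu)$. $H_\mu$ is the non-negative self-adjoint operator in $L^2(P,\mu)$ associated with the closed form $q|_{H^1(P,\mu)}$: $f\in\operatorname{dom}(H_\mu)$ and $H_\mu f=g$ iff $f\in H^1(P,\mu)$ and $q(f,\varphi)=\int_P g\varphi\,d\mu$ for all $\varphi\in H^1(P,\mu)$. Its spectrum is discrete; its eigenvalues, counted with multiplicity, are $0=\lambda_0(H_\mu)<\lambda_1(H_\mu)\le\lambda_2(H_\mu)\le\cdots$, with the convention $\lambda_k(H_\mu):=+\infty$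 for $k\ge\dim L^2(P,\mu)$. Let $\lambda_k^{\min}(P):=\min_\mu\lambda_k(H_\mu)$ over all Borel probability measures $\mu$ on $P$ (attained). *)

theory Defs
  imports "HOL-Probability.Probability"
begin

text \<open>The path graph is the interval \<open>{0..1::real}\<close>. Functions on it are total functions
  \<open>real \<Rightarrow> real\<close> whose values outside the interval are irrelevant. Elements of \<open>L\<^sup>2\<close> spaces are
  represented by square-integrable functions, without passing to almost-everywhere classes.\<close>

definition square_integrable :: "'a measure \<Rightarrow> ('a \<Rightarrow> real) set" where
  "square_integrable M = {f \<in> borel_measurable M. integrable M (\<lambda>x. (f x)\<^sup>2)}"

text \<open>Linear independence is taken modulo null sets, so that the following is the dimension of
  the span of the classes of \<open>V\<close> in \<open>L\<^sup>2(M)\<close>; it is \<open>\<infinity>\<close> if there are arbitrarily large independent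
  subsets.\<close>

definition L2_independent :: "'a measure \<Rightarrow> ('a \<Rightarrow> real) set \<Rightarrow> bool" where
  "L2_independent M S \<longleftrightarrow> finite S \<and>
     (\<forall>c :: ('a \<Rightarrow> real) \<Rightarrow> real. (AE x in M. (\<Sum>f\<in>S. c f * f x) = 0) \<longrightarrow> (\<forall>f\<in>S. c f = 0))"

definition L2_dim :: "'a measure \<Rightarrow> ('a \<Rightarrow> real) set \<Rightarrow> enat" where
  "L2_dim M V = (SUP S\<in>{S. S \<subseteq> V \<and> L2_independent M S}. enat (card S))"

abbreviation unit_lborel :: "real measure" where
  "unit_lborel \<equiv> restrict_space lborel {0<..<1}"

text \<open>The test functions are \<open>C\<^sup>1\<close> with compact support in the open interval; compactness of the
  support is automatic, as it is closed and contained in a bounded set.\<close>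

definition test_functions :: "(real \<Rightarrow> real) set" where
  "test_functions = {\<phi>. \<phi> C1_differentiable_on UNIV \<and> closure {x. \<phi> x \<noteq> 0} \<subseteq> {0<..<1}}"

definition has_weak_deriv :: "(real \<Rightarrow> real) \<Rightarrow> (real \<Rightarrow> real) \<Rightarrow> bool" where
  "has_weak_deriv f h \<longleftrightarrow> h \<in> square_integrable unit_lborel \<and>
     (\<forall>\<phi>\<in>test_functions.
        (LINT x|unit_lborel. f x * deriv \<phi> x) = - (LINT x|unit_lborel. h x * \<phi> x))"

definition H1 :: "(real \<Rightarrow> real) set" where
  "H1 = {f. continuous_on {0..1} f \<and> (\<exists>h. has_weak_deriv f h)}"

text \<open>The choice of the weak derivative, unique up to a null set, does not affect \<open>q\<close>.\<close>

definition weak_deriv :: "(real \<Rightarrow> real) \<Rightarrow> real \<Rightarrow> real" where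
  "weak_deriv f = (SOME h. has_weak_deriv f h)"

definition q :: "(real \<Rightarrow> real) \<Rightarrow> (real \<Rightarrow> real) \<Rightarrow> real" where
  "q f g = (LINT x|unit_lborel. weak_deriv f x * weak_deriv g x)"

definition harmonic_on :: "real set \<Rightarrow> (real \<Rightarrow> real) \<Rightarrow> bool" where
  "harmonic_on U f \<longleftrightarrow> f \<in> H1 \<and> (\<forall>g\<in>H1. (\<forall>x\<in>{0..1} - U. g x = 0) \<longrightarrow> q f g = 0)"

abbreviation P_borel :: "real measure" where
  "P_borel \<equiv> restrict_space borel {0..1}"

definition P_prob_measures :: "real measure set" where
  "P_prob_measures = {\<mu>. sets \<mu> = sets P_borel \<and> prob_space \<mu>}"

definition supp :: "real measure \<Rightarrow> real set" where
  "supp \<mu> = {x \<in> {0..1}. \<forall>U. openin (top_of_set {0..1}) U \<and> x \<in> U \<longrightarrow> emeasure \<mu> U > 0}"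

definition H1_mu :: "real measure \<Rightarrow> (real \<Rightarrow> real) set" where
  "H1_mu \<mu> = {f \<in> H1. harmonic_on ({0..1} - supp \<mu>) f}"

text \<open>The graph of the operator \<open>H\<^sub>\<mu>\<close>. An element of the domain, a class in \<open>L\<^sup>2(P,\<mu>)\<close>, is given by
  its unique representative in \<open>H1_mu \<mu>\<close>.\<close>

definition H_op :: "real measure \<Rightarrow> ((real \<Rightarrow> real) \<times> (real \<Rightarrow> real)) set" where
  "H_op \<mu> = {(f, g). f \<in> H1_mu \<mu> \<and> g \<in> square_integrable \<mu> \<and>
     (\<forall>\<phi>\<in>H1_mu \<mu>. q f \<phi> = (LINT x|\<mu>. g x * \<phi> x))}"

definition eigenspace :: "real measure \<Rightarrow> real \<Rightarrow> (real \<Rightarrow> real) set" where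
  "eigenspace \<mu> l = {f. (f, \<lambda>x. l * f x) \<in> H_op \<mu>}"

text \<open>The number of eigenvalues in \<open>{..t}\<close>, counted with multiplicity; the supremum over finite
  sets is the possibly infinite sum of the multiplicities (zero for non-eigenvalues).\<close>

definition eigenvalue_count :: "real measure \<Rightarrow> real \<Rightarrow> enat" where
  "eigenvalue_count \<mu> t =
     (SUP F\<in>{F. finite F \<and> F \<subseteq> {..t}}. \<Sum>l\<in>F. L2_dim \<mu> (eigenspace \<mu> l))"

text \<open>The entry with index \<open>k\<close>, starting at 0, of the increasing list of the eigenvalues repeated
  according to multiplicity: the least \<open>t\<close> with at least \<open>k + 1\<close> eigenvalues in \<open>{..t}\<close>.\<close>

definition eigval :: "nat \<Rightarrow> real measure \<Rightarrow> ereal" where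
  "eigval k \<mu> =
     (if L2_dim \<mu> (square_integrable \<mu>) \<le> enat k then \<infinity>
      else Inf (ereal ` {t. enat (Suc k) \<le> eigenvalue_count \<mu> t}))"

definition lambda_min :: "nat \<Rightarrow> ereal" where
  "lambda_min k = (INF \<mu>\<in>P_prob_measures. eigval k \<mu>)"

text \<open>\<open>return P_borel x\<close> is the Dirac measure at \<open>x\<close>.\<close>

definition mu_opt :: "nat \<Rightarrow> real measure" where
  "mu_opt k = measure_of {0..1} (sets P_borel)
     (\<lambda>A. ennreal (1 / (2 * real k)) * emeasure (return P_borel 0) A
        + ennreal (1 / (2 * real k)) * emeasure (return P_borel 1) A
        + (\<Sum>j\<in>{1..k - 1}. ennreal (1 / real k) * emeasure (return P_borel (real j / real k)) A))"

end

theory Submission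
  imports Defs
begin

text \<open>Suppose that \<open>k + 1\<close> eigenvalues of \<open>H\<^sub>\<mu>\<close> are at most \<open>t\<close>. Then some function \<open>f\<close> in the span of the
  eigenfunctions vanishes at \<open>k\<close> prescribed points \<open>x\<^sub>1 \<le> \<dots> \<le> x\<^sub>k\<close> and satisfies
  \<open>q f f \<le> t * \<integral> f\<^sup>2 d\<mu>\<close>. On a piece of length \<open>L\<close> between two such points, \<open>f\<^sup>2 \<le> L / 4 * \<integral> f'\<^sup>2\<close>, and on
  the two end pieces \<open>f\<^sup>2 \<le> L * \<integral> f'\<^sup>2\<close>. By the Cauchy-Schwarz inequality
  \<open>\<Sum> sqrt (L * m) \<le> 1\<close> for the lengths \<open>L\<close> and the \<open>\<mu>\<close>-masses \<open>m\<close> of the pieces, a greedy choice of the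
  points achieves \<open>L * m \<le> 1 / k\<^sup>2\<close> on the inner and \<open>L * m \<le> 1 / (4 * k\<^sup>2)\<close> on the end pieces, whence
  \<open>4 * k\<^sup>2 \<le> t\<close>. If \<open>t = 4 * k\<^sup>2\<close>, then \<open>f\<close> is itself an eigenfunction. On each piece where it does not
  vanish, \<open>\<mu>\<close> is a single atom at the peak; by unique continuation there is no piece where it vanishes;
  and equality in the Cauchy-Schwarz inequality then determines \<open>\<mu>\<close>. For this \<open>\<mu>\<close> the eigenfunctions
  are the piecewise linear interpolations of \<open>cos (\<pi> * j * x)\<close>, \<open>j \<le> k\<close>.\<close>

section \<open>Continuous functions with a weak derivative\<close>

text \<open>A span of dimension k + 1 can absorb k linear conditions, hence k zeros and k + 1
  pieces. The constants are resistances: a point at distances a and b from two zeros sees a * b / (a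
  + b), at most a quarter of the piece; an end piece has a zero on one side only. Since the square
  roots of the quotas, 1/k on k - 1 inner pieces and 1/(2k) on two end pieces, add up to exactly 1,
  the greedy choice leaves no more than its quota to the last piece. The obstacle is that \<mu> may
  have atoms, so that a quota need not be met exactly by any point. A greedy point before 1 gives at
  least the quota when counted in and at most the quota when left out. The first fact drives the
  Cauchy-Schwarz sum; the second is enough for the estimate because f vanishes at the point. Unique
  continuation is a kink condition: an eigenfunction bends only where f \<mu> has mass, so it cannot
  be nonzero at a peak and vanish identically beyond the adjacent zero.\<close>

lemma has_derivative_pos_part_square:
  "((\<lambda>x::real. (max 0 x)\<^sup>2) has_real_derivative 2 * max 0 x) (at x)"
proof -
  consider "x < 0" | "x > 0" | "x = 0" by linarith
  then show ?thesis
  proof cases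
    case 1
    have "((\<lambda>x::real. 0) has_real_derivative 2 * max 0 x) (at x)"
      using 1 by simp
    then show ?thesis
      by (rule has_field_derivative_transform_within_open[of _ _ _ "{..<0}"]) (use 1 in auto)
  next
    case 2
    have "((\<lambda>x::real. x\<^sup>2) has_real_derivative 2 * max 0 x) (at x)"
      using 2 by (auto intro!: derivative_eq_intros)
    then show ?thesis
      by (rule has_field_derivative_transform_within_open[of _ _ _ "{0<..}"]) (use 2 in auto)
  next
    case 3
    have "((\<lambda>h::real. (max 0 h)\<^sup>2 / h) \<longlongrightarrow> 0) (at 0)"
    proof (rule tendsto_rabs_zero_cancel, rule tendsto_sandwich[of "\<lambda>_. 0" _ _ "\<lambda>h. \<bar>h\<bar>"])
      show "\<forall>\<^sub>F h in at 0. \<bar>(max 0 h)\<^sup>2 / h\<bar> \<le> \<bar>h::real\<bar>"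
        by (auto simp: max_def power2_eq_square intro!: always_eventually)
      show "((\<lambda>h::real. \<bar>h\<bar>) \<longlongrightarrow> 0) (at 0)"
        by (intro tendsto_eq_intros) auto
    qed auto
    then show ?thesis using 3 by (simp add: DERIV_def)
  qed
qed

text \<open>A quadratic spline rising from 0 to 1 on the unit interval; its derivative
  \<open>hat\<close> is a tent of height 2 and integral 1. Test functions are only required to be
  C^1, so this explicit spline can replace a smooth cutoff.\<close>

definition smooth_step :: "real \<Rightarrow> real" where
  "smooth_step x = 2 * ((max 0 x)\<^sup>2 - 2 * (max 0 (x - 1/2))\<^sup>2 + (max 0 (x - 1))\<^sup>2)"

definition hat :: "real \<Rightarrow> real" where
  "hat x = 4 * (max 0 x - 2 * max 0 (x - 1/2) + max 0 (x - 1))"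

lemma smooth_step_has_derivative:
  "(smooth_step has_real_derivative hat x) (at x)"
proof -
  have d: "((\<lambda>x. (max 0 (x - c))\<^sup>2) has_real_derivative 2 * max 0 (x - c)) (at x)" for c
  proof -
    have "((\<lambda>x. x - c) has_real_derivative 1) (at x)"
      by (auto intro!: derivative_eq_intros)
    from DERIV_chain2[OF has_derivative_pos_part_square this] show ?thesis by simp
  qed
  show ?thesis unfolding smooth_step_def[abs_def] hat_def
    using DERIV_cmult[OF DERIV_add[OF DERIV_diff[OF d[of 0] DERIV_cmult[OF d[of "1/2"], of 2]] d[of 1]], of 2]
    by simp
qed

lemma continuous_on_hat: "continuous_on S hat"
  unfolding hat_def[abs_def] by (intro continuous_intros)

lemma hat_eq_0: "x \<le> 0 \<or> x \<ge> 1 \<Longrightarrow> hat x = 0"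
  by (auto simp: hat_def max_def)

lemma hat_nonneg: "hat x \<ge> 0"
  by (auto simp: hat_def max_def)

lemma smooth_step_eq_0: "x \<le> 0 \<Longrightarrow> smooth_step x = 0"
  by (auto simp: smooth_step_def max_def)

lemma smooth_step_eq_1: "x \<ge> 1 \<Longrightarrow> smooth_step x = 1"
  by (auto simp: smooth_step_def max_def power2_eq_square algebra_simps)

lemma smooth_step_mono: "x \<le> y \<Longrightarrow> smooth_step x \<le> smooth_step y"
  by (rule DERIV_nonneg_imp_nondecreasing[of x y smooth_step])
    (use smooth_step_has_derivative hat_nonneg in blast)+

lemma smooth_step_bounds: "0 \<le> smooth_step x" "smooth_step x \<le> 1"
  using smooth_step_mono[of "min 0 x" x] smooth_step_mono[of x "max x 1"]
  by (auto simp: smooth_step_eq_0 smooth_step_eq_1)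

lemma has_bochner_integral_hat: "has_bochner_integral lborel hat 1"
proof -
  have "has_bochner_integral lborel (\<lambda>x. hat x * indicator {0 .. 1} x) (smooth_step 1 - smooth_step 0)"
  proof (rule has_bochner_integral_FTC_Icc_real)
    show "isCont hat x" for x
      using continuous_on_hat[of UNIV] by (simp add: continuous_on_eq_continuous_at)
  qed (auto simp: smooth_step_has_derivative)
  moreover have "hat x * indicator {0 .. 1} x = hat x" for x
    using hat_eq_0[of x] by (cases "x \<in> {0..1}") auto
  ultimately show ?thesis by (simp add: smooth_step_eq_0 smooth_step_eq_1)
qed

section \<open>Integrability on the open unit interval\<close>

lemma sets_unit_lborel: "sets unit_lborel = sets (restrict_space borel {0<..<1})"
  by (simp add: sets_restrict_space)

lemma finite_measure_unit_lborel: "finite_measure unit_lborel"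
  by (rule finite_measureI) (simp add: emeasure_restrict_space)

lemma continuous_imp_measurable_unit:
  fixes f :: "real \<Rightarrow> real"
  assumes "continuous_on {0..1} f"
  shows "f \<in> borel_measurable unit_lborel"
proof -
  have "f \<in> borel_measurable (restrict_space borel {0<..<1})"
    by (intro borel_measurable_continuous_on_restrict continuous_on_subset[OF assms]) auto
  then show ?thesis using measurable_cong_sets[OF sets_unit_lborel refl] by blast
qed

lemma continuous_imp_bounded_unit:
  fixes f :: "real \<Rightarrow> real"
  assumes "continuous_on {0..1} f"
  obtains B where "B \<ge> 0" "\<And>x. x \<in> {0..1} \<Longrightarrow> \<bar>f x\<bar> \<le> B"
proof -
  have "bounded (f ` {0..1})"
    using assms compact_continuous_image compact_imp_bounded by blast
  then obtain B where "\<forall>x\<in>{0..1}. \<bar>f x\<bar> \<le> B" by (auto simp: bounded_iff)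
  then show ?thesis using that[of "max B 0"] by (metis max.cobounded2 max.coboundedI1)
qed

lemma integrable_continuous_mult_unit:
  fixes f g :: "real \<Rightarrow> real"
  assumes "continuous_on {0..1} f" "integrable unit_lborel g"
  shows "integrable unit_lborel (\<lambda>x. f x * g x)"
proof -
  obtain B where B: "B \<ge> 0" "\<And>x. x \<in> {0..1} \<Longrightarrow> \<bar>f x\<bar> \<le> B"
    using continuous_imp_bounded_unit[OF assms(1)] by metis
  show ?thesis
  proof (rule Bochner_Integration.integrable_bound[of _ "\<lambda>x. B * g x"])
    show "integrable unit_lborel (\<lambda>x. B * g x)" using assms by auto
    show "(\<lambda>x. f x * g x) \<in> borel_measurable unit_lborel"
      using continuous_imp_measurable_unit[OF assms(1)] assms(2) by auto
    show "AE x in unit_lborel. norm (f x * g x) \<le> norm (B * g x)"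
      using B by (intro AE_I2) (auto simp: space_restrict_space abs_mult intro!: mult_right_mono)
  qed
qed

lemma integrable_one_unit: "integrable unit_lborel (\<lambda>x. c::real)"
  using finite_measure.integrable_const[OF finite_measure_unit_lborel] .

lemma integrable_continuous_unit:
  fixes f :: "real \<Rightarrow> real"
  assumes "continuous_on {0..1} f"
  shows "integrable unit_lborel f"
  using integrable_continuous_mult_unit[OF assms integrable_one_unit[of 1]] by simp

lemma square_integrable_mult_integrable:
  assumes "f \<in> square_integrable M" "g \<in> square_integrable M"
  shows "integrable M (\<lambda>x. f x * g x)"
proof (rule Bochner_Integration.integrable_bound[of _ "\<lambda>x. (f x)\<^sup>2 + (g x)\<^sup>2"])
  show "integrable M (\<lambda>x. (f x)\<^sup>2 + (g x)\<^sup>2)" "(\<lambda>x. f x * g x) \<in> borel_measurable M"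
    using assms by (auto simp: square_integrable_def)
  have "\<bar>a * b\<bar> \<le> \<bar>a\<^sup>2 + b\<^sup>2\<bar>" for a b :: real
  proof -
    have "2 * (\<bar>a\<bar> * \<bar>b\<bar>) \<le> a\<^sup>2 + b\<^sup>2" "0 \<le> \<bar>a\<bar> * \<bar>b\<bar>"
      using sum_squares_bound[of "\<bar>a\<bar>" "\<bar>b\<bar>"] by simp_all
    then show ?thesis unfolding abs_mult by linarith
  qed
  then show "AE x in M. norm (f x * g x) \<le> norm ((f x)\<^sup>2 + (g x)\<^sup>2)"
    unfolding real_norm_def by (intro AE_I2)
qed

lemma square_integrable_unit_imp_integrable:
  "h \<in> square_integrable unit_lborel \<Longrightarrow> integrable unit_lborel h"
  using square_integrable_mult_integrable[of h unit_lborel "\<lambda>_. 1"] integrable_one_unit[of 1]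
  by (simp add: square_integrable_def)

lemma square_integrable_add:
  assumes "f \<in> square_integrable M" "g \<in> square_integrable M"
  shows "(\<lambda>x. f x + g x) \<in> square_integrable M"
  using assms square_integrable_mult_integrable[OF assms]
  by (auto simp: square_integrable_def power2_sum mult.assoc)

lemma square_integrable_cmult:
  "f \<in> square_integrable M \<Longrightarrow> (\<lambda>x. c * f x) \<in> square_integrable M"
  by (auto simp: square_integrable_def power_mult_distrib)

lemma test_functionD:
  assumes "\<phi> \<in> test_functions"
  shows "(\<phi> has_real_derivative deriv \<phi> x) (at x)" "continuous_on S (deriv \<phi>)" "continuous_on S \<phi>"
    "x \<notin> {0<..<1} \<Longrightarrow> \<phi> x = 0"
proof -
  have C1: "\<phi> C1_differentiable_on UNIV" using assms by (simp add: test_functions_def)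
  then have d: "\<phi> differentiable at x" and c: "continuous_on UNIV (\<lambda>x. vector_derivative \<phi> (at x))" for x
    by (auto simp: C1_differentiable_on_eq)
  show der: "(\<phi> has_real_derivative deriv \<phi> x) (at x)" for x
    using d[of x] by (metis DERIV_deriv_iff_real_differentiable)
  have "vector_derivative \<phi> (at x) = deriv \<phi> x" for x
    using der[of x] by (simp add: has_real_derivative_iff_has_vector_derivative vector_derivative_at)
  then show "continuous_on S (deriv \<phi>)" using c continuous_on_subset[of UNIV "deriv \<phi>" S] by simp
  show "continuous_on S \<phi>" using der
    by (meson DERIV_isCont continuous_at_imp_continuous_on)
  show "x \<notin> {0<..<1} \<Longrightarrow> \<phi> x = 0"
    using assms closure_subset[of "{x. \<phi> x \<noteq> 0}"] by (auto simp: test_functions_def)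
qed

text \<open>The rise occupies a + 1/n to a + 2/n and the fall b - 2/n to b - 1/n. The margin 1/n
  keeps the closed support inside the open unit interval even if a = 0 or b = 1.\<close>

definition bump :: "real \<Rightarrow> real \<Rightarrow> nat \<Rightarrow> real \<Rightarrow> real" where
  "bump a b n x = smooth_step (n * (x - a) - 1) - smooth_step (n * (x - b) + 2)"

lemma bump_has_derivative:
  "(bump a b n has_real_derivative n * hat (n * (x - a) - 1) - n * hat (n * (x - b) + 2)) (at x)"
proof -
  have d: "((\<lambda>x. smooth_step (n * (x - a) + c)) has_real_derivative n * hat (n * (x - a) + c)) (at x)" for a c
  proof -
    have "((\<lambda>x. n * (x - a) + c) has_real_derivative n) (at x)"
      by (auto intro!: derivative_eq_intros)
    from DERIV_chain2[OF smooth_step_has_derivative this] show ?thesis by (simp add: mult.commute)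
  qed
  show ?thesis unfolding bump_def[abs_def]
    using DERIV_diff[OF d[of a "-1"] d[of b 2]] by simp
qed

text \<open>By the bound 3 the fall neither starts before the rise starts nor ends before the rise
  ends, so the two steps cancel outside a + 1/n to b - 1/n.\<close>

lemma bump_test_function:
  assumes "0 \<le> a" "a < b" "b \<le> 1" "real n * (b - a) \<ge> 3"
  shows "bump a b n \<in> test_functions"
proof -
  have n: "n > 0" using assms by (cases n) auto
  have "continuous_on UNIV (\<lambda>x. c * hat (c * (x - d) + e))" for c d e :: real
    by (intro continuous_on_mult continuous_on_const continuous_on_compose2[OF continuous_on_hat[of UNIV]])
      (auto intro!: continuous_intros)
  then have "continuous_on UNIV (\<lambda>x. n * hat (n * (x - a) + (- 1)) - n * hat (n * (x - b) + 2))"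
    by (intro continuous_on_diff)
  then have "bump a b n C1_differentiable_on UNIV"
    unfolding C1_differentiable_on_def
    using bump_has_derivative[of a b n]
    by (intro exI[of _ "\<lambda>x. n * hat (n * (x - a) + (- 1)) - n * hat (n * (x - b) + 2)"])
      (simp add: has_real_derivative_iff_has_vector_derivative)
  moreover have "{x. bump a b n x \<noteq> 0} \<subseteq> {a + 1/n .. b - 1/n}"
  proof
    fix x assume x: "x \<in> {x. bump a b n x \<noteq> 0}"
    have "\<not> real n * (x - a) - 1 < 0"
    proof
      assume *: "real n * (x - a) - 1 < 0"
      have "real n * (x - b) + 2 = (real n * (x - a) - 1) - real n * (b - a) + 3" by (simp add: algebra_simps)
      then have "real n * (x - b) + 2 \<le> 0" using * assms(4) by linarith
      then show False using x * by (auto simp: bump_def smooth_step_eq_0)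
    qed
    moreover have "\<not> real n * (x - b) + 2 > 1"
    proof
      assume *: "real n * (x - b) + 2 > 1"
      have "real n * (x - a) - 1 = (real n * (x - b) + 2) + real n * (b - a) - 3" by (simp add: algebra_simps)
      then have "real n * (x - a) - 1 \<ge> 1" using * assms(4) by linarith
      then show False using x * by (auto simp: bump_def smooth_step_eq_1)
    qed
    ultimately show "x \<in> {a + 1/n .. b - 1/n}" using n by (auto simp: field_simps)
  qed
  then have "closure {x. bump a b n x \<noteq> 0} \<subseteq> {a + 1/n .. b - 1/n}" by (rule closure_minimal) auto
  moreover have "{a + 1/n .. b - 1/n} \<subseteq> {0<..<1}"
  proof
    fix x assume "x \<in> {a + 1/n .. b - 1/n}"
    then have "a + 1 / n \<le> x" "x \<le> b - 1 / n" by auto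
    moreover have "1 / real n > 0" using n by simp
    ultimately have "0 < x" "x < 1" using assms by linarith+
    then show "x \<in> {0<..<1}" by simp
  qed
  ultimately show ?thesis unfolding test_functions_def by blast
qed

lemma eventually_linear_ge:
  fixes c d :: real assumes "c > 0" shows "\<forall>\<^sub>F n in sequentially. real n * c \<ge> d"
  using eventually_ge_at_top[of "nat \<lceil>d / c\<rceil>"]
  by eventually_elim (use assms in \<open>simp add: field_simps nat_le_iff ceiling_le_iff\<close>)

lemma bump_tendsto_indicator:
  assumes "a < b"
  shows "(\<lambda>n. bump a b n x) \<longlonglongrightarrow> indicator {a<..<b} x"
proof -
  have 1: "(\<lambda>n. smooth_step (real n * (x - a) - 1)) \<longlonglongrightarrow> (if x > a then 1 else 0)"
  proof (cases "x > a")
    case True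
    have "\<forall>\<^sub>F n in sequentially. smooth_step (real n * (x - a) - 1) = 1"
      using eventually_linear_ge[of "x - a" 2] True by (auto elim!: eventually_mono simp: smooth_step_eq_1)
    then show ?thesis using True by (simp add: tendsto_eventually)
  next
    case False
    then have "real n * (x - a) - 1 \<le> 0" for n
      using mult_nonneg_nonpos[of "real n" "x - a"] by simp
    then have "smooth_step (real n * (x - a) - 1) = 0" for n by (rule smooth_step_eq_0)
    then show ?thesis using False by simp
  qed
  have 2: "(\<lambda>n. smooth_step (real n * (x - b) + 2)) \<longlonglongrightarrow> (if x \<ge> b then 1 else 0)"
  proof (cases "x < b")
    case True
    have "\<forall>\<^sub>F n in sequentially. smooth_step (real n * (x - b) + 2) = 0"
      using eventually_linear_ge[of "b - x" 2] True by (auto elim!: eventually_mono simp: smooth_step_eq_0 algebra_simps)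
    then show ?thesis using True by (simp add: tendsto_eventually)
  next
    case False
    then have "real n * (x - b) + 2 \<ge> 1" for n
      using mult_nonneg_nonneg[of "real n" "x - b"] by simp
    then have "smooth_step (real n * (x - b) + 2) = 1" for n by (rule smooth_step_eq_1)
    then show ?thesis using False by simp
  qed
  show ?thesis unfolding bump_def using tendsto_diff[OF 1 2] assms by (auto simp: indicator_def split: if_splits)
qed

text \<open>The kernels n * hat (n * (x - a) + c) form an approximate identity at a; the
  substitution u = n * (x - a) + c turns the claim into dominated convergence. The shift c lets the
  kernel sit on one side of a, which matters when a is an end point of the path.\<close>

lemma hat_approximation:
  fixes f :: "real \<Rightarrow> real"
  assumes f: "continuous_on {0..1} f" and a: "a \<in> {0..1}"
    and supp: "\<forall>\<^sub>F n::nat in sequentially. \<forall>x. hat (n * (x - a) + c) \<noteq> 0 \<longrightarrow> x \<in> {0<..<1}"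
  shows "(\<lambda>n::nat. LINT x|unit_lborel. f x * (n * hat (n * (x - a) + c))) \<longlonglongrightarrow> f a"
proof -
  \<comment> \<open>Clamping extends f to a bounded continuous function on the whole line, over
    which the substitution is carried out.\<close>
  define g where "g x = f (max 0 (min 1 x))" for x
  have g: "continuous_on UNIV g" unfolding g_def
    by (intro continuous_on_compose2[OF f] continuous_intros) auto
  obtain B where B: "B \<ge> 0" "\<And>x. x \<in> {0..1} \<Longrightarrow> \<bar>f x\<bar> \<le> B"
    using continuous_imp_bounded_unit[OF f] by metis
  have meas[measurable]: "g \<in> borel_measurable borel" "hat \<in> borel_measurable borel"
    using g continuous_on_hat borel_measurable_continuous_onI by blast+
  have lim: "(\<lambda>n::nat. LINT u|lborel. g (a + (u - c) / n) * hat u) \<longlonglongrightarrow> (LINT u|lborel. g a * hat u)"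
  proof (rule integral_dominated_convergence[where w="\<lambda>u. B * hat u"])
    show "integrable lborel (\<lambda>u. B * hat u)"
      using has_bochner_integral_hat by (auto simp: has_bochner_integral_iff)
    have "(\<lambda>n. g (a + (u - c) / real n)) \<longlonglongrightarrow> g (a + 0)" for u
    proof (rule continuous_on_tendsto_compose[OF g])
      show "(\<lambda>n. a + (u - c) / real n) \<longlonglongrightarrow> a + 0"
        by (intro tendsto_intros tendsto_divide_0[OF tendsto_const] filterlim_at_top_imp_at_infinity filterlim_real_sequentially)
    qed auto
    then show "AE u in lborel. (\<lambda>n. g (a + (u - c) / real n) * hat u) \<longlonglongrightarrow> g a * hat u"
      by (auto intro!: AE_I2 tendsto_intros)
    show "\<And>n. AE u in lborel. norm (g (a + (u - c) / real n) * hat u) \<le> B * hat u"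
      using B(2) by (auto intro!: AE_I2 mult_right_mono simp: abs_mult hat_nonneg g_def)
  qed auto
  have eq: "\<forall>\<^sub>F n::nat in sequentially. (LINT u|lborel. g (a + (u - c) / n) * hat u)
     = (LINT x|unit_lborel. f x * (n * hat (n * (x - a) + c)))"
    using supp eventually_gt_at_top[of 0]
  proof eventually_elim
    case (elim n)
    have "(LINT u|lborel. g (a + (u - c) / n) * hat u)
      = \<bar>real n\<bar> *\<^sub>R (LINT x|lborel. g (a + ((c - n * a) + real n * x - c) / n) * hat ((c - n * a) + real n * x))"
      using elim by (intro lborel_integral_real_affine) auto
    also have "\<dots> = (LINT x|lborel. g x * (n * hat (n * (x - a) + c)))"
    proof -
      have "a + ((c - n * a) + real n * x - c) / n = x" for x using elim by (simp add: field_simps)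
      moreover have "(c - n * a) + real n * x = n * (x - a) + c" for x by (simp add: algebra_simps)
      ultimately show ?thesis
        by (simp only: real_scaleR_def flip: integral_mult_right_zero) (simp add: mult.left_commute)
    qed
    also have "\<dots> = (LINT x|lborel. indicator {0<..<1} x *\<^sub>R (f x * (n * hat (n * (x - a) + c))))"
      using elim by (intro Bochner_Integration.integral_cong) (auto simp: indicator_def g_def)
    also have "\<dots> = (LINT x|unit_lborel. f x * (n * hat (n * (x - a) + c)))"
      by (subst integral_restrict_space) auto
    finally show ?case .
  qed
  have "g a = f a" using a by (simp add: g_def)
  then have "(LINT u|lborel. g a * hat u) = f a"
    using has_bochner_integral_hat by (simp add: has_bochner_integral_iff)
  then show ?thesis using Lim_transform_eventually[OF lim eq] by simp
qed

text \<open>The derivative of \<open>bump a b n\<close> is a difference of approximate unit masses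
  at a and b, while \<open>bump a b n\<close> itself tends to the indicator of the interval. Testing
  the weak derivative with it and letting n grow gives the formula.\<close>

lemma weak_deriv_FTC:
  assumes f: "continuous_on {0..1} f" and h: "has_weak_deriv f h" and ab: "0 \<le> a" "a \<le> b" "b \<le> 1"
  shows "f b - f a = (LINT x|unit_lborel. indicator {a<..<b} x * h x)"
proof (cases "a = b")
  case False
  then have ab': "a < b" using ab by simp
  have hi: "integrable unit_lborel h"
    using h square_integrable_unit_imp_integrable by (auto simp: has_weak_deriv_def)
  have s1: "\<forall>\<^sub>F n::nat in sequentially. \<forall>x. hat (n * (x - a) + (- 1)) \<noteq> 0 \<longrightarrow> x \<in> {0<..<1}"
  proof (rule eventually_mono[OF eventually_linear_ge[of "b - a" 3]], simp add: ab', intro allI impI)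
    fix n :: nat and x assume n: "3 \<le> real n * (b - a)" and *: "hat (real n * (x - a) + - 1) \<noteq> 0"
    have n0: "n > 0" using n by (cases n) auto
    have **: "real n * (x - a) + - 1 > 0" "real n * (x - a) + - 1 < 1" using * hat_eq_0 by (meson not_less)+
    then have "real n * (x - a) > 0" "real n * (x - a) < real n * (b - a)" using n by linarith+
    then show "x \<in> {0<..<1}" using n0 ab by (auto simp: zero_less_mult_iff)
  qed
  have s2: "\<forall>\<^sub>F n::nat in sequentially. \<forall>x. hat (n * (x - b) + 2) \<noteq> 0 \<longrightarrow> x \<in> {0<..<1}"
  proof (rule eventually_mono[OF eventually_linear_ge[of "b - a" 3]], simp add: ab', intro allI impI)
    fix n :: nat and x assume n: "3 \<le> real n * (b - a)" and *: "hat (real n * (x - b) + 2) \<noteq> 0"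
    have n0: "n > 0" using n by (cases n) auto
    have **: "real n * (x - b) + 2 > 0" "real n * (x - b) + 2 < 1" using * hat_eq_0 by (meson not_less)+
    then have "real n * (b - x) > 0" "real n * (b - x) < real n * (b - a)" using n by (simp_all add: algebra_simps)
    then show "x \<in> {0<..<1}" using n0 ab by (auto simp: zero_less_mult_iff)
  qed
  have cont: "continuous_on {0..1} (\<lambda>x. n * hat (n * (x - c) + d))" for n c d :: real
    by (intro continuous_on_mult continuous_on_const continuous_on_compose2[OF continuous_on_hat[of UNIV]])
      (auto intro!: continuous_intros)
  have int: "integrable unit_lborel (\<lambda>x. f x * (n * hat (n * (x - c) + d)))" for n c d :: real
    using integrable_continuous_mult_unit[OF f integrable_continuous_unit[OF cont]] .
  have L: "(\<lambda>n. LINT x|unit_lborel. f x * deriv (bump a b n) x) \<longlonglongrightarrow> f a - f b"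
  proof -
    have "deriv (bump a b n) x = n * hat (n * (x - a) + (-1)) - n * hat (n * (x - b) + 2)" for n x
      using DERIV_imp_deriv[OF bump_has_derivative] by simp
    then have "(LINT x|unit_lborel. f x * deriv (bump a b n) x) =
      (LINT x|unit_lborel. f x * (n * hat (n * (x - a) + (-1)))) - (LINT x|unit_lborel. f x * (n * hat (n * (x - b) + 2)))" for n
      by (subst Bochner_Integration.integral_diff[OF int int, symmetric]) (simp add: right_diff_distrib)
    then show ?thesis
      using tendsto_diff[OF hat_approximation[OF f _ s1] hat_approximation[OF f _ s2]] ab by simp
  qed
  have R: "(\<lambda>n. LINT x|unit_lborel. h x * bump a b n x) \<longlonglongrightarrow> (LINT x|unit_lborel. h x * indicator {a<..<b} x)"
  proof (rule integral_dominated_convergence[where w="\<lambda>x. \<bar>h x\<bar>"])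
    show "integrable unit_lborel (\<lambda>x. \<bar>h x\<bar>)" using hi by auto
    show "AE x in unit_lborel. (\<lambda>n. h x * bump a b n x) \<longlonglongrightarrow> h x * indicator {a<..<b} x"
      using bump_tendsto_indicator[OF ab'] by (auto intro!: AE_I2 tendsto_intros)
    have "\<bar>bump a b n x\<bar> \<le> 1" for n x
      unfolding bump_def using smooth_step_bounds[of "real n * (x - a) - 1"]
        smooth_step_bounds[of "real n * (x - b) + 2"] by linarith
    then show "\<And>n. AE x in unit_lborel. norm (h x * bump a b n x) \<le> \<bar>h x\<bar>"
      by (auto intro!: AE_I2 simp: abs_mult mult_left_le)
    have [measurable]: "h \<in> borel_measurable unit_lborel" using hi by auto
    have "indicator {a<..<b} \<in> borel_measurable (borel :: real measure)" by measurable
    then have [measurable]: "(indicator {a<..<b} :: real \<Rightarrow> real) \<in> borel_measurable unit_lborel"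
      by (intro measurable_restrict_space1) simp
    show "(\<lambda>x. h x * indicator {a<..<b} x) \<in> borel_measurable unit_lborel" by measurable
    have "bump a b n \<in> borel_measurable unit_lborel" for n
      by (meson bump_has_derivative DERIV_isCont continuous_at_imp_continuous_on continuous_imp_measurable_unit)
    then show "\<And>n. (\<lambda>x. h x * bump a b n x) \<in> borel_measurable unit_lborel" by measurable
  qed
  have "\<forall>\<^sub>F n in sequentially. (LINT x|unit_lborel. f x * deriv (bump a b n) x) = - (LINT x|unit_lborel. h x * bump a b n x)"
    using eventually_linear_ge[of "b - a" 3]
    by (rule eventually_mono) (use ab' ab h bump_test_function in \<open>auto simp: has_weak_deriv_def\<close>)
  then have "(\<lambda>n. - (LINT x|unit_lborel. h x * bump a b n x)) \<longlonglongrightarrow> f a - f b"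
    by (rule Lim_transform_eventually[OF L])
  with tendsto_minus[OF R] have "- (LINT x|unit_lborel. h x * indicator {a<..<b} x) = f a - f b"
    by (rule LIMSEQ_unique)
  then show ?thesis by (simp add: mult.commute)
qed simp

section \<open>The form on the Sobolev space\<close>

lemma LINT_unit_eq: "(LINT x|unit_lborel. f x) = (LINT x:{0<..<1}|lborel. f x :: real)"
  by (simp add: set_lebesgue_integral_def integral_restrict_space)

lemma integrable_unit_iff: "integrable unit_lborel f \<longleftrightarrow> set_integrable lborel {0<..<1} (f :: real \<Rightarrow> real)"
  by (simp add: set_integrable_def integrable_restrict_space)

lemma indicator_measurable_unit:
  "A \<in> sets borel \<Longrightarrow> (indicator A :: real \<Rightarrow> real) \<in> borel_measurable unit_lborel"
  by (intro measurable_restrict_space1) simp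

lemma integrable_indicator_mult_unit:
  fixes h :: "real \<Rightarrow> real"
  assumes "integrable unit_lborel h" "A \<in> sets borel"
  shows "integrable unit_lborel (\<lambda>x. indicator A x * h x)"
proof (rule Bochner_Integration.integrable_bound[OF assms(1)])
  show "(\<lambda>x. indicator A x * h x) \<in> borel_measurable unit_lborel"
    using indicator_measurable_unit[OF assms(2)] assms(1) by measurable
qed (auto intro!: AE_I2 simp: indicator_def)

text \<open>A Dynkin argument: bounded open intervals form an intersection-stable generator, and the
  total integral, which is not one of the interval integrals, handles complements.\<close>

lemma AE_zero_of_interval_integrals:
  fixes d :: "real \<Rightarrow> real"
  assumes d: "integrable lborel d"
    and zero: "\<And>a b. a \<le> b \<Longrightarrow> (LINT x:{a<..<b}|lborel. d x) = 0"
    and total: "(LINT x|lborel. d x) = 0"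
  shows "AE x in lborel. d x = 0"
proof -
  have si: "set_integrable lborel A d" if "A \<in> sets borel" for A
    unfolding set_integrable_def using integrable_mult_indicator[OF _ d, of A] that by simp
  have "(LINT x:A|lborel. d x) = 0" if "A \<in> sets borel" for A
  proof -
    let ?G = "range (\<lambda>(a, b). {a<..<b::real})"
    have borel: "sets borel = sigma_sets UNIV ?G"
    proof -
      have box: "(\<lambda>(a, b). box a b) = (\<lambda>(a, b). {a<..<b::real})" by (rule ext) (simp split: prod.split)
      show ?thesis unfolding borel_eq_box box by (rule sets_measure_of) simp
    qed
    have "Int_stable ?G"
    proof (rule Int_stableI)
      fix A B assume "A \<in> ?G" "B \<in> ?G"
      then obtain a b a' b' where "A = {a<..<b}" "B = {a'<..<b'}" by auto
      then have "A \<inter> B = {max a a'<..<min b b'}" by auto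
      then show "A \<inter> B \<in> ?G" by auto
    qed
    moreover have "?G \<subseteq> Pow UNIV" by simp
    moreover have "A \<in> sigma_sets UNIV ?G" using that borel by simp
    ultimately show ?thesis
    proof (induction rule: sigma_sets_induct_disjoint)
      case (basic A)
      then obtain a b where A: "A = {a<..<b}" by auto
      show ?case
      proof (cases "a \<le> b")
        case False
        then have "A = {}" using A by auto
        then show ?thesis unfolding set_lebesgue_integral_def by simp
      qed (use zero A in simp)
    next
      case (compl A)
      have A: "A \<in> sets borel" using compl borel by simp
      have "(LINT x:A \<union> (UNIV - A)|lborel. d x) = (LINT x:A|lborel. d x) + (LINT x:UNIV - A|lborel. d x)"
        by (rule set_integral_Un) (use si A in auto)
      then show ?case using compl total by (simp add: set_lebesgue_integral_def)
    next
      case (union A)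
      have "A i \<in> sets borel" for i using union borel by auto
      then have "(LINT x:(\<Union>i. A i)|lborel. d x) = (\<Sum>i. (LINT x:(A i)|lborel. d x))"
        by (intro lebesgue_integral_countable_add)
          (use union(1) si in \<open>auto simp: disjoint_family_on_def\<close>)
      then show ?case using union by simp
    qed (simp add: set_lebesgue_integral_def)
  qed
  then show ?thesis by (intro density_unique_real[OF d]) (simp_all add: set_lebesgue_integral_def)
qed

text \<open>Both candidates have the same integrals over intervals by \<open>weak_deriv_FTC\<close>.
  This frees \<open>q\<close> from the choice operator in \<open>weak_deriv\<close>.\<close>

lemma weak_deriv_unique:
  assumes f: "continuous_on {0..1} f" and h1: "has_weak_deriv f h1" and h2: "has_weak_deriv f h2"
  shows "AE x in unit_lborel. h1 x = h2 x"
proof -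
  define d where "d x = indicator {0<..<1} x * (h1 x - h2 x)" for x :: real
  have i: "integrable unit_lborel h1" "integrable unit_lborel h2"
    using h1 h2 square_integrable_unit_imp_integrable by (auto simp: has_weak_deriv_def)
  have "integrable unit_lborel (\<lambda>x. h1 x - h2 x)" using i by auto
  then have d: "integrable lborel d"
    unfolding d_def integrable_unit_iff set_integrable_def by simp
  have z: "(LINT x:{a<..<b}|lborel. d x) = 0" if ab: "0 \<le> a" "a \<le> b" "b \<le> 1" for a b
  proof -
    have "(LINT x:{a<..<b}|lborel. d x) = (LINT x|unit_lborel. indicator {a<..<b} x * (h1 x - h2 x))"
      unfolding LINT_unit_eq set_lebesgue_integral_def d_def
      by (intro Bochner_Integration.integral_cong) (auto simp: indicator_def)
    also have "\<dots> = (LINT x|unit_lborel. indicator {a<..<b} x * h1 x) - (LINT x|unit_lborel. indicator {a<..<b} x * h2 x)"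
      by (subst Bochner_Integration.integral_diff[symmetric])
        (use i in \<open>auto intro!: integrable_indicator_mult_unit simp: right_diff_distrib\<close>)
    also have "\<dots> = 0" using weak_deriv_FTC[OF f h1 ab] weak_deriv_FTC[OF f h2 ab] by simp
    finally show ?thesis .
  qed
  have "AE x in lborel. d x = 0"
  proof (rule AE_zero_of_interval_integrals[OF d])
    have "(LINT x|lborel. d x) = (LINT x:{0<..<1}|lborel. d x)"
      unfolding set_lebesgue_integral_def d_def
      by (intro Bochner_Integration.integral_cong) (auto simp: indicator_def)
    then show "(LINT x|lborel. d x) = 0" using z[of 0 1] by simp
    fix a b :: real assume "a \<le> b"
    have "(LINT x:{a<..<b}|lborel. d x) = (LINT x:{max 0 a<..<min 1 b}|lborel. d x)"
      unfolding set_lebesgue_integral_def d_def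
      by (intro Bochner_Integration.integral_cong) (auto simp: indicator_def)
    also have "\<dots> = 0"
    proof (cases "max 0 a \<le> min 1 b")
      case False
      then have "{max 0 a<..<min 1 b} = {}" by auto
      then show ?thesis unfolding set_lebesgue_integral_def by simp
    qed (use z in simp)
    finally show "(LINT x:{a<..<b}|lborel. d x) = 0" .
  qed
  then show ?thesis
    by (subst AE_restrict_space_iff) (auto simp: d_def elim!: eventually_mono)
qed

section \<open>Linearity of the Sobolev space and of the form\<close>

lemma H1_continuous: "f \<in> H1 \<Longrightarrow> continuous_on {0..1} f"
  by (simp add: H1_def)

lemma has_weak_deriv_weak_deriv: "f \<in> H1 \<Longrightarrow> has_weak_deriv f (weak_deriv f)"
  using someI_ex[of "has_weak_deriv f"] by (simp add: H1_def weak_deriv_def)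

lemma has_weak_deriv_square_integrable: "has_weak_deriv f h \<Longrightarrow> h \<in> square_integrable unit_lborel"
  by (simp add: has_weak_deriv_def)

lemma H1_I: "continuous_on {0..1} f \<Longrightarrow> has_weak_deriv f h \<Longrightarrow> f \<in> H1"
  by (auto simp: H1_def)

lemma q_eq:
  assumes "f \<in> H1" "g \<in> H1" "has_weak_deriv f hf" "has_weak_deriv g hg"
  shows "q f g = (LINT x|unit_lborel. hf x * hg x)"
  unfolding q_def
proof (rule integral_cong_AE)
  note s = assms(3,4) assms(1,2)[THEN has_weak_deriv_weak_deriv]
  have [measurable]: "hf \<in> borel_measurable unit_lborel" "hg \<in> borel_measurable unit_lborel"
    "weak_deriv f \<in> borel_measurable unit_lborel" "weak_deriv g \<in> borel_measurable unit_lborel"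
    using s[THEN has_weak_deriv_square_integrable] by (auto simp: square_integrable_def)
  show "(\<lambda>x. weak_deriv f x * weak_deriv g x) \<in> borel_measurable unit_lborel"
    "(\<lambda>x. hf x * hg x) \<in> borel_measurable unit_lborel" by measurable
  show "AE x in unit_lborel. weak_deriv f x * weak_deriv g x = hf x * hg x"
    using weak_deriv_unique[OF H1_continuous[OF assms(1)] s(3,1)]
      weak_deriv_unique[OF H1_continuous[OF assms(2)] s(4,2)]
    by eventually_elim simp
qed

lemma integrable_mult_test_unit:
  assumes "\<phi> \<in> test_functions"
  shows "continuous_on {0..1} f \<Longrightarrow> integrable unit_lborel (\<lambda>x. f x * deriv \<phi> x)"
    "h \<in> square_integrable unit_lborel \<Longrightarrow> integrable unit_lborel (\<lambda>x. h x * \<phi> x)"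
  using integrable_continuous_mult_unit[OF _ integrable_continuous_unit[OF test_functionD(2)[OF assms]], of f]
    integrable_continuous_mult_unit[OF test_functionD(3)[OF assms] square_integrable_unit_imp_integrable[of h]]
  by (simp_all add: mult.commute)

lemma has_weak_deriv_add:
  assumes "continuous_on {0..1} f" "continuous_on {0..1} g" "has_weak_deriv f hf" "has_weak_deriv g hg"
  shows "has_weak_deriv (\<lambda>x. f x + g x) (\<lambda>x. hf x + hg x)"
  unfolding has_weak_deriv_def
proof (intro conjI ballI)
  have s: "hf \<in> square_integrable unit_lborel" "hg \<in> square_integrable unit_lborel"
    using assms by (auto simp: has_weak_deriv_def)
  then show "(\<lambda>x. hf x + hg x) \<in> square_integrable unit_lborel" by (rule square_integrable_add)
  fix \<phi> assume \<phi>: "\<phi> \<in> test_functions"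
  show "(LINT x|unit_lborel. (f x + g x) * deriv \<phi> x) = - (LINT x|unit_lborel. (hf x + hg x) * \<phi> x)"
    using assms(3,4) \<phi> integrable_mult_test_unit(1)[OF \<phi> assms(1)] integrable_mult_test_unit(1)[OF \<phi> assms(2)]
      integrable_mult_test_unit(2)[OF \<phi> s(1)] integrable_mult_test_unit(2)[OF \<phi> s(2)]
    by (simp add: has_weak_deriv_def distrib_right)
qed

lemma has_weak_deriv_cmult:
  assumes "has_weak_deriv f h"
  shows "has_weak_deriv (\<lambda>x. c * f x) (\<lambda>x. c * h x)"
  using assms by (auto simp: has_weak_deriv_def square_integrable_cmult mult.assoc)

lemma H1_add: "f \<in> H1 \<Longrightarrow> g \<in> H1 \<Longrightarrow> (\<lambda>x. f x + g x) \<in> H1"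
  by (rule H1_I[OF _ has_weak_deriv_add[OF _ _ has_weak_deriv_weak_deriv has_weak_deriv_weak_deriv]])
    (auto intro: continuous_on_add H1_continuous)

lemma H1_cmult: "f \<in> H1 \<Longrightarrow> (\<lambda>x. c * f x) \<in> H1"
  by (rule H1_I[OF _ has_weak_deriv_cmult[OF has_weak_deriv_weak_deriv]])
    (auto intro: continuous_on_mult_left H1_continuous)

lemma q_commute: "q f g = q g f"
  by (simp add: q_def mult.commute)

lemma q_integrable:
  assumes "f \<in> H1" "g \<in> H1"
  shows "integrable unit_lborel (\<lambda>x. weak_deriv f x * weak_deriv g x)"
  using assms[THEN has_weak_deriv_weak_deriv, THEN has_weak_deriv_square_integrable]
  by (rule square_integrable_mult_integrable)

lemma q_add_left:
  assumes "f \<in> H1" "g \<in> H1" "h \<in> H1"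
  shows "q (\<lambda>x. f x + g x) h = q f h + q g h"
proof -
  have "q (\<lambda>x. f x + g x) h = (LINT x|unit_lborel. (weak_deriv f x + weak_deriv g x) * weak_deriv h x)"
    by (rule q_eq[OF H1_add assms(3) has_weak_deriv_add])
      (use assms in \<open>auto intro: has_weak_deriv_weak_deriv H1_continuous\<close>)
  then show ?thesis
    using q_integrable[OF assms(1,3)] q_integrable[OF assms(2,3)]
    by (simp add: q_def distrib_right)
qed

lemma q_cmult_left:
  assumes "f \<in> H1" "h \<in> H1"
  shows "q (\<lambda>x. c * f x) h = c * q f h"
proof -
  have "q (\<lambda>x. c * f x) h = (LINT x|unit_lborel. (c * weak_deriv f x) * weak_deriv h x)"
    by (rule q_eq[OF H1_cmult assms(2) has_weak_deriv_cmult])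
      (use assms in \<open>auto intro: has_weak_deriv_weak_deriv\<close>)
  then show ?thesis by (simp add: q_def mult.assoc)
qed

lemma has_weak_deriv_const: "has_weak_deriv (\<lambda>x. c) (\<lambda>x. 0)"
  unfolding has_weak_deriv_def
proof (intro conjI ballI)
  fix \<phi> assume \<phi>: "\<phi> \<in> test_functions"
  have "(deriv \<phi> has_integral (\<phi> 1 - \<phi> 0)) {0..1}"
    using test_functionD(1)[OF \<phi>]
    by (intro fundamental_theorem_of_calculus)
      (auto simp: has_real_derivative_iff_has_vector_derivative has_vector_derivative_at_within)
  then have "(deriv \<phi> has_integral 0) {0..1}" using test_functionD(4)[OF \<phi>] by simp
  moreover have "set_integrable lborel {0<..<1} (deriv \<phi>)"
    using integrable_continuous_unit[OF test_functionD(2)[OF \<phi>]] by (simp add: integrable_unit_iff)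
  ultimately have "(LINT x|unit_lborel. deriv \<phi> x) = 0"
    unfolding LINT_unit_eq
    by (metis set_borel_integral_eq_integral(2) integral_unique has_integral_Icc_iff_Ioo)
  then show "(LINT x|unit_lborel. c * deriv \<phi> x) = - (LINT x|unit_lborel. 0 * \<phi> x)" by simp
qed (simp add: square_integrable_def)

lemma H1_const: "(\<lambda>x. c) \<in> H1"
  using H1_I[OF _ has_weak_deriv_const] by simp

lemma q_const_left: "g \<in> H1 \<Longrightarrow> q (\<lambda>x. c) g = 0"
  using q_eq[OF H1_const _ has_weak_deriv_const has_weak_deriv_weak_deriv] by simp

lemma H1_sum: "(\<And>i. i \<in> I \<Longrightarrow> f i \<in> H1) \<Longrightarrow> (\<lambda>x. \<Sum>i\<in>I. f i x) \<in> H1"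
  by (induction I rule: infinite_finite_induct) (auto intro: H1_add H1_const)

lemma q_sum_left:
  "(\<And>i. i \<in> I \<Longrightarrow> f i \<in> H1) \<Longrightarrow> g \<in> H1 \<Longrightarrow> q (\<lambda>x. \<Sum>i\<in>I. f i x) g = (\<Sum>i\<in>I. q (f i) g)"
  by (induction I rule: infinite_finite_induct) (auto simp: q_const_left q_add_left H1_sum)

text \<open>For a \<le> b, the antiderivative of the indicator of the interval from a to b. It
  represents the increment g b - g a in the form \<open>q\<close>, which lets harmonicity and
  eigenvalue equations be read off from point values.\<close>

definition ramp :: "real \<Rightarrow> real \<Rightarrow> real \<Rightarrow> real" where
  "ramp a b x = max 0 (min x b - a)"

lemma continuous_on_ramp: "continuous_on S (ramp a b)"
  unfolding ramp_def[abs_def] by (intro continuous_intros)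

lemma ramp_has_derivative:
  assumes "a \<le> b" "x \<noteq> a" "x \<noteq> b"
  shows "(ramp a b has_real_derivative indicator {a<..<b} x) (at x)"
proof -
  consider "x < a" | "a < x" "x < b" | "b < x" using assms by linarith
  then show ?thesis
  proof cases
    case 1
    have "((\<lambda>x. 0) has_real_derivative indicator {a<..<b} x) (at x)" using 1 by simp
    then show ?thesis
      by (rule has_field_derivative_transform_within_open[of _ _ _ "{..<a}"])
        (use 1 assms in \<open>auto simp: ramp_def\<close>)
  next
    case 2
    have "((\<lambda>x. x - a) has_real_derivative indicator {a<..<b} x) (at x)"
      using 2 by (auto intro!: derivative_eq_intros)
    then show ?thesis
      by (rule has_field_derivative_transform_within_open[of _ _ _ "{a<..<b}"])
        (use 2 assms in \<open>auto simp: ramp_def\<close>)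
  next
    case 3
    have "((\<lambda>x. b - a) has_real_derivative indicator {a<..<b} x) (at x)" using 3 by simp
    then show ?thesis
      by (rule has_field_derivative_transform_within_open[of _ _ _ "{b<..}"])
        (use 3 assms in \<open>auto simp: ramp_def\<close>)
  qed
qed

lemma has_weak_deriv_ramp:
  assumes ab: "a \<le> b"
  shows "has_weak_deriv (ramp a b) (indicator {a<..<b})"
  unfolding has_weak_deriv_def
proof (intro conjI ballI)
  have m: "(indicator {a<..<b} :: real \<Rightarrow> real) \<in> borel_measurable unit_lborel"
    by (rule indicator_measurable_unit) simp
  have sq: "(indicator {a<..<b} x :: real)\<^sup>2 = indicator {a<..<b} x * 1" for x
    by (auto simp: indicator_def)
  show s: "indicator {a<..<b} \<in> square_integrable unit_lborel"
    using m integrable_indicator_mult_unit[OF integrable_one_unit[of 1], of "{a<..<b}"]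
    by (simp only: square_integrable_def mem_Collect_eq sq) simp
  fix \<phi> assume \<phi>: "\<phi> \<in> test_functions"
  note i = integrable_mult_test_unit(1)[OF \<phi> continuous_on_ramp[of _ a b]] integrable_mult_test_unit(2)[OF \<phi> s]
  let ?g = "\<lambda>x. ramp a b x * deriv \<phi> x + indicator {a<..<b} x * \<phi> x"
  \<comment> \<open>Integration by parts: off the two kinks \<open>?g\<close> is the derivative of
    \<open>ramp a b\<close> times the test function, and the latter vanishes at 0 and 1.\<close>
  have "(?g has_integral (ramp a b 1 * \<phi> 1 - ramp a b 0 * \<phi> 0)) {0..1}"
  proof (rule fundamental_theorem_of_calculus_interior_strong[of "{a, b}"])
    fix x assume "x \<in> {0<..<1} - {a, b}"
    then have "((\<lambda>x. ramp a b x * \<phi> x) has_real_derivative ?g x) (at x)"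
      using DERIV_mult[OF ramp_has_derivative[OF ab] test_functionD(1)[OF \<phi>], of x]
      by (simp add: algebra_simps)
    then show "((\<lambda>x. ramp a b x * \<phi> x) has_vector_derivative ?g x) (at x)"
      by (simp add: has_real_derivative_iff_has_vector_derivative)
  next
    show "continuous_on {0..1} (\<lambda>x. ramp a b x * \<phi> x)"
      using test_functionD(3)[OF \<phi>] continuous_on_ramp by (rule continuous_on_mult[rotated])
  qed auto
  then have "(?g has_integral 0) {0..1}" using test_functionD(4)[OF \<phi>] by simp
  moreover have "set_integrable lborel {0<..<1} ?g"
    using i by (simp flip: integrable_unit_iff)
  ultimately have "(LINT x|unit_lborel. ?g x) = 0"
    unfolding LINT_unit_eq
    by (metis set_borel_integral_eq_integral(2) integral_unique has_integral_Icc_iff_Ioo)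
  then show "(LINT x|unit_lborel. ramp a b x * deriv \<phi> x) = - (LINT x|unit_lborel. indicator {a<..<b} x * \<phi> x)"
    using i by simp
qed

lemma H1_ramp: "a \<le> b \<Longrightarrow> ramp a b \<in> H1"
  using H1_I[OF continuous_on_ramp has_weak_deriv_ramp] .

lemma q_ramp_left:
  assumes "0 \<le> a" "a \<le> b" "b \<le> 1" "g \<in> H1"
  shows "q (ramp a b) g = g b - g a"
  using q_eq[OF H1_ramp assms(4) has_weak_deriv_ramp has_weak_deriv_weak_deriv]
    weak_deriv_FTC[OF H1_continuous has_weak_deriv_weak_deriv] assms by simp

text \<open>The witness is the integral of (f')^2 over 0 to x. The estimates on the pieces of a
  partition work with these four properties and never touch f' again.\<close>

lemma H1_energy:
  assumes f: "f \<in> H1"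
  obtains e :: "real \<Rightarrow> real" where "e 0 = 0" "e 1 = q f f"
    "\<And>a b. 0 \<le> a \<Longrightarrow> a \<le> b \<Longrightarrow> b \<le> 1 \<Longrightarrow> e a \<le> e b"
    "\<And>a b. 0 \<le> a \<Longrightarrow> a \<le> b \<Longrightarrow> b \<le> 1 \<Longrightarrow> (f b - f a)\<^sup>2 \<le> (b - a) * (e b - e a)"
proof -
  define h where "h = weak_deriv f"
  have h: "has_weak_deriv f h" unfolding h_def using f by (rule has_weak_deriv_weak_deriv)
  have s: "h \<in> square_integrable unit_lborel" using h by (rule has_weak_deriv_square_integrable)
  have h1: "integrable unit_lborel h" using s by (rule square_integrable_unit_imp_integrable)
  have h2: "integrable unit_lborel (\<lambda>x. (h x)\<^sup>2)" using s by (simp add: square_integrable_def)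
  define e where "e x = (LINT y|unit_lborel. indicator {0<..x} y * (h y)\<^sup>2)" for x :: real
  have ie: "integrable unit_lborel (\<lambda>y. indicator {0<..x} y * (h y)\<^sup>2)"
    "integrable unit_lborel (\<lambda>y. indicator {x<..<z} y * (h y)\<^sup>2)" for x z :: real
    using integrable_indicator_mult_unit[OF h2] by auto
  have key: "(LINT y|unit_lborel. indicator {a<..<b} y * (h y)\<^sup>2) \<le> e b - e a"
    if "0 \<le> a" "a \<le> b" for a b
  proof -
    have "e b - e a = (LINT y|unit_lborel. indicator {0<..b} y * (h y)\<^sup>2 - indicator {0<..a} y * (h y)\<^sup>2)"
      unfolding e_def using ie by simp
    also have "\<dots> \<ge> (LINT y|unit_lborel. indicator {a<..<b} y * (h y)\<^sup>2)"
      using that by (intro integral_mono ie Bochner_Integration.integrable_diff) (auto simp: indicator_def)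
    finally show ?thesis by simp
  qed
  show ?thesis
  proof
    show "e 0 = 0" by (simp add: e_def)
    have "q f f = (LINT x|unit_lborel. h x * h x)" using q_eq[OF f f h h] .
    also have "\<dots> = e 1" unfolding e_def
      by (intro Bochner_Integration.integral_cong) (auto simp: space_restrict_space indicator_def power2_eq_square)
    finally show "e 1 = q f f" by simp
    fix a b :: real assume ab: "0 \<le> a" "a \<le> b" "b \<le> 1"
    have "0 \<le> (LINT y|unit_lborel. indicator {a<..<b} y * (h y)\<^sup>2)"
      by (rule Bochner_Integration.integral_nonneg) (simp add: indicator_def)
    then show "e a \<le> e b" using key[OF ab(1,2)] by linarith
    show "(f b - f a)\<^sup>2 \<le> (b - a) * (e b - e a)"
    proof (cases "a = b")
      case False
      define D where "D = f b - f a"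
      \<comment> \<open>The mean slope: expanding the integral of (h - c)^2, which is nonnegative,
        gives Cauchy-Schwarz on the interval.\<close>
      define c where "c = D / (b - a)"
      have D: "(LINT x|unit_lborel. indicator {a<..<b} x * h x) = D"
        unfolding D_def using weak_deriv_FTC[OF H1_continuous[OF f] h ab] by simp
      have L: "(LINT x|unit_lborel. indicator {a<..<b} x) = b - a"
      proof -
        have "(LINT x|unit_lborel. indicator {a<..<b} x) = (LINT x|lborel. indicator {a<..<b} x :: real)"
          unfolding LINT_unit_eq set_lebesgue_integral_def using ab
          by (intro Bochner_Integration.integral_cong) (auto simp: indicator_def)
        then show ?thesis using ab by simp
      qed
      have i: "integrable unit_lborel (\<lambda>x. indicator {a<..<b} x * h x)"
        "integrable unit_lborel (\<lambda>x. indicator {a<..<b} x :: real)"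
        using integrable_indicator_mult_unit[OF h1] integrable_indicator_mult_unit[OF integrable_one_unit[of 1]] by auto
      have "0 \<le> (LINT x|unit_lborel. indicator {a<..<b} x * (h x - c)\<^sup>2)" by simp
      also have "\<dots> = (LINT x|unit_lborel. indicator {a<..<b} x * (h x)\<^sup>2 - 2 * c * (indicator {a<..<b} x * h x) + c\<^sup>2 * indicator {a<..<b} x)"
        by (intro Bochner_Integration.integral_cong) (auto simp: power2_eq_square algebra_simps)
      also have "\<dots> = (LINT x|unit_lborel. indicator {a<..<b} x * (h x)\<^sup>2) - 2 * c * D + c\<^sup>2 * (b - a)"
        using i ie(2) D L by simp
      also have "\<dots> \<le> (e b - e a) - 2 * c * D + c\<^sup>2 * (b - a)" using key[OF ab(1,2)] by simp
      also have "\<dots> = (e b - e a) - D\<^sup>2 / (b - a)"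
      proof -
        have "c * (b - a) = D" using False by (simp add: c_def)
        then have "c\<^sup>2 * (b - a) = c * D" by (simp add: power2_eq_square mult.assoc)
        moreover have "D\<^sup>2 / (b - a) = c * D" by (simp add: c_def power2_eq_square)
        ultimately show ?thesis by simp
      qed
      finally have "D\<^sup>2 / (b - a) \<le> e b - e a" by simp
      then show ?thesis using False ab by (simp add: D_def field_simps)
    qed simp
  qed
qed

section \<open>Probability measures on the path\<close>

lemma P_prob_space: "\<mu> \<in> P_prob_measures \<Longrightarrow> space \<mu> = {0..1}"
  using sets_eq_imp_space_eq[of \<mu> P_borel] by (simp add: P_prob_measures_def space_restrict_space)

lemma P_prob_sets_iff: "\<mu> \<in> P_prob_measures \<Longrightarrow> A \<in> sets \<mu> \<longleftrightarrow> A \<in> sets borel \<and> A \<subseteq> {0..1}"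
  by (auto simp: P_prob_measures_def sets_restrict_space_iff)

lemma P_prob_prob_space: "\<mu> \<in> P_prob_measures \<Longrightarrow> prob_space \<mu>"
  by (simp add: P_prob_measures_def)

lemma P_prob_finite_measure: "\<mu> \<in> P_prob_measures \<Longrightarrow> finite_measure \<mu>"
  by (simp add: P_prob_measures_def prob_space_def)

lemma P_prob_measurable:
  fixes f :: "real \<Rightarrow> real"
  assumes "\<mu> \<in> P_prob_measures" "continuous_on {0..1} f"
  shows "f \<in> borel_measurable \<mu>"
  using borel_measurable_continuous_on_restrict[OF assms(2)] assms(1)
  by (simp add: P_prob_measures_def measurable_cong_sets[of \<mu> P_borel])

lemma P_prob_integrable:
  fixes f :: "real \<Rightarrow> real"
  assumes "\<mu> \<in> P_prob_measures" "continuous_on {0..1} f"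
  shows "integrable \<mu> f"
proof -
  obtain B where "\<And>x. x \<in> {0..1} \<Longrightarrow> \<bar>f x\<bar> \<le> B"
    using continuous_imp_bounded_unit[OF assms(2)] by metis
  then show ?thesis
    using assms P_prob_finite_measure P_prob_measurable P_prob_space[OF assms(1)]
    by (intro finite_measure.integrable_const_bound[where B=B]) (auto intro!: AE_I2)
qed

lemma H1_square_integrable:
  assumes "\<mu> \<in> P_prob_measures" "f \<in> H1"
  shows "f \<in> square_integrable \<mu>"
  using P_prob_measurable[OF assms(1) H1_continuous[OF assms(2)]]
    P_prob_integrable[OF assms(1) continuous_on_power[OF H1_continuous[OF assms(2)]], of 2]
  by (simp add: square_integrable_def)

lemma H1_mult_integrable:
  "\<mu> \<in> P_prob_measures \<Longrightarrow> f \<in> H1 \<Longrightarrow> g \<in> H1 \<Longrightarrow> integrable \<mu> (\<lambda>x. f x * g x)"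
  by (rule square_integrable_mult_integrable) (auto intro: H1_square_integrable)

section \<open>The support of a measure\<close>

lemma supp_iff:
  "x \<in> supp \<mu> \<longleftrightarrow> x \<in> {0..1} \<and> (\<forall>V. open V \<longrightarrow> x \<in> V \<longrightarrow> emeasure \<mu> ({0..1} \<inter> V) > 0)"
proof -
  have "(\<forall>U. openin (top_of_set {0..1}) U \<and> x \<in> U \<longrightarrow> emeasure \<mu> U > 0) \<longleftrightarrow>
      (\<forall>V. open V \<longrightarrow> x \<in> V \<longrightarrow> emeasure \<mu> ({0..1} \<inter> V) > 0)" if "x \<in> {0..1}"
    using that unfolding openin_open by blast
  then show ?thesis unfolding supp_def by blast
qed

lemma supp_subset: "supp \<mu> \<subseteq> {0..1}"
  by (auto simp: supp_def)

lemma closed_supp: "closed (supp \<mu>)"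
proof -
  have "supp \<mu> = {0..1} - \<Union>{V. open V \<and> emeasure \<mu> ({0..1} \<inter> V) = 0}"
    unfolding set_eq_iff supp_iff zero_less_iff_neq_zero by blast
  then show ?thesis by (auto intro!: closed_Diff)
qed

text \<open>Second countability: the complement of the support is covered by countably many basic
  open sets of measure zero.\<close>

lemma AE_supp:
  assumes "\<mu> \<in> P_prob_measures"
  shows "AE x in \<mu>. x \<in> supp \<mu>"
proof -
  obtain B :: "real set set" where B: "countable B" "topological_basis B"
    using ex_countable_basis by blast
  define N where "N = {b \<in> B. emeasure \<mu> ({0..1} \<inter> b) = 0}"
  have cN: "countable N" unfolding N_def using B(1) by simp
  have "(\<Union>b\<in>N. {0..1} \<inter> b) \<in> null_sets \<mu>"
  proof (rule null_sets_UN'[OF cN])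
    fix b assume b: "b \<in> N"
    then have "open b" using B(2) topological_basis_open by (auto simp: N_def)
    then show "{0..1} \<inter> b \<in> null_sets \<mu>" using b assms by (auto simp: N_def null_sets_def P_prob_sets_iff)
  qed
  then show ?thesis
  proof (rule AE_I')
    show "{x \<in> space \<mu>. \<not> x \<in> supp \<mu>} \<subseteq> (\<Union>b\<in>N. {0..1} \<inter> b)"
    proof
      fix x assume "x \<in> {x \<in> space \<mu>. \<not> x \<in> supp \<mu>}"
      then obtain V where x: "x \<in> {0..1}" and V: "open V" "x \<in> V" "emeasure \<mu> ({0..1} \<inter> V) = 0"
        using P_prob_space[OF assms] by (auto simp: supp_iff)
      obtain b where b: "b \<in> B" "x \<in> b" "b \<subseteq> V"
        using topological_basisE[OF B(2) V(1,2)] by metis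
      have "emeasure \<mu> ({0..1} \<inter> b) \<le> emeasure \<mu> ({0..1} \<inter> V)"
        using b V assms by (intro emeasure_mono) (auto simp: P_prob_sets_iff)
      then show "x \<in> (\<Union>b\<in>N. {0..1} \<inter> b)" using b x V by (auto simp: N_def)
    qed
  qed
qed

lemma supp_nonempty:
  assumes "\<mu> \<in> P_prob_measures"
  shows "supp \<mu> \<noteq> {}"
  using AE_supp[OF assms] prob_space.AE_False[OF P_prob_prob_space[OF assms]] by auto

lemma atom_in_supp:
  assumes "\<mu> \<in> P_prob_measures" "x \<in> {0..1}" "measure \<mu> {x} > 0"
  shows "x \<in> supp \<mu>"
  unfolding supp_iff
proof (intro conjI allI impI)
  fix V :: "real set" assume V: "open V" "x \<in> V"
  have "emeasure \<mu> {x} > 0" using assms(3) by (simp add: measure_def enn2real_positive_iff)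
  also have "emeasure \<mu> {x} \<le> emeasure \<mu> ({0..1} \<inter> V)"
    using V assms by (intro emeasure_mono) (auto simp: P_prob_sets_iff)
  finally show "emeasure \<mu> ({0..1} \<inter> V) > 0" .
qed fact

section \<open>Functions harmonic off the support\<close>

lemma H1_mu_iff: "f \<in> H1_mu \<mu> \<longleftrightarrow> f \<in> H1 \<and> (\<forall>g\<in>H1. (\<forall>x\<in>supp \<mu>. g x = 0) \<longrightarrow> q f g = 0)"
proof -
  have "{0..1} - ({0..1} - supp \<mu>) = supp \<mu>" using supp_subset by blast
  then show ?thesis by (auto simp: H1_mu_def harmonic_on_def)
qed

lemma H1_mu_add: "f \<in> H1_mu \<mu> \<Longrightarrow> g \<in> H1_mu \<mu> \<Longrightarrow> (\<lambda>x. f x + g x) \<in> H1_mu \<mu>"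
  by (simp add: H1_mu_iff H1_add q_add_left)

lemma H1_mu_cmult: "f \<in> H1_mu \<mu> \<Longrightarrow> (\<lambda>x. c * f x) \<in> H1_mu \<mu>"
  by (simp add: H1_mu_iff H1_cmult q_cmult_left)

lemma H1_mu_const: "(\<lambda>x. c) \<in> H1_mu \<mu>"
  by (simp add: H1_mu_iff H1_const q_const_left)

lemma H1_mu_sum: "(\<And>i. i \<in> I \<Longrightarrow> f i \<in> H1_mu \<mu>) \<Longrightarrow> (\<lambda>x. \<Sum>i\<in>I. f i x) \<in> H1_mu \<mu>"
  by (induction I rule: infinite_finite_induct) (auto intro: H1_mu_add H1_mu_const)

text \<open>By \<open>q_ramp_left\<close>, pairing with the ramp evaluates a function at s and t
  only, so functions vanishing on the support are annihilated.\<close>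

lemma H1_mu_ramp:
  assumes "s \<in> supp \<mu>" "t \<in> supp \<mu>" "s \<le> t"
  shows "ramp s t \<in> H1_mu \<mu>"
proof -
  have "0 \<le> s" "t \<le> 1" using assms supp_subset[of \<mu>] by auto
  then show ?thesis using assms q_ramp_left[of s t] by (simp add: H1_mu_iff H1_ramp)
qed

text \<open>\<open>ramp b 1\<close> need not be harmonic off the support, but on the support it
  agrees with a combination of a constant and ramps whose end points lie there: a kink in a gap is
  shared out between the two edges of the gap, and the end point 1 is replaced by the maximum M of
  the support.\<close>

lemma ramp_interpolation_on_supp:
  assumes \<mu>: "\<mu> \<in> P_prob_measures" and b: "b \<in> {0..1}"
  obtains \<psi> where "\<psi> \<in> H1_mu \<mu>" "\<And>x. x \<in> supp \<mu> \<Longrightarrow> \<psi> x = ramp b 1 x"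
proof -
  let ?S = "supp \<mu>"
  have bdd: "bdd_above ?S" "bdd_below ?S"
    using bdd_above_mono[OF bdd_above_Icc supp_subset] bdd_below_mono[OF bdd_below_Icc supp_subset] .
  define M where "M = Sup ?S"
  define m where "m = Inf ?S"
  have M: "M \<in> ?S" unfolding M_def
    using closed_contains_Sup[OF supp_nonempty[OF \<mu>] bdd(1) closed_supp] .
  have m: "m \<in> ?S" unfolding m_def
    using closed_contains_Inf[OF supp_nonempty[OF \<mu>] bdd(2) closed_supp] .
  have leM: "x \<le> M" if "x \<in> ?S" for x unfolding M_def using cSup_upper[OF that bdd(1)] .
  have gem: "m \<le> x" if "x \<in> ?S" for x unfolding m_def using cInf_lower[OF that bdd(2)] .
  have S01: "0 \<le> x" "x \<le> 1" if "x \<in> ?S" for x using supp_subset[of \<mu>] that by auto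
  have rM: "ramp s M x = ramp s 1 x" if "x \<in> ?S" for s x
    using leM[OF that] S01[OF that] by (simp add: ramp_def)
  consider "b \<in> ?S" | "b < m" | "M < b" | "b \<notin> ?S" "m \<le> b" "b \<le> M" by linarith
  then show ?thesis
  proof cases
    case 1
    show ?thesis using that[OF H1_mu_ramp[OF 1 M leM[OF 1]] rM] .
  next
    case 2
    show ?thesis
    proof (rule that[of "\<lambda>x. ramp m M x + (m - b)"])
      show "(\<lambda>x. ramp m M x + (m - b)) \<in> H1_mu \<mu>"
        by (rule H1_mu_add[OF H1_mu_ramp[OF m M leM[OF m]] H1_mu_const])
      fix x assume "x \<in> ?S"
      then show "ramp m M x + (m - b) = ramp b 1 x"
        using gem[of x] leM[of x] S01[of x] 2 by (simp add: ramp_def)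
    qed
  next
    case 3
    show ?thesis
    proof (rule that[OF H1_mu_const[of 0]])
      fix x assume "x \<in> ?S"
      then show "0 = ramp b 1 x" using leM[of x] 3 by (simp add: ramp_def)
    qed
  next
    case 4
    define l where "l = Sup (?S \<inter> {..b})"
    define r where "r = Inf (?S \<inter> {b..})"
    have bl: "bdd_above (?S \<inter> {..b})" "bdd_below (?S \<inter> {b..})"
      by (rule bdd_above_mono[OF bdd(1)], simp) (rule bdd_below_mono[OF bdd(2)], simp)
    have ne: "?S \<inter> {..b} \<noteq> {}" "?S \<inter> {b..} \<noteq> {}" using m M 4 by auto
    have l: "l \<in> ?S \<inter> {..b}" unfolding l_def
      by (rule closed_contains_Sup[OF ne(1) bl(1)]) (simp add: closed_Int closed_supp)
    have r: "r \<in> ?S \<inter> {b..}" unfolding r_def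
      by (rule closed_contains_Inf[OF ne(2) bl(2)]) (simp add: closed_Int closed_supp)
    have lb: "l < b" "b < r" using l r 4(1) by (auto simp: order_le_less)
    have gap: "x \<le> l \<or> r \<le> x" if "x \<in> ?S" for x
      using cSup_upper[OF _ bl(1), of x] cInf_lower[OF _ bl(2), of x] that
      unfolding l_def r_def by force
    \<comment> \<open>Chosen so that \<theta> * l + (1 - \<theta>) * r = b; both sides then agree at
      the points of the support to the right of the gap.\<close>
    define \<theta> where "\<theta> = (r - b) / (r - l)"
    show ?thesis
    proof (rule that[of "\<lambda>x. \<theta> * ramp l M x + (1 - \<theta>) * ramp r M x"])
      show "(\<lambda>x. \<theta> * ramp l M x + (1 - \<theta>) * ramp r M x) \<in> H1_mu \<mu>"
        using l r M leM by (intro H1_mu_add H1_mu_cmult H1_mu_ramp) auto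
      fix x assume x: "x \<in> ?S"
      show "\<theta> * ramp l M x + (1 - \<theta>) * ramp r M x = ramp b 1 x"
      proof (cases "x \<le> l")
        case True
        then show ?thesis using lb by (simp add: ramp_def)
      next
        case False
        then have xr: "r \<le> x" using gap[OF x] by simp
        have "\<theta> * (r - l) = r - b" using lb by (simp add: \<theta>_def)
        then have "\<theta> * (x - l) + (1 - \<theta>) * (x - r) = x - b" by (simp add: algebra_simps)
        moreover have "ramp l M x = x - l" "ramp r M x = x - r" "ramp b 1 x = x - b"
          using xr lb leM[OF x] S01[OF x] by (auto simp: ramp_def)
        ultimately show ?thesis by simp
      qed
    qed
  qed
qed

section \<open>Eigenspaces\<close>

lemma eigenspace_iff:
  assumes "\<mu> \<in> P_prob_measures"
  shows "f \<in> eigenspace \<mu> l \<longleftrightarrow> f \<in> H1_mu \<mu> \<and> (\<forall>\<phi>\<in>H1_mu \<mu>. q f \<phi> = l * (LINT x|\<mu>. f x * \<phi> x))"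
  using H1_square_integrable[OF assms H1_cmult, of f l]
  by (auto simp: eigenspace_def H_op_def mult.assoc H1_mu_iff)

lemma eigenspaceD:
  assumes "\<mu> \<in> P_prob_measures" "f \<in> eigenspace \<mu> l"
  shows "f \<in> H1_mu \<mu>" "f \<in> H1" "\<phi> \<in> H1_mu \<mu> \<Longrightarrow> q f \<phi> = l * (LINT x|\<mu>. f x * \<phi> x)"
  using assms eigenspace_iff by (auto simp: H1_mu_iff)

lemma eigenspace_sum:
  assumes "\<mu> \<in> P_prob_measures" "\<And>i. i \<in> I \<Longrightarrow> f i \<in> eigenspace \<mu> l"
  shows "(\<lambda>x. \<Sum>i\<in>I. c i * f i x) \<in> eigenspace \<mu> l"
  unfolding eigenspace_iff[OF assms(1)]
proof (intro conjI ballI)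
  show "(\<lambda>x. \<Sum>i\<in>I. c i * f i x) \<in> H1_mu \<mu>"
    using assms eigenspaceD by (intro H1_mu_sum H1_mu_cmult) blast
  fix \<phi> assume \<phi>: "\<phi> \<in> H1_mu \<mu>"
  then have \<phi>': "\<phi> \<in> H1" by (simp add: H1_mu_iff)
  have f: "f i \<in> H1" if "i \<in> I" for i using eigenspaceD assms that by blast
  have "q (\<lambda>x. \<Sum>i\<in>I. c i * f i x) \<phi> = (\<Sum>i\<in>I. q (\<lambda>x. c i * f i x) \<phi>)"
    by (rule q_sum_left) (use f \<phi>' H1_cmult in auto)
  also have "\<dots> = (\<Sum>i\<in>I. l * (LINT x|\<mu>. c i * (f i x * \<phi> x)))"
    by (rule sum.cong) (use f \<phi>' \<phi> eigenspaceD(3)[OF assms(1) assms(2)] in \<open>auto simp: q_cmult_left\<close>)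
  also have "\<dots> = l * (LINT x|\<mu>. (\<Sum>i\<in>I. c i * (f i x * \<phi> x)))"
    unfolding sum_distrib_left[symmetric]
    by (subst Bochner_Integration.integral_sum) (use f \<phi>' H1_mult_integrable[OF assms(1)] in auto)
  also have "(\<lambda>x. \<Sum>i\<in>I. c i * (f i x * \<phi> x)) = (\<lambda>x. (\<Sum>i\<in>I. c i * f i x) * \<phi> x)"
    by (simp add: sum_distrib_right mult.assoc)
  finally show "q (\<lambda>x. \<Sum>i\<in>I. c i * f i x) \<phi> = l * (LINT x|\<mu>. (\<Sum>i\<in>I. c i * f i x) * \<phi> x)" .
qed

lemma eigenspace_orthogonal:
  assumes "\<mu> \<in> P_prob_measures" "f \<in> eigenspace \<mu> l" "g \<in> eigenspace \<mu> l'" "l \<noteq> l'"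
  shows "(LINT x|\<mu>. f x * g x) = 0"
proof -
  have "l * (LINT x|\<mu>. f x * g x) = q f g" using eigenspaceD assms by metis
  also have "\<dots> = q g f" by (rule q_commute)
  also have "\<dots> = l' * (LINT x|\<mu>. g x * f x)" using eigenspaceD assms by metis
  finally show ?thesis using assms(4) by (simp add: mult.commute)
qed

text \<open>A function in \<open>H1_mu\<close> pairs with a test function only through the values of the latter on the
  support, so the eigenvalue equation extends to ramps with arbitrary kinks: an integrated form of
  \<open>- f'' = l f \<mu>\<close>.\<close>

lemma eigenfunction_Volterra:
  assumes \<mu>: "\<mu> \<in> P_prob_measures" and f: "f \<in> eigenspace \<mu> l" and b: "b \<in> {0..1}"
  shows "f 1 - f b = l * (LINT x|\<mu>. f x * ramp b 1 x)"
proof -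
  obtain \<psi> where \<psi>: "\<psi> \<in> H1_mu \<mu>" "\<And>x. x \<in> supp \<mu> \<Longrightarrow> \<psi> x = ramp b 1 x"
    using ramp_interpolation_on_supp[OF \<mu> b] by metis
  have fH: "f \<in> H1_mu \<mu>" "f \<in> H1" using eigenspaceD[OF \<mu> f] by auto
  have \<psi>H: "\<psi> \<in> H1" using \<psi> by (simp add: H1_mu_iff)
  have rH: "ramp b 1 \<in> H1" using H1_ramp b by simp
  let ?g = "\<lambda>x. ramp b 1 x + (-1) * \<psi> x"
  have "?g \<in> H1" by (rule H1_add[OF rH H1_cmult[OF \<psi>H]])
  moreover have "\<forall>x\<in>supp \<mu>. ?g x = 0" using \<psi>(2) by simp
  ultimately have "q f ?g = 0" using fH by (simp add: H1_mu_iff)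
  moreover have "q f ?g = q ?g f" by (rule q_commute)
  moreover have "q ?g f = q (ramp b 1) f + q (\<lambda>x. (-1) * \<psi> x) f"
    by (rule q_add_left[OF rH H1_cmult[OF \<psi>H] fH(2)])
  moreover have "q (\<lambda>x. (-1) * \<psi> x) f = (-1) * q \<psi> f"
    by (rule q_cmult_left[OF \<psi>H fH(2)])
  ultimately have "q (ramp b 1) f = q \<psi> f" by linarith
  then have "f 1 - f b = q f \<psi>" using q_ramp_left[of b 1 f] b fH q_commute[of \<psi> f] by simp
  also have "\<dots> = l * (LINT x|\<mu>. f x * \<psi> x)" using eigenspaceD(3)[OF \<mu> f \<psi>(1)] .
  also have "(LINT x|\<mu>. f x * \<psi> x) = (LINT x|\<mu>. f x * ramp b 1 x)"
  proof (rule integral_cong_AE)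
    show "(\<lambda>x. f x * \<psi> x) \<in> borel_measurable \<mu>" "(\<lambda>x. f x * ramp b 1 x) \<in> borel_measurable \<mu>"
      using H1_mult_integrable[OF \<mu> fH(2)] \<psi>H rH by auto
    show "AE x in \<mu>. f x * \<psi> x = f x * ramp b 1 x"
      using AE_supp[OF \<mu>] by eventually_elim (simp add: \<psi>(2))
  qed
  finally show ?thesis .
qed

section \<open>Combinations of eigenfunctions\<close>

text \<open>Gaussian elimination, by induction on the number k of equations: the last equation is
  solved for a pivot unknown p, which is then substituted into the others.\<close>

lemma homogeneous_system_solution:
  fixes \<phi> :: "nat \<Rightarrow> 'a \<Rightarrow> real"
  assumes "finite I" "k < card I"
  shows "\<exists>c. (\<exists>i\<in>I. c i \<noteq> 0) \<and> (\<forall>j<k. (\<Sum>i\<in>I. c i * \<phi> j i) = 0)"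
  using assms
proof (induction k arbitrary: I \<phi>)
  case 0
  then have "I \<noteq> {}" by auto
  then show ?case by (intro exI[of _ "\<lambda>_. 1"]) auto
next
  case (Suc k)
  show ?case
  proof (cases "\<exists>p\<in>I. \<phi> k p \<noteq> 0")
    case False
    have "k < card I" using Suc.prems by simp
    from Suc.IH[OF Suc.prems(1) this, of \<phi>] obtain c
      where c: "\<exists>i\<in>I. c i \<noteq> 0" "\<forall>j<k. (\<Sum>i\<in>I. c i * \<phi> j i) = 0" by auto
    moreover have "(\<Sum>i\<in>I. c i * \<phi> k i) = 0" using False by simp
    ultimately show ?thesis by (intro exI[of _ c]) (simp add: less_Suc_eq)
  next
    case True
    then obtain p where p: "p \<in> I" "\<phi> k p \<noteq> 0" by auto
    define J where "J = I - {p}"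
    have J: "finite J" "k < card J" "p \<notin> J" "I = insert p J"
      using Suc.prems p by (auto simp: J_def)
    from Suc.IH[OF J(1,2), of "\<lambda>j i. \<phi> j i - \<phi> j p * \<phi> k i / \<phi> k p"]
    obtain c where c: "\<exists>i\<in>J. c i \<noteq> 0"
      "\<forall>j<k. (\<Sum>i\<in>J. c i * (\<phi> j i - \<phi> j p * \<phi> k i / \<phi> k p)) = 0" by auto
    define s where "s = (\<Sum>i\<in>J. c i * \<phi> k i)"
    define c' where "c' = c(p := - s / \<phi> k p)"
    have c'J: "(\<Sum>i\<in>J. c' i * \<phi> j i) = (\<Sum>i\<in>J. c i * \<phi> j i)" for j
      using J by (intro sum.cong) (auto simp: c'_def)
    have tot: "(\<Sum>i\<in>I. c' i * \<phi> j i) = (\<Sum>i\<in>J. c i * \<phi> j i) - s / \<phi> k p * \<phi> j p" for j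
      using J c'J by (simp add: c'_def)
    have "(\<Sum>i\<in>I. c' i * \<phi> j i) = 0" if "j < Suc k" for j
    proof (cases "j = k")
      case True
      then show ?thesis using tot[of k] p by (simp add: s_def)
    next
      case False
      have "(\<Sum>i\<in>J. c i * (\<phi> j i - \<phi> j p * \<phi> k i / \<phi> k p)) =
        (\<Sum>i\<in>J. c i * \<phi> j i - \<phi> j p / \<phi> k p * (c i * \<phi> k i))"
        by (intro sum.cong) (auto simp: algebra_simps)
      also have "\<dots> = (\<Sum>i\<in>J. c i * \<phi> j i) - \<phi> j p / \<phi> k p * s"
        by (simp add: sum_subtractf s_def sum_distrib_left)
      finally show ?thesis using tot[of j] c(2) False that by simp
    qed
    moreover have "\<exists>i\<in>I. c' i \<noteq> 0" using c(1) J by (auto simp: c'_def)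
    ultimately show ?thesis by blast
  qed
qed

text \<open>Extended naturals that fail to reach m + 1 are at most m, and so is their supremum.
  Nonemptiness enters for n = 0.\<close>

lemma enat_le_SUP_witness:
  fixes f :: "'a \<Rightarrow> enat"
  assumes "enat n \<le> (SUP x\<in>A. f x)" "A \<noteq> {}"
  obtains x where "x \<in> A" "enat n \<le> f x"
proof (cases n)
  case 0
  then show ?thesis using assms(2) that by (auto simp: enat_0)
next
  case (Suc m)
  have "\<exists>x\<in>A. enat n \<le> f x"
  proof (rule ccontr)
    assume "\<not> ?thesis"
    then have "\<forall>x\<in>A. f x \<le> enat m" unfolding Suc using Suc_ile_eq by (auto simp: not_le not_less)
    then have "(SUP x\<in>A. f x) \<le> enat m" by (simp add: SUP_least)
    then have "enat n \<le> enat m" using assms(1) by (rule order_trans[rotated])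
    then show False using Suc by simp
  qed
  then show ?thesis using that by blast
qed

lemma L2_independent_empty: "L2_independent M {}"
  by (simp add: L2_independent_def)

lemma L2_dim_witness:
  assumes "enat n \<le> L2_dim M V"
  obtains S where "S \<subseteq> V" "L2_independent M S" "n \<le> card S"
proof (rule enat_le_SUP_witness[OF assms[unfolded L2_dim_def]])
  show "{S. S \<subseteq> V \<and> L2_independent M S} \<noteq> {}" using L2_independent_empty by blast
next
  fix S assume "S \<in> {S. S \<subseteq> V \<and> L2_independent M S}" "enat n \<le> enat (card S)"
  then show thesis using that[of S] by simp
qed

lemma enat_le_add_split:
  assumes "enat n \<le> a + b"
  obtains n1 n2 where "n = n1 + n2" "enat n1 \<le> a" "enat n2 \<le> b"
proof (cases a)
  case infinity
  then show ?thesis using that[of n 0] by (simp add: enat_0)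
next
  case (enat x)
  show ?thesis
  proof (rule that[of "min n x" "n - min n x"])
    show "enat (n - min n x) \<le> b" using assms enat by (cases b) auto
  qed (use enat in auto)
qed

text \<open>The dimensions may be infinite; a lower bound on their sum is already realised by finite
  independent sets, one in each space.\<close>

lemma L2_dim_sum_witness:
  assumes "finite F" "enat n \<le> (\<Sum>l\<in>F. L2_dim M (V l))"
  shows "\<exists>S. (\<forall>l\<in>F. S l \<subseteq> V l \<and> L2_independent M (S l)) \<and> n \<le> (\<Sum>l\<in>F. card (S l))"
  using assms
proof (induction F arbitrary: n rule: finite_induct)
  case empty
  then show ?case by (simp add: enat_0_iff)
next
  case (insert a F)
  obtain n1 n2 where n: "n = n1 + n2" "enat n1 \<le> L2_dim M (V a)" "enat n2 \<le> (\<Sum>l\<in>F. L2_dim M (V l))"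
    using enat_le_add_split[of n "L2_dim M (V a)" "\<Sum>l\<in>F. L2_dim M (V l)"] insert by auto
  obtain S where S: "\<forall>l\<in>F. S l \<subseteq> V l \<and> L2_independent M (S l)" "n2 \<le> (\<Sum>l\<in>F. card (S l))"
    using insert.IH[OF n(3)] by auto
  obtain T where T: "T \<subseteq> V a" "L2_independent M T" "n1 \<le> card T"
    using L2_dim_witness[OF n(2)] .
  have "(\<Sum>l\<in>F. card ((S(a := T)) l)) = (\<Sum>l\<in>F. card (S l))"
    using insert by (intro sum.cong) auto
  then show ?case using S T n insert by (intro exI[of _ "S(a := T)"]) auto
qed

lemma eigenvalue_count_witness:
  assumes "enat n \<le> eigenvalue_count \<mu> t"
  obtains F where "finite F" "F \<subseteq> {..t}" "enat n \<le> (\<Sum>l\<in>F. L2_dim \<mu> (eigenspace \<mu> l))"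
proof (rule enat_le_SUP_witness[OF assms[unfolded eigenvalue_count_def]])
  show "{F. finite F \<and> F \<subseteq> {..t}} \<noteq> {}" by blast
next
  fix F assume "F \<in> {F. finite F \<and> F \<subseteq> {..t}}" "enat n \<le> (\<Sum>l\<in>F. L2_dim \<mu> (eigenspace \<mu> l))"
  then show thesis using that[of F] by simp
qed

text \<open>Orthogonality of the eigenspaces gives q f f = \<Sum> l * w l and the integral of f^2 as
  \<Sum> w l, where w l is the squared norm of the component of f in the eigenspace of l. Hence the
  Rayleigh quotient is at most t, and it equals t only if w l = 0 for all l \<noteq> t.\<close>

lemma eigenfunction_combination:
  assumes \<mu>: "\<mu> \<in> P_prob_measures" and F: "finite F" "F \<subseteq> {..t}"
    and n: "enat (Suc k) \<le> (\<Sum>l\<in>F. L2_dim \<mu> (eigenspace \<mu> l))"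
  obtains f where "f \<in> H1" "\<And>j. j < k \<Longrightarrow> f (z j) = 0" "0 < (LINT x|\<mu>. (f x)\<^sup>2)"
    "q f f \<le> t * (LINT x|\<mu>. (f x)\<^sup>2)"
    "q f f = t * (LINT x|\<mu>. (f x)\<^sup>2) \<Longrightarrow> f \<in> eigenspace \<mu> t"
proof -
  obtain S where S: "\<And>l. l \<in> F \<Longrightarrow> S l \<subseteq> eigenspace \<mu> l" "\<And>l. l \<in> F \<Longrightarrow> L2_independent \<mu> (S l)"
    "Suc k \<le> (\<Sum>l\<in>F. card (S l))"
    using L2_dim_sum_witness[OF F(1) n] by blast
  have fS: "finite (S l)" if "l \<in> F" for l using S(2)[OF that] by (simp add: L2_independent_def)
  \<comment> \<open>Indexing the coefficients by pairs keeps the families of different eigenvalues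
    apart without first proving them disjoint.\<close>
  define I where "I = Sigma F S"
  have "finite I" "k < card I" using S(3) fS F(1) by (auto simp: I_def card_SigmaI)
  from homogeneous_system_solution[OF this, of "\<lambda>j i. snd i (z j)"]
  obtain c where c: "\<exists>i\<in>I. c i \<noteq> 0" "\<forall>j<k. (\<Sum>i\<in>I. c i * snd i (z j)) = 0" by auto
  define g where "g l x = (\<Sum>u\<in>S l. c (l, u) * u x)" for l x
  define f where "f x = (\<Sum>l\<in>F. g l x)" for x
  have g: "g l \<in> eigenspace \<mu> l" if "l \<in> F" for l
    unfolding g_def by (rule eigenspace_sum[OF \<mu>]) (use S(1)[OF that] in auto)
  have gH: "g l \<in> H1" "g l \<in> H1_mu \<mu>" if "l \<in> F" for l using eigenspaceD[OF \<mu> g[OF that]] by auto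
  have fH: "f \<in> H1" "f \<in> H1_mu \<mu>" using gH unfolding f_def by (auto intro: H1_sum H1_mu_sum)
  have int: "integrable \<mu> (\<lambda>x. u x * v x)" if "u \<in> H1" "v \<in> H1" for u v
    using H1_mult_integrable[OF \<mu> that] .
  define w where "w l = (LINT x|\<mu>. (g l x)\<^sup>2)" for l
  have w0: "w l \<ge> 0" for l unfolding w_def by (rule Bochner_Integration.integral_nonneg) simp
  have gf: "(LINT x|\<mu>. g l x * f x) = w l" if l: "l \<in> F" for l
  proof -
    have "(LINT x|\<mu>. g l x * f x) = (\<Sum>m\<in>F. (LINT x|\<mu>. g l x * g m x))"
      unfolding f_def sum_distrib_left
      by (rule Bochner_Integration.integral_sum) (use int gH l in auto)
    also have "\<dots> = (\<Sum>m\<in>F. if m = l then w l else 0)"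
      using eigenspace_orthogonal[OF \<mu> g[OF l] g]
      by (intro sum.cong) (auto simp: w_def power2_eq_square)
    finally show ?thesis using F l by simp
  qed
  have ff: "(LINT x|\<mu>. (f x)\<^sup>2) = (\<Sum>l\<in>F. w l)"
  proof -
    have "(LINT x|\<mu>. (f x)\<^sup>2) = (LINT x|\<mu>. (\<Sum>l\<in>F. g l x * f x))"
      by (simp add: power2_eq_square f_def sum_distrib_right)
    also have "\<dots> = (\<Sum>l\<in>F. (LINT x|\<mu>. g l x * f x))"
      by (rule Bochner_Integration.integral_sum) (use int gH fH in auto)
    finally show ?thesis using gf by simp
  qed
  have q\<phi>: "q f \<phi> = (\<Sum>l\<in>F. l * (LINT x|\<mu>. g l x * \<phi> x))" if "\<phi> \<in> H1_mu \<mu>" for \<phi>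
  proof -
    have "\<phi> \<in> H1" using that by (simp add: H1_mu_iff)
    then have "q f \<phi> = (\<Sum>l\<in>F. q (g l) \<phi>)" unfolding f_def using q_sum_left gH by auto
    then show ?thesis using eigenspaceD(3)[OF \<mu> g that] by simp
  qed
  have qff: "q f f = (\<Sum>l\<in>F. l * w l)" using q\<phi>[OF fH(2)] gf by simp
  show ?thesis
  proof
    show "f \<in> H1" by fact
    fix j assume "j < k"
    then have "(\<Sum>i\<in>I. c i * snd i (z j)) = 0" using c by auto
    moreover have "(\<Sum>i\<in>I. c i * snd i (z j)) = f (z j)"
      unfolding I_def f_def g_def by (subst sum.Sigma) (use F fS in \<open>auto intro!: sum.cong\<close>)
    ultimately show "f (z j) = 0" by simp
  next
    obtain l u where lu: "l \<in> F" "u \<in> S l" "c (l, u) \<noteq> 0" using c(1) by (auto simp: I_def)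
    have "w l \<noteq> 0"
    proof
      assume "w l = 0"
      then have "AE x in \<mu>. (g l x)\<^sup>2 = 0" unfolding w_def
        by (subst (asm) integral_nonneg_eq_0_iff_AE)
          (use int[OF gH(1)[OF lu(1)] gH(1)[OF lu(1)]] in \<open>auto simp: power2_eq_square\<close>)
      then have "AE x in \<mu>. (\<Sum>u\<in>S l. c (l, u) * u x) = 0" by (simp add: g_def)
      then show False using S(2)[OF lu(1)] lu by (auto simp: L2_independent_def)
    qed
    then have "0 < w l" using w0[of l] by simp
    also have "w l \<le> (\<Sum>l\<in>F. w l)" using F lu w0 by (intro member_le_sum) auto
    finally show "0 < (LINT x|\<mu>. (f x)\<^sup>2)" by (simp add: ff)
  next
    show "q f f \<le> t * (LINT x|\<mu>. (f x)\<^sup>2)"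
      unfolding qff ff sum_distrib_left using F w0 by (intro sum_mono mult_right_mono) auto
  next
    assume eq: "q f f = t * (LINT x|\<mu>. (f x)\<^sup>2)"
    have "(\<Sum>l\<in>F. (t - l) * w l) = 0"
      using eq unfolding qff ff by (simp add: left_diff_distrib sum_subtractf sum_distrib_left)
    then have z: "\<forall>l\<in>F. (t - l) * w l = 0"
      by (subst (asm) sum_nonneg_eq_0_iff) (use F w0 in auto)
    \<comment> \<open>A component with l \<noteq> t vanishes almost everywhere, so its eigenvalue
      may be replaced by t in front of the integral.\<close>
    have lt: "l * (LINT x|\<mu>. g l x * \<phi> x) = t * (LINT x|\<mu>. g l x * \<phi> x)" if l: "l \<in> F" for l \<phi>
    proof (cases "l = t")
      case False
      then have "w l = 0" using z l by auto
      then have "AE x in \<mu>. (g l x)\<^sup>2 = 0" unfolding w_def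
        by (subst (asm) integral_nonneg_eq_0_iff_AE)
          (use int[OF gH(1)[OF l] gH(1)[OF l]] in \<open>auto simp: power2_eq_square\<close>)
      then have "AE x in \<mu>. g l x * \<phi> x = 0" by eventually_elim simp
      then have "(LINT x|\<mu>. g l x * \<phi> x) = 0" by (rule integral_eq_zero_AE)
      then show ?thesis by simp
    qed simp
    have q2: "q f \<phi> = (\<Sum>l\<in>F. t * (LINT x|\<mu>. g l x * \<phi> x))" if "\<phi> \<in> H1_mu \<mu>" for \<phi>
      unfolding q\<phi>[OF that] by (rule sum.cong[OF refl]) (rule lt)
    have "(LINT x|\<mu>. f x * \<phi> x) = (\<Sum>l\<in>F. (LINT x|\<mu>. g l x * \<phi> x))" if "\<phi> \<in> H1_mu \<mu>" for \<phi>
      unfolding f_def sum_distrib_right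
      by (rule Bochner_Integration.integral_sum) (use int gH that in \<open>auto simp: H1_mu_iff\<close>)
    then show "f \<in> eigenspace \<mu> t"
      unfolding eigenspace_iff[OF \<mu>] using fH q2 by (simp add: sum_distrib_left)
  qed
qed

text \<open>With \<phi> b as b - a times the measure of A to the left of b, the witness is the
  supremum of the points with \<phi> b \<le> c. Since \<phi> is monotone and left-continuous, the
  bound survives at b. The right limit of \<phi> also counts an atom at b, so the reverse inequality
  holds for the closed set.\<close>

lemma greedy_step:
  assumes M: "finite_measure M" "measure M (space M) \<le> 1"
    and sets: "A \<in> sets M" "\<And>x. A \<inter> {..<x} \<in> sets M" "\<And>x. A \<inter> {..x} \<in> sets M"
    and a: "0 \<le> a" "a \<le> 1" and c: "0 < c"
  shows "\<exists>b\<in>{a..1::real}. (b - a) * measure M (A \<inter> {..<b}) \<le> c \<and>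
    (b = 1 \<or> c \<le> (b - a) * measure M (A \<inter> {..b})) \<and> (b = 1 \<or> a < b)"
proof -
  interpret finite_measure M by fact
  define \<phi> where "\<phi> b = (b - a) * measure M (A \<inter> {..<b})" for b
  define B where "B = {b\<in>{a..1}. \<phi> b \<le> c}"
  define b where "b = Sup B"
  have aB: "a \<in> B" using a c by (auto simp: B_def \<phi>_def)
  have bdd: "bdd_above B" by (auto simp: B_def)
  have ab: "a \<le> b" unfolding b_def by (rule cSup_upper[OF aB bdd])
  have b1: "b \<le> 1" unfolding b_def by (rule cSup_least) (use aB in \<open>auto simp: B_def\<close>)
  have mono: "\<phi> x \<le> \<phi> y" if "a \<le> x" "x \<le> y" for x y
    unfolding \<phi>_def using that sets by (intro mult_mono finite_measure_mono) auto
  have below: "\<phi> x \<le> c" if "a \<le> x" "x < b" for x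
  proof -
    have "B \<noteq> {}" using aB by blast
    then have "x < Sup B \<longleftrightarrow> (\<exists>y\<in>B. x < y)" using bdd by (rule less_cSup_iff)
    moreover have "x < Sup B" using that by (simp add: b_def)
    ultimately obtain y where "y \<in> B" "x < y" by blast
    then show ?thesis using mono[of x y] that by (auto simp: B_def)
  qed
  have above: "c < \<phi> x" if "b < x" "x \<le> 1" for x
  proof (rule ccontr)
    assume "\<not> ?thesis"
    then have "x \<in> B" using that ab by (auto simp: B_def)
    then have "x \<le> b" unfolding b_def using bdd by (rule cSup_upper)
    then show False using that by simp
  qed
  have lim0: "(\<lambda>n. d / real (Suc n)) \<longlonglongrightarrow> 0" for d
    using LIMSEQ_inverse_real_of_nat[THEN tendsto_mult_left, of d] by (simp add: divide_inverse)
  have 1: "\<phi> b \<le> c"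
  proof (cases "a < b")
    case True
    define x where "x n = b - (b - a) / real (Suc n)" for n
    have x: "a \<le> x n" "x n < b" for n
      using True mult_left_mono[of 1 "real (Suc n)" "b - a"] by (auto simp: x_def field_simps)
    have xlim: "x \<longlonglongrightarrow> b"
      unfolding x_def using tendsto_diff[OF tendsto_const lim0[of "b - a"], of b] by simp
    have inc: "incseq (\<lambda>n. A \<inter> {..<x n})"
    proof (rule incseq_SucI)
      fix n
      have "(b - a) / real (Suc (Suc n)) \<le> (b - a) / real (Suc n)"
        using True by (intro divide_left_mono) auto
      then show "A \<inter> {..<x n} \<subseteq> A \<inter> {..<x (Suc n)}" by (auto simp: x_def)
    qed
    have "(\<Union>n. A \<inter> {..<x n}) = A \<inter> {..<b}"
    proof (intro equalityI subsetI)
      fix y assume y: "y \<in> A \<inter> {..<b}"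
      then obtain n where "y < x n"
        using order_tendstoD(1)[OF xlim, of y] by (auto simp: eventually_sequentially)
      then show "y \<in> (\<Union>n. A \<inter> {..<x n})" using y by auto
    next
      fix y assume "y \<in> (\<Union>n. A \<inter> {..<x n})"
      then show "y \<in> A \<inter> {..<b}" using x(2) by (auto intro: less_trans)
    qed
    then have "(\<lambda>n. measure M (A \<inter> {..<x n})) \<longlonglongrightarrow> measure M (A \<inter> {..<b})"
      using finite_Lim_measure_incseq[OF _ inc] sets by auto
    then have "(\<lambda>n. \<phi> (x n)) \<longlonglongrightarrow> \<phi> b" unfolding \<phi>_def using xlim by (intro tendsto_intros)
    then show ?thesis by (rule LIMSEQ_le_const2) (use below x in auto)
  qed (use ab c in \<open>simp add: \<phi>_def\<close>)
  have 2: "c \<le> (b - a) * measure M (A \<inter> {..b})" if "b \<noteq> 1"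
  proof -
    have b1: "b < 1" using b1 that by simp
    define x where "x n = b + (1 - b) / real (Suc n)" for n
    have x: "b < x n" "x n \<le> 1" for n
      using b1 mult_left_mono[of 1 "real (Suc n)" "1 - b"] by (auto simp: x_def field_simps)
    have xlim: "x \<longlonglongrightarrow> b"
      unfolding x_def using tendsto_add[OF tendsto_const lim0[of "1 - b"], of b] by simp
    have dec: "decseq (\<lambda>n. A \<inter> {..<x n})"
    proof (rule decseq_SucI)
      fix n
      have "(1 - b) / real (Suc (Suc n)) \<le> (1 - b) / real (Suc n)"
        using b1 by (intro divide_left_mono) auto
      then show "A \<inter> {..<x (Suc n)} \<subseteq> A \<inter> {..<x n}" by (auto simp: x_def)
    qed
    have "(\<Inter>n. A \<inter> {..<x n}) = A \<inter> {..b}"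
    proof (intro equalityI subsetI)
      fix y assume y: "y \<in> (\<Inter>n. A \<inter> {..<x n})"
      have "y \<le> b" by (rule LIMSEQ_le_const[OF xlim]) (use y in \<open>auto intro: less_imp_le\<close>)
      then show "y \<in> A \<inter> {..b}" using y by auto
    next
      fix y assume "y \<in> A \<inter> {..b}"
      then show "y \<in> (\<Inter>n. A \<inter> {..<x n})" using x(1) by (auto intro: le_less_trans)
    qed
    then have "(\<lambda>n. measure M (A \<inter> {..<x n})) \<longlonglongrightarrow> measure M (A \<inter> {..b})"
      using finite_Lim_measure_decseq[OF _ dec] sets by auto
    then have "(\<lambda>n. \<phi> (x n)) \<longlonglongrightarrow> (b - a) * measure M (A \<inter> {..b})"
      unfolding \<phi>_def using xlim by (intro tendsto_intros)
    then show ?thesis by (rule LIMSEQ_le_const) (use above x less_imp_le in blast)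
  qed
  have 3: "a < b" if "b \<noteq> 1"
  proof (rule ccontr)
    assume "\<not> a < b"
    then have "b = a" using ab by simp
    then have "c \<le> 0" using 2[OF that] by simp
    then show False using c by simp
  qed
  show ?thesis using 1 2 3 ab b1 by (intro bexI[of _ b]) (auto simp: \<phi>_def)
qed

section \<open>Balanced partitions\<close>

text \<open>Cauchy-Schwarz for two summands: sqrt (p * r) + sqrt (s * u) is at most sqrt ((p + s) *
  (r + u)). In the application p and s are lengths, r and u masses.\<close>

lemma sum_mult_ge_square:
  fixes p r s u \<alpha> \<beta> :: real
  assumes nn: "0 \<le> p" "0 \<le> r" "0 \<le> s" "0 \<le> u" "0 \<le> \<alpha>" "0 \<le> \<beta>" and ge: "\<alpha>\<^sup>2 \<le> p * r" "\<beta>\<^sup>2 \<le> s * u"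
  shows "(\<alpha> + \<beta>)\<^sup>2 \<le> (p + s) * (r + u)"
proof -
  have "(2 * \<alpha> * \<beta>)\<^sup>2 = 4 * (\<alpha>\<^sup>2 * \<beta>\<^sup>2)" by (simp add: power2_eq_square)
  also have "\<dots> \<le> 4 * ((p * r) * (s * u))" using ge nn by (intro mult_left_mono mult_mono) auto
  also have "\<dots> = (p * u + s * r)\<^sup>2 - (p * u - s * r)\<^sup>2" by (simp add: power2_eq_square algebra_simps)
  also have "\<dots> \<le> (p * u + s * r)\<^sup>2" by simp
  finally have "2 * \<alpha> * \<beta> \<le> p * u + s * r" by (rule power2_le_imp_le) (use nn in simp)
  then show ?thesis using ge by (simp add: power2_eq_square algebra_simps)
qed

text \<open>In a \<open>unit_partition\<close> the points z 1, ..., z k belong to no piece, as f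
  will be 0 there, whereas 0 belongs to the first piece, and 1 to the last one unless it is itself a
  partition point.\<close>

definition piece :: "nat \<Rightarrow> (nat \<Rightarrow> real) \<Rightarrow> nat \<Rightarrow> real set" where
  "piece k z i = {w \<in> {0..1}. (i = 0 \<or> z i < w) \<and> (i = k \<or> w < z (Suc i))}"

text \<open>The constant in \<open>f\<^sup>2 \<le> capacity * \<integral> f'\<^sup>2\<close> on a piece, where \<open>f\<close> vanishes at both endpoints of an inner
  piece but only at the inner endpoint of the first and the last piece; \<open>peak\<close> is the point at which
  equality is possible.\<close>

definition capacity :: "nat \<Rightarrow> (nat \<Rightarrow> real) \<Rightarrow> nat \<Rightarrow> real" where
  "capacity k z i = (if i = 0 then z 1 else if i = k then 1 - z k else (z (Suc i) - z i) / 4)"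

definition peak :: "nat \<Rightarrow> (nat \<Rightarrow> real) \<Rightarrow> nat \<Rightarrow> real" where
  "peak k z i = (if i = 0 then 0 else if i = k then 1 else (z i + z (Suc i)) / 2)"

text \<open>The entries z 1, ..., z k are the prescribed zeros; z 0 and z (Suc k) only mark the ends
  of the path. \<open>z_step\<close> admits a greedy choice that reaches 1 early and stays there,
  leaving empty pieces.\<close>

locale unit_partition =
  fixes k :: nat and z :: "nat \<Rightarrow> real"
  assumes k: "1 \<le> k" and z_first: "z 0 = 0" and z_last: "z (Suc k) = 1"
    and z_step: "i \<le> k \<Longrightarrow> z i < z (Suc i) \<or> z i = 1 \<and> z (Suc i) = 1"
begin

lemma z_mono: "i \<le> j \<Longrightarrow> j \<le> Suc k \<Longrightarrow> z i \<le> z j"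
proof (induction j rule: dec_induct)
  case (step n)
  then show ?case using z_step[of n] by auto
qed simp

lemma z_bounds: "i \<le> Suc k \<Longrightarrow> 0 \<le> z i" "i \<le> Suc k \<Longrightarrow> z i \<le> 1"
  using z_mono[of 0 i] z_mono[of i "Suc k"] z_first z_last by auto

lemma piece_subset: "i \<le> k \<Longrightarrow> w \<in> piece k z i \<Longrightarrow> z i \<le> w \<and> w \<le> z (Suc i)"
  using z_first z_last by (auto simp: piece_def)

lemma piece_disjoint:
  assumes "i < j" "j \<le> k"
  shows "piece k z i \<inter> piece k z j = {}"
proof -
  have "z (Suc i) \<le> z j" using assms by (intro z_mono) auto
  then show ?thesis using assms by (auto simp: piece_def)
qed

lemma piece_cover:
  assumes "w \<in> {0..1}" "\<And>i. 1 \<le> i \<Longrightarrow> i \<le> k \<Longrightarrow> w \<noteq> z i"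
  shows "\<exists>i\<le>k. w \<in> piece k z i"
proof -
  let ?P = "\<lambda>i. i \<le> k \<and> (i = 0 \<or> z i < w)"
  define i where "i = (GREATEST i. ?P i)"
  have i: "?P i" unfolding i_def by (rule GreatestI_nat[of ?P 0 k]) auto
  have "w < z (Suc i)" if "i \<noteq> k"
  proof (rule ccontr)
    assume "\<not> w < z (Suc i)"
    then have "?P (Suc i)" using that i assms(2)[of "Suc i"] by auto
    then have "Suc i \<le> i" unfolding i_def by (rule Greatest_le_nat[of ?P _ k]) auto
    then show False by simp
  qed
  then show ?thesis using i assms(1) by (auto simp: piece_def)
qed

lemma capacity_nonneg: "i \<le> k \<Longrightarrow> 0 \<le> capacity k z i"
  using z_bounds[of 1] z_bounds[of k] z_mono[of i "Suc i"] k by (auto simp: capacity_def)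

lemma peak_in_unit: "i \<le> k \<Longrightarrow> peak k z i \<in> {0..1}"
  using z_bounds[of i] z_bounds[of "Suc i"] by (auto simp: peak_def)

text \<open>On an inner piece the Cauchy-Schwarz bounds from both ends are averaged with weights
  proportional to the opposite distances; an end piece offers only one of them. In each case the
  deficit is kept: if the piece has energy, it vanishes only at the peak.\<close>

lemma piece_bound:
  assumes e: "\<And>a b. 0 \<le> a \<Longrightarrow> a \<le> b \<Longrightarrow> b \<le> 1 \<Longrightarrow> e a \<le> e b"
    "\<And>a b. 0 \<le> a \<Longrightarrow> a \<le> b \<Longrightarrow> b \<le> 1 \<Longrightarrow> (f b - f a)\<^sup>2 \<le> (b - a) * (e b - e a :: real)"
    and f: "\<And>i. 1 \<le> i \<Longrightarrow> i \<le> k \<Longrightarrow> f (z i) = (0::real)"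
    and i: "i \<le> k" and w: "w \<in> piece k z i"
  shows "(f w)\<^sup>2 \<le> capacity k z i * (e (z (Suc i)) - e (z i))" (is "_ \<le> _ * ?E")
    and "(f w)\<^sup>2 = capacity k z i * (e (z (Suc i)) - e (z i)) \<Longrightarrow> e (z i) < e (z (Suc i)) \<Longrightarrow> w = peak k z i"
proof -
  have w01: "0 \<le> w" "w \<le> 1" using w by (auto simp: piece_def)
  have zw: "z i \<le> w" "w \<le> z (Suc i)" using piece_subset[OF i w] by auto
  have zb: "0 \<le> z i" "z (Suc i) \<le> 1" using z_bounds[of i] z_bounds[of "Suc i"] i by auto
  have L: "e (z i) \<le> e w" "(f w - f (z i))\<^sup>2 \<le> (w - z i) * (e w - e (z i))"
    using e zb zw w01 by auto
  have R: "e w \<le> e (z (Suc i))" "(f (z (Suc i)) - f w)\<^sup>2 \<le> (z (Suc i) - w) * (e (z (Suc i)) - e w)"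
    using e zb zw w01 by auto
  have E0: "0 \<le> ?E" using L R by simp
  consider "i = 0" | "i = k" "i \<noteq> 0" | "i \<noteq> 0" "i \<noteq> k" by blast
  then have "(f w)\<^sup>2 \<le> capacity k z i * ?E \<and> ((f w)\<^sup>2 = capacity k z i * ?E \<longrightarrow> 0 < ?E \<longrightarrow> w = peak k z i)"
  proof cases
    case 1
    have "(f w)\<^sup>2 \<le> (z (Suc i) - w) * (e (z (Suc i)) - e w)"
      using R(2) f[of 1] 1 k by (simp add: power2_eq_square)
    also have "\<dots> \<le> (z (Suc i) - w) * ?E" using zw L by (intro mult_left_mono) auto
    finally have *: "(f w)\<^sup>2 \<le> z 1 * ?E - w * ?E" using 1 by (simp add: left_diff_distrib)
    have "w * ?E \<ge> 0" using w01 E0 by simp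
    moreover have "w = 0" if "w * ?E \<le> 0" "0 < ?E" using that w01 by (simp add: mult_le_0_iff)
    ultimately show ?thesis using * 1 by (auto simp: capacity_def peak_def)
  next
    case 2
    have "(f w)\<^sup>2 \<le> (w - z i) * (e w - e (z i))"
      using L(2) f[of i] 2 k by simp
    also have "\<dots> \<le> (w - z i) * ?E" using zw R by (intro mult_left_mono) auto
    finally have *: "(f w)\<^sup>2 \<le> (1 - z i) * ?E - (1 - w) * ?E" by (simp add: left_diff_distrib)
    have "(1 - w) * ?E \<ge> 0" using w01 E0 by simp
    moreover have "w = 1" if "(1 - w) * ?E \<le> 0" "0 < ?E" using that w01 by (simp add: mult_le_0_iff)
    ultimately show ?thesis using * 2 by (auto simp: capacity_def peak_def)
  next
    case 3
    define a where "a = z i"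
    define b where "b = z (Suc i)"
    have ab: "a < w" "w < b" using w 3 by (auto simp: piece_def a_def b_def)
    have l: "(f w)\<^sup>2 \<le> (w - a) * (e w - e a)" using L(2) f[of i] 3 i by (simp add: a_def)
    have r: "(f w)\<^sup>2 \<le> (b - w) * (e b - e w)" using R(2) f[of "Suc i"] 3 i by (simp add: b_def)
    have "(b - a) * (f w)\<^sup>2 = (b - w) * (f w)\<^sup>2 + (w - a) * (f w)\<^sup>2" by (simp add: algebra_simps)
    also have "\<dots> \<le> (b - w) * ((w - a) * (e w - e a)) + (w - a) * ((b - w) * (e b - e w))"
      using ab l r by (intro add_mono mult_left_mono) auto
    also have "\<dots> = (b - w) * (w - a) * (e b - e a)" by (simp add: algebra_simps)
    \<comment> \<open>Uses 4 * (b - w) * (w - a) = (b - a)^2 - (2 * w - a - b)^2, where the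
      subtracted square vanishes at the midpoint only.\<close>
    also have "\<dots> = (b - a) * ((b - a) / 4 * (e b - e a)) - (2 * w - a - b)\<^sup>2 / 4 * (e b - e a)"
      by (simp add: power2_eq_square field_simps)
    finally have *: "(b - a) * (f w)\<^sup>2 \<le> (b - a) * ((b - a) / 4 * (e b - e a)) - (2 * w - a - b)\<^sup>2 / 4 * (e b - e a)" .
    have pos: "0 \<le> (2 * w - a - b)\<^sup>2 / 4 * (e b - e a)" using E0 by (simp add: a_def b_def)
    then have "(b - a) * (f w)\<^sup>2 \<le> (b - a) * ((b - a) / 4 * (e b - e a))" using * by linarith
    then have 1: "(f w)\<^sup>2 \<le> (b - a) / 4 * (e b - e a)" by (rule mult_left_le_imp_le) (use ab in simp)
    have "w = (a + b) / 2" if eq: "(f w)\<^sup>2 = (b - a) / 4 * (e b - e a)" and E: "0 < e b - e a"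
    proof -
      have "(2 * w - a - b)\<^sup>2 / 4 * (e b - e a) \<le> 0" using * unfolding eq by linarith
      then have "(2 * w - a - b)\<^sup>2 = 0" using E by (simp add: mult_le_0_iff)
      then show ?thesis by simp
    qed
    then show ?thesis using 1 3 by (simp add: capacity_def peak_def a_def b_def)
  qed
  then show "(f w)\<^sup>2 \<le> capacity k z i * ?E"
    and "(f w)\<^sup>2 = capacity k z i * ?E \<Longrightarrow> e (z i) < e (z (Suc i)) \<Longrightarrow> w = peak k z i" by auto
qed

lemma piece_sets: "\<mu> \<in> P_prob_measures \<Longrightarrow> piece k z i \<in> sets \<mu>"
proof -
  have "piece k z i = {0..1} \<inter> (if i = 0 then UNIV else {z i<..}) \<inter> (if i = k then UNIV else {..<z (Suc i)})"
    by (auto simp: piece_def)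
  then show "\<mu> \<in> P_prob_measures \<Longrightarrow> piece k z i \<in> sets \<mu>" by (simp add: P_prob_sets_iff le_infI1)
qed

end

text \<open>Greedy points are chosen with quota 1/(4k^2) and then 1/k^2 for length times mass. By
  Cauchy-Schwarz the closed interval up to the last point below 1 has length times mass at least (1
  - 1/(2k))^2 if all k points lie below 1; a last piece with more than 1/(4k^2) would then exceed
  the total 1 * 1.\<close>

lemma exists_balanced_partition:
  assumes \<mu>: "\<mu> \<in> P_prob_measures" and k: "1 \<le> k"
  shows "\<exists>z. unit_partition k z \<and>
    (\<forall>i\<le>k. capacity k z i * measure \<mu> (piece k z i) \<le> 1 / (4 * (real k)\<^sup>2))"
proof -
  interpret prob_space \<mu> using P_prob_prob_space[OF \<mu>] .
  have k0: "0 < real k" using k by simp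
  have sets: "A \<in> sets \<mu>" if "A \<in> sets borel" "A \<subseteq> {0..1}" for A
    using that P_prob_sets_iff[OF \<mu>] by simp
  have fin: "finite_measure \<mu>" "measure \<mu> (space \<mu>) \<le> 1"
    using finite_measure_axioms by auto
  have "\<exists>b\<in>{0..1}. (b - 0) * measure \<mu> ({0..1} \<inter> {..<b}) \<le> 1 / (4 * (real k)\<^sup>2) \<and>
    (b = 1 \<or> 1 / (4 * (real k)\<^sup>2) \<le> (b - 0) * measure \<mu> ({0..1} \<inter> {..b})) \<and> (b = 1 \<or> 0 < b)"
    using k0 by (intro greedy_step[OF fin] sets) auto
  then obtain b0 where b0: "b0 \<in> {0..1}" "b0 * measure \<mu> ({0..1} \<inter> {..<b0}) \<le> 1 / (4 * (real k)\<^sup>2)"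
    "b0 = 1 \<or> 1 / (4 * (real k)\<^sup>2) \<le> b0 * measure \<mu> ({0..1} \<inter> {..b0})" "b0 = 1 \<or> 0 < b0"
    unfolding diff_zero by blast
  have "\<forall>a. \<exists>b. a \<in> {0..1} \<longrightarrow> (b \<in> {a..1} \<and> (b - a) * measure \<mu> ({a<..1} \<inter> {..<b}) \<le> 1 / (real k)\<^sup>2 \<and>
    (b = 1 \<or> 1 / (real k)\<^sup>2 \<le> (b - a) * measure \<mu> ({a<..1} \<inter> {..b})) \<and> (b = 1 \<or> a < b))"
  proof (intro allI)
    fix a
    have "\<exists>b\<in>{a..1}. (b - a) * measure \<mu> ({a<..1} \<inter> {..<b}) \<le> 1 / (real k)\<^sup>2 \<and>
      (b = 1 \<or> 1 / (real k)\<^sup>2 \<le> (b - a) * measure \<mu> ({a<..1} \<inter> {..b})) \<and> (b = 1 \<or> a < b)" if "a \<in> {0..1}"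
      using k0 that by (intro greedy_step[OF fin] sets) auto
    then show "\<exists>b. a \<in> {0..1} \<longrightarrow> (b \<in> {a..1} \<and> (b - a) * measure \<mu> ({a<..1} \<inter> {..<b}) \<le> 1 / (real k)\<^sup>2 \<and>
      (b = 1 \<or> 1 / (real k)\<^sup>2 \<le> (b - a) * measure \<mu> ({a<..1} \<inter> {..b})) \<and> (b = 1 \<or> a < b))" by blast
  qed
  then obtain st where st: "\<And>a. a \<in> {0..1} \<Longrightarrow> st a \<in> {a..1} \<and>
      (st a - a) * measure \<mu> ({a<..1} \<inter> {..<st a}) \<le> 1 / (real k)\<^sup>2 \<and>
      (st a = 1 \<or> 1 / (real k)\<^sup>2 \<le> (st a - a) * measure \<mu> ({a<..1} \<inter> {..st a})) \<and> (st a = 1 \<or> a < st a)"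
    by (subst (asm) choice_iff) blast
  define x where "x = rec_nat b0 (\<lambda>_. st)"
  have x0: "x 0 = b0" and xS: "x (Suc i) = st (x i)" for i by (simp_all add: x_def)
  have x01: "x i \<in> {0..1}" for i
  proof (induction i)
    case (Suc i)
    then show ?case using st[OF Suc] by (auto simp: xS)
  qed (use b0 x0 in auto)
  note xst = st[OF x01, folded xS]
  \<comment> \<open>The square roots of the quotas used so far add up to 1/(2k) + j/k. The
    alternative x j = 1 records an early end.\<close>
  have inv: "x j = 1 \<or> ((2 * real j + 1) / (2 * real k))\<^sup>2 \<le> x j * measure \<mu> ({0..1} \<inter> {..x j})" for j
  proof (induction j)
    case 0
    then show ?case using b0(3) by (simp add: x0 power_divide power_mult_distrib)
  next
    case (Suc j)
    show ?case
    proof (cases "x (Suc j) = 1")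
      case False
      then have ne: "x j \<noteq> 1" using xst[of j] by auto
      have "((2 * real j + 1) / (2 * real k) + 1 / real k)\<^sup>2 \<le>
        (x j + (x (Suc j) - x j)) * (measure \<mu> ({0..1} \<inter> {..x j}) + measure \<mu> ({x j<..1} \<inter> {..x (Suc j)}))"
        using Suc ne False xst[of j] x01[of j]
        by (intro sum_mult_ge_square) (auto simp: power_divide)
      also have "measure \<mu> ({0..1} \<inter> {..x j}) + measure \<mu> ({x j<..1} \<inter> {..x (Suc j)}) =
          measure \<mu> (({0..1} \<inter> {..x j}) \<union> ({x j<..1} \<inter> {..x (Suc j)}))"
        using x01[of j] by (intro finite_measure_Union[symmetric] sets) auto
      also have "({0..1} \<inter> {..x j}) \<union> ({x j<..1} \<inter> {..x (Suc j)}) = {0..1} \<inter> {..x (Suc j)}"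
        using x01[of j] xst[of j] by auto
      also have "(2 * real j + 1) / (2 * real k) + 1 / real k = (2 * real (Suc j) + 1) / (2 * real k)"
        using k0 by (simp add: field_simps)
      finally show ?thesis by simp
    qed simp
  qed
  \<comment> \<open>The greedy points are numbered from 0, the partition points from 1.\<close>
  define z where "z i = (if i = 0 then 0 else if i \<le> k then x (i - 1) else 1)" for i
  have z: "z 0 = 0" "z (Suc k) = 1" "\<And>i. i < k \<Longrightarrow> z (Suc i) = x i" by (auto simp: z_def)
  have "unit_partition k z"
  proof
    fix i assume i: "i \<le> k"
    show "z i < z (Suc i) \<or> z i = 1 \<and> z (Suc i) = 1"
    proof (cases i)
      case 0
      then show ?thesis using b0 k z x0 by auto
    next
      case (Suc j)
      show ?thesis
      proof (cases "i = k")
        case True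
        then show ?thesis using Suc x01[of j] z by auto
      next
        case False
        then show ?thesis using Suc x01[of j] x01[of "Suc j"] xst[of j] z i by auto
      qed
    qed
  qed (use k z in auto)
  moreover have "capacity k z i * measure \<mu> (piece k z i) \<le> 1 / (4 * (real k)\<^sup>2)" if i: "i \<le> k" for i
  proof -
    consider "i = 0" | "i = k" "i \<noteq> 0" | "i \<noteq> 0" "i \<noteq> k" by blast
    then show ?thesis
    proof cases
      case 1
      have "piece k z i = {0..1} \<inter> {..<b0}" using 1 k z(3)[of 0] x0 by (auto simp: piece_def)
      then show ?thesis using 1 b0(2) k z(3)[of 0] x0 by (simp add: capacity_def)
    next
      case 2
      define y where "y = x (k - 1)"
      have y: "z k = y" using z(3)[of "k - 1"] k by (simp add: y_def)
      have y01: "y \<in> {0..1}" unfolding y_def by (rule x01)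
      have p: "piece k z i = {y<..1}" using 2 y y01 by (auto simp: piece_def)
      let ?m = "measure \<mu> {y<..1}"
      have "(1 - y) * ?m \<le> 1 / (4 * (real k)\<^sup>2)"
      proof (rule ccontr)
        assume c: "\<not> ?thesis"
        have nn: "0 \<le> (1 - y) * ?m" using y01 by simp
        have "y \<noteq> 1" using c by auto
        then have "((2 * real (k - 1) + 1) / (2 * real k))\<^sup>2 \<le> y * measure \<mu> ({0..1} \<inter> {..y})"
          using inv[of "k - 1"] by (simp add: y_def)
        moreover have "(2 * real (k - 1) + 1) / (2 * real k) = 1 - 1 / (2 * real k)"
          using k k0 by (simp add: of_nat_diff field_simps)
        ultimately have i1: "(1 - 1 / (2 * real k))\<^sup>2 \<le> y * measure \<mu> ({0..1} \<inter> {..y})" by simp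
        define \<beta> where "\<beta> = sqrt ((1 - y) * ?m)"
        have "(1 / (2 * real k))\<^sup>2 < (1 - y) * ?m" using c by (simp add: power_divide power_mult_distrib)
        then have b: "1 / (2 * real k) < \<beta>" unfolding \<beta>_def by (rule real_less_rsqrt)
        have k1: "0 \<le> 1 - 1 / (2 * real k)" using k by (simp add: field_simps)
        have "(1 - 1 / (2 * real k) + \<beta>)\<^sup>2 \<le> (y + (1 - y)) * (measure \<mu> ({0..1} \<inter> {..y}) + ?m)"
          using i1 y01 nn k1 by (intro sum_mult_ge_square) (auto simp: \<beta>_def)
        also have "measure \<mu> ({0..1} \<inter> {..y}) + ?m = measure \<mu> (({0..1} \<inter> {..y}) \<union> {y<..1})"
          using y01 by (intro finite_measure_Union[symmetric] sets) auto
        also have "\<dots> \<le> 1" by (rule prob_le_1)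
        finally have "(1 - 1 / (2 * real k) + \<beta>)\<^sup>2 \<le> 1\<^sup>2" by simp
        then have "1 - 1 / (2 * real k) + \<beta> \<le> 1" by (rule power2_le_imp_le) simp
        then show False using b by simp
      qed
      then show ?thesis using 2 p y by (simp add: capacity_def)
    next
      case 3
      then obtain j where j: "i = Suc j" by (cases i) auto
      have zi: "z i = x j" "z (Suc i) = x (Suc j)" using 3 i j z by auto
      have "piece k z i = {x j<..1} \<inter> {..<x (Suc j)}"
        using 3 zi x01[of j] by (auto simp: piece_def)
      then show ?thesis using 3 zi xst[of j] by (simp add: capacity_def)
    qed
  qed
  ultimately show ?thesis by blast
qed

section \<open>Equality in the lower bound\<close>

text \<open>The eigenvalue equation is tested against the hat function with nodes \<open>p\<close>, \<open>b\<close>, \<open>r\<close>.\<close>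

lemma eigenfunction_two_sided:
  assumes \<mu>: "\<mu> \<in> P_prob_measures" and f: "f \<in> eigenspace \<mu> l"
    and p: "0 \<le> p" "p < b" "b < r" "r \<le> 1" and fb: "f b = 0"
    and AE: "AE w in \<mu>. p < w \<and> w < r \<longrightarrow> f w = 0"
  shows "f p / (b - p) + f r / (r - b) = 0"
proof -
  have V: "f 1 - f s = l * (LINT x|\<mu>. f x * ramp s 1 x)" if "s \<in> {0..1}" for s
    using eigenfunction_Volterra[OF \<mu> f that] .
  have fH: "f \<in> H1" using eigenspaceD[OF \<mu> f] by auto
  have int: "integrable \<mu> (\<lambda>x. f x * ramp s 1 x)" if "s \<in> {0..1}" for s
    using H1_mult_integrable[OF \<mu> fH H1_ramp] that by simp
  define \<alpha> where "\<alpha> = 1 / (b - p)"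
  define \<beta> where "\<beta> = 1 / (r - b)"
  have ab: "\<alpha> * (b - p) = 1" "\<beta> * (r - b) = 1" using p by (auto simp: \<alpha>_def \<beta>_def)
  \<comment> \<open>This combination of three ramps is the hat function of height 1 at b: slope
    \<alpha> from p to b, slope -\<beta> from b to r, and 0 elsewhere on the path. On its open
    support f vanishes almost everywhere, so the right-hand side is 0.\<close>
  have "\<alpha> * (f 1 - f p) - (\<alpha> + \<beta>) * (f 1 - f b) + \<beta> * (f 1 - f r) =
      l * (\<alpha> * (LINT x|\<mu>. f x * ramp p 1 x) - (\<alpha> + \<beta>) * (LINT x|\<mu>. f x * ramp b 1 x) + \<beta> * (LINT x|\<mu>. f x * ramp r 1 x))"
    using p by (simp add: V algebra_simps)
  also have "\<alpha> * (LINT x|\<mu>. f x * ramp p 1 x) - (\<alpha> + \<beta>) * (LINT x|\<mu>. f x * ramp b 1 x) + \<beta> * (LINT x|\<mu>. f x * ramp r 1 x)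
     = (LINT x|\<mu>. \<alpha> * (f x * ramp p 1 x) - (\<alpha> + \<beta>) * (f x * ramp b 1 x) + \<beta> * (f x * ramp r 1 x))"
    using int[of p] int[of b] int[of r] p by simp
  also have "\<dots> = 0"
  proof (rule integral_eq_zero_AE)
    show "AE x in \<mu>. \<alpha> * (f x * ramp p 1 x) - (\<alpha> + \<beta>) * (f x * ramp b 1 x) + \<beta> * (f x * ramp r 1 x) = 0"
      using AE AE_space
    proof eventually_elim
      case (elim x)
      have x: "x \<le> 1" using elim P_prob_space[OF \<mu>] by auto
      have "\<alpha> * ramp p 1 x - (\<alpha> + \<beta>) * ramp b 1 x + \<beta> * ramp r 1 x = 0" if "\<not> (p < x \<and> x < r)"
      proof (cases "x \<le> p")
        case True
        then show ?thesis using p by (simp add: ramp_def)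
      next
        case False
        then have rr: "ramp p 1 x = x - p" "ramp b 1 x = x - b" "ramp r 1 x = x - r"
          using that p x by (auto simp: ramp_def)
        have "\<alpha> * ramp p 1 x - (\<alpha> + \<beta>) * ramp b 1 x + \<beta> * ramp r 1 x = \<alpha> * (b - p) - \<beta> * (r - b)"
          unfolding rr by (simp add: algebra_simps)
        then show ?thesis using ab by simp
      qed
      moreover have "\<alpha> * (f x * ramp p 1 x) - (\<alpha> + \<beta>) * (f x * ramp b 1 x) + \<beta> * (f x * ramp r 1 x)
        = f x * (\<alpha> * ramp p 1 x - (\<alpha> + \<beta>) * ramp b 1 x + \<beta> * ramp r 1 x)"
        by (simp add: algebra_simps)
      ultimately show ?case using elim by (cases "p < x \<and> x < r") auto
    qed
  qed
  finally have "\<alpha> * f p + \<beta> * f r = 0" using fb by (simp add: algebra_simps)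
  then show ?thesis by (simp add: \<alpha>_def \<beta>_def)
qed

text \<open>Takes the place of the hat function argument when the zero is the end point 1 and no
  room is left to its right.\<close>

lemma eigenfunction_right_end:
  assumes \<mu>: "\<mu> \<in> P_prob_measures" and f: "f \<in> eigenspace \<mu> l"
    and p: "0 \<le> p" "p \<le> 1" and f1: "f 1 = 0" and AE: "AE w in \<mu>. p < w \<longrightarrow> f w = 0"
  shows "f p = 0"
proof -
  have "(LINT x|\<mu>. f x * ramp p 1 x) = 0"
    by (rule integral_eq_zero_AE) (use AE in \<open>eventually_elim, auto simp: ramp_def max_def\<close>)
  then show ?thesis using eigenfunction_Volterra[OF \<mu> f, of p] p f1 by simp
qed

text \<open>The mass of the optimal measure at i/k. The same numbers are the lengths of the optimal
  pieces and the square roots of the quotas for length times mass.\<close>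

definition weight :: "nat \<Rightarrow> nat \<Rightarrow> real" where
  "weight k i = (if i = 0 \<or> i = k then 1 / (2 * real k) else 1 / real k)"

lemma sum_weight:
  assumes "1 \<le> k"
  shows "(\<Sum>i\<le>k. weight k i) = 1"
proof -
  obtain m where m: "k = Suc m" using assms by (cases k) auto
  have "(\<Sum>i\<le>k. weight k i) = weight k 0 + (\<Sum>i\<le>m. weight k (Suc i))"
    unfolding m by (rule sum.atMost_Suc_shift)
  also have "(\<Sum>i\<le>m. weight k (Suc i)) = (\<Sum>i<m. weight k (Suc i)) + weight k (Suc m)"
    by (simp flip: lessThan_Suc_atMost)
  also have "(\<Sum>i<m. weight k (Suc i)) = (\<Sum>i<m. 1 / real k)"
    by (intro sum.cong) (auto simp: weight_def m)
  also have "weight k 0 + ((\<Sum>i<m. 1 / real k) + weight k (Suc m)) = 1"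
  proof -
    have "1 / (2 * K) + (x * (1 / K) + 1 / (2 * K)) = (x + 1) / K" if "K \<noteq> 0" for x K :: real
      using that by (simp add: field_simps)
    from this[of "real k" "real m"] show ?thesis by (simp add: weight_def m)
  qed
  finally show ?thesis .
qed

section \<open>The energy estimate on a balanced partition\<close>

locale balanced_partition = unit_partition +
  fixes \<mu> :: "real measure"
  assumes \<mu>: "\<mu> \<in> P_prob_measures"
    and balanced: "i \<le> k \<Longrightarrow> capacity k z i * measure \<mu> (piece k z i) \<le> 1 / (4 * (real k)\<^sup>2)"
begin

lemma k_pos: "0 < real k"
  using k by simp

context
  fixes f e :: "real \<Rightarrow> real" and E :: "nat \<Rightarrow> real"
  defines "E i \<equiv> e (z (Suc i)) - e (z i)"
  assumes f: "f \<in> H1" and f0: "\<And>i. 1 \<le> i \<Longrightarrow> i \<le> k \<Longrightarrow> f (z i) = 0"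
    and e: "e 0 = 0" "e 1 = q f f"
      "\<And>a b. 0 \<le> a \<Longrightarrow> a \<le> b \<Longrightarrow> b \<le> 1 \<Longrightarrow> e a \<le> e b"
      "\<And>a b. 0 \<le> a \<Longrightarrow> a \<le> b \<Longrightarrow> b \<le> 1 \<Longrightarrow> (f b - f a)\<^sup>2 \<le> (b - a) * (e b - e a)"
begin

lemma energy_nonneg: "i \<le> k \<Longrightarrow> 0 \<le> E i"
  using e(3)[of "z i" "z (Suc i)"] z_bounds[of i] z_bounds[of "Suc i"] z_mono[of i "Suc i"]
  by (simp add: E_def)

lemma energy_sum: "(\<Sum>i\<le>k. E i) = q f f"
  using sum_lessThan_telescope[of "\<lambda>i. e (z i)" "Suc k"] e(1,2) z_first z_last
  by (simp only: lessThan_Suc_atMost E_def)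

text \<open>The integrand is the step function that \<open>piece_bound\<close> puts above f^2; the
  integral of f^2 is compared with the energy through it.\<close>

lemma bound_measurable: "integrable \<mu> (\<lambda>w. \<Sum>i\<le>k. capacity k z i * E i * indicator (piece k z i) w :: real)"
  using finite_measure.emeasure_finite[OF P_prob_finite_measure[OF \<mu>]] piece_sets[OF \<mu>]
  by (intro Bochner_Integration.integrable_sum Bochner_Integration.integrable_mult_right integrable_real_indicator)
    (auto simp: less_top[symmetric])

lemma bound_integral:
  "(LINT w|\<mu>. (\<Sum>i\<le>k. capacity k z i * E i * indicator (piece k z i) w)) =
    (\<Sum>i\<le>k. capacity k z i * E i * measure \<mu> (piece k z i))"
  using finite_measure.emeasure_finite[OF P_prob_finite_measure[OF \<mu>]] piece_sets[OF \<mu>]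
    sets.sets_into_space[OF piece_sets[OF \<mu>]]
  by (subst Bochner_Integration.integral_sum)
    (auto simp: less_top[symmetric] Int_absorb2 intro!: integrable_real_indicator)

lemma piece_le_bound:
  assumes "i \<le> k" "w \<in> piece k z i"
  shows "capacity k z i * E i \<le> (\<Sum>i\<le>k. capacity k z i * E i * indicator (piece k z i) w)"
proof -
  have "capacity k z i * E i * indicator (piece k z i) w \<le>
    (\<Sum>i\<le>k. capacity k z i * E i * indicator (piece k z i) w)"
    using assms capacity_nonneg energy_nonneg
    by (intro member_le_sum[of i "{..k}" "\<lambda>i. capacity k z i * E i * indicator (piece k z i) w"]) auto
  then show ?thesis using assms by simp
qed

lemma square_le_bound:
  assumes "w \<in> {0..1}"
  shows "(f w)\<^sup>2 \<le> (\<Sum>i\<le>k. capacity k z i * E i * indicator (piece k z i) w)"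
proof (cases "\<exists>i. 1 \<le> i \<and> i \<le> k \<and> w = z i")
  case True
  then have "f w = 0" using f0 by auto
  moreover have "0 \<le> (\<Sum>i\<le>k. capacity k z i * E i * indicator (piece k z i) w)"
    using capacity_nonneg energy_nonneg by (intro sum_nonneg mult_nonneg_nonneg) auto
  ultimately show ?thesis by simp
next
  case False
  then obtain i where i: "i \<le> k" "w \<in> piece k z i" using piece_cover[OF assms] by blast
  have "(f w)\<^sup>2 \<le> capacity k z i * E i"
    unfolding E_def by (rule piece_bound(1)[OF e(3,4) f0 i])
  also note piece_le_bound[OF i]
  finally show ?thesis .
qed

lemma mass_energy_le:
  assumes "i \<le> k"
  shows "4 * (real k)\<^sup>2 * (capacity k z i * E i * measure \<mu> (piece k z i)) \<le> E i"
proof -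
  have "4 * (real k)\<^sup>2 * (capacity k z i * measure \<mu> (piece k z i)) \<le> 1"
    using balanced[OF assms] k_pos by (simp add: field_simps)
  from mult_right_mono[OF this energy_nonneg[OF assms]] show ?thesis by (simp add: mult_ac)
qed

lemma bound_integral_le:
  "4 * (real k)\<^sup>2 * (LINT w|\<mu>. (\<Sum>i\<le>k. capacity k z i * E i * indicator (piece k z i) w)) \<le> q f f"
  unfolding bound_integral energy_sum[symmetric] sum_distrib_left by (intro sum_mono mass_energy_le) simp

lemma square_integral_le:
  "(LINT w|\<mu>. (f w)\<^sup>2) \<le> (LINT w|\<mu>. (\<Sum>i\<le>k. capacity k z i * E i * indicator (piece k z i) w))"
  using H1_square_integrable[OF \<mu> f] square_le_bound P_prob_space[OF \<mu>]
  by (intro integral_mono bound_measurable) (auto simp: square_integrable_def)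

text \<open>The integral of f^2 is at most the sum of capacity * energy * mass over the pieces;
  balance bounds capacity * mass by 1/(4k^2), which leaves the total energy.\<close>

lemma energy_lower_bound: "4 * (real k)\<^sup>2 * (LINT w|\<mu>. (f w)\<^sup>2) \<le> q f f"
  using mult_left_mono[OF square_integral_le, of "4 * (real k)\<^sup>2"] bound_integral_le by simp

text \<open>Without energy f is constant on the closed piece, and at least one of its two ends is a
  prescribed zero because k \<ge> 1.\<close>

lemma energy_zero_imp_zero:
  assumes i: "i \<le> k" and E: "E i = 0" and w: "z i \<le> w" "w \<le> z (Suc i)"
  shows "f w = 0"
proof -
  have b: "0 \<le> z i" "z (Suc i) \<le> 1" using i z_bounds by auto
  have m: "e (z i) \<le> e w" "e w \<le> e (z (Suc i))" using e(3) b w by auto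
  then have eq: "e w = e (z i)" "e w = e (z (Suc i))" using E by (auto simp: E_def)
  have "(f w - f (z i))\<^sup>2 \<le> 0" "(f (z (Suc i)) - f w)\<^sup>2 \<le> 0"
    using e(4)[of "z i" w] e(4)[of w "z (Suc i)"] b w eq by auto
  then have "f w = f (z i)" "f w = f (z (Suc i))" by simp_all
  moreover have "f (z i) = 0 \<or> f (z (Suc i)) = 0"
    using f0[of i] f0[of "Suc i"] i k by (cases "i = 0") auto
  ultimately show ?thesis by auto
qed

section \<open>Equality: one atom per piece of positive energy\<close>

context
  assumes eq: "q f f = 4 * (real k)\<^sup>2 * (LINT w|\<mu>. (f w)\<^sup>2)"
begin

text \<open>The inequality of \<open>mass_energy_le\<close> holds in each term, and the sums of both
  sides agree.\<close>

lemma mass_energy_eq: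
  assumes "i \<le> k"
  shows "4 * (real k)\<^sup>2 * (capacity k z i * E i * measure \<mu> (piece k z i)) = E i"
proof -
  have "q f f \<le> 4 * (real k)\<^sup>2 * (\<Sum>i\<le>k. capacity k z i * E i * measure \<mu> (piece k z i))"
    unfolding eq using square_integral_le[unfolded bound_integral] by (intro mult_left_mono) auto
  then have le: "(\<Sum>i\<le>k. E i - 4 * (real k)\<^sup>2 * (capacity k z i * E i * measure \<mu> (piece k z i))) \<le> 0"
    by (simp add: sum_subtractf energy_sum sum_distrib_left)
  have nn: "0 \<le> E i - 4 * (real k)\<^sup>2 * (capacity k z i * E i * measure \<mu> (piece k z i))" if "i \<in> {..k}" for i
    using mass_energy_le[of i] that by simp
  have "(\<Sum>i\<le>k. E i - 4 * (real k)\<^sup>2 * (capacity k z i * E i * measure \<mu> (piece k z i))) = 0"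
    by (intro antisym[OF le] sum_nonneg nn)
  then have "\<forall>i\<in>{..k}. E i - 4 * (real k)\<^sup>2 * (capacity k z i * E i * measure \<mu> (piece k z i)) = 0"
    by (subst (asm) sum_nonneg_eq_0_iff[OF finite_atMost]) (fact nn)+
  then show ?thesis using assms by simp
qed

lemma AE_square_eq_bound: "AE w in \<mu>. (f w)\<^sup>2 = (\<Sum>i\<le>k. capacity k z i * E i * indicator (piece k z i) w)"
proof -
  let ?B = "\<lambda>w. \<Sum>i\<le>k. capacity k z i * E i * indicator (piece k z i) w"
  have i: "integrable \<mu> (\<lambda>w. (f w)\<^sup>2)" using H1_square_integrable[OF \<mu> f] by (simp add: square_integrable_def)
  have "4 * (real k)\<^sup>2 * (LINT w|\<mu>. ?B w) \<le> 4 * (real k)\<^sup>2 * (LINT w|\<mu>. (f w)\<^sup>2)"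
    using bound_integral_le eq by simp
  then have "(LINT w|\<mu>. ?B w) \<le> (LINT w|\<mu>. (f w)\<^sup>2)"
    by (rule mult_left_le_imp_le) (use k_pos in simp)
  then have "(LINT w|\<mu>. ?B w - (f w)\<^sup>2) = 0"
    using square_integral_le by (subst Bochner_Integration.integral_diff[OF bound_measurable i]) linarith
  moreover have "AE w in \<mu>. 0 \<le> ?B w - (f w)\<^sup>2"
    using square_le_bound P_prob_space[OF \<mu>] by (intro AE_I2) simp
  ultimately have "AE w in \<mu>. ?B w - (f w)\<^sup>2 = 0"
    using integral_nonneg_eq_0_iff_AE[OF Bochner_Integration.integrable_diff[OF bound_measurable i]] by simp
  then show ?thesis by eventually_elim simp
qed

text \<open>Almost everywhere on the piece f^2 attains the bound of \<open>piece_bound\<close>,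
  which with positive energy is possible only at the peak.\<close>

lemma AE_piece:
  assumes i: "i \<le> k" and E: "0 < E i"
  shows "AE w in \<mu>. w \<in> piece k z i \<longrightarrow> w = peak k z i \<and> (f w)\<^sup>2 = capacity k z i * E i"
  using AE_square_eq_bound
proof eventually_elim
  case (elim w)
  show ?case
  proof
    assume w: "w \<in> piece k z i"
    have "(f w)\<^sup>2 \<le> capacity k z i * E i"
      unfolding E_def by (rule piece_bound(1)[OF e(3,4) f0 i w])
    then have *: "(f w)\<^sup>2 = capacity k z i * E i" using piece_le_bound[OF i w] elim by simp
    have "w = peak k z i"
      by (rule piece_bound(2)[OF e(3,4) f0 i w]) (use * E in \<open>auto simp: E_def\<close>)
    then show "w = peak k z i \<and> (f w)\<^sup>2 = capacity k z i * E i" using * by simp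
  qed
qed

lemma capacity_mass_eq:
  assumes "i \<le> k" "0 < E i"
  shows "capacity k z i * measure \<mu> (piece k z i) = 1 / (4 * (real k)\<^sup>2)"
proof -
  have "E i * (4 * (real k)\<^sup>2 * (capacity k z i * measure \<mu> (piece k z i))) = E i * 1"
    using mass_energy_eq[OF assms(1)] by (simp add: mult_ac)
  then have "4 * (real k)\<^sup>2 * (capacity k z i * measure \<mu> (piece k z i)) = 1"
    using assms(2) by (subst (asm) mult_left_cancel) auto
  then show ?thesis using k_pos by (simp add: field_simps)
qed

lemma capacity_mass_pos:
  assumes "i \<le> k" "0 < E i"
  shows "0 < capacity k z i" "0 < measure \<mu> (piece k z i)"
proof -
  have "0 < capacity k z i * measure \<mu> (piece k z i)"
    unfolding capacity_mass_eq[OF assms] using k_pos by simp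
  then show "0 < capacity k z i" "0 < measure \<mu> (piece k z i)"
    using capacity_nonneg[OF assms(1)] measure_nonneg[of \<mu> "piece k z i"]
    by (auto simp: zero_less_mult_iff)
qed

text \<open>Ensures that \<open>AE_piece\<close> does not hold vacuously: positive energy forces
  positive mass.\<close>

lemma not_AE_not_piece:
  assumes "i \<le> k" "0 < E i"
  shows "\<not> (AE w in \<mu>. w \<notin> piece k z i)"
proof
  assume "AE w in \<mu>. w \<notin> piece k z i"
  then have "measure \<mu> (piece k z i) = measure \<mu> {}"
    using piece_sets[OF \<mu>] by (intro measure_eq_AE) auto
  then show False using capacity_mass_pos[OF assms] by simp
qed

lemma peak_in_piece:
  assumes "i \<le> k" "0 < E i"
  shows "peak k z i \<in> piece k z i"
proof (rule ccontr)
  assume "peak k z i \<notin> piece k z i"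
  then have "AE w in \<mu>. w \<notin> piece k z i" using AE_piece[OF assms] by (auto elim!: eventually_mono)
  then show False using not_AE_not_piece[OF assms] by simp
qed

lemma peak_nonzero:
  assumes "i \<le> k" "0 < E i"
  shows "f (peak k z i) \<noteq> 0"
proof
  assume 0: "f (peak k z i) = 0"
  have "0 < capacity k z i * E i" using capacity_mass_pos[OF assms] assms by simp
  then have "AE w in \<mu>. w \<notin> piece k z i" using AE_piece[OF assms] 0 by (auto elim!: eventually_mono)
  then show False using not_AE_not_piece[OF assms] by simp
qed

lemma measure_peak:
  assumes "i \<le> k" "0 < E i"
  shows "measure \<mu> {peak k z i} = measure \<mu> (piece k z i)"
proof (rule measure_eq_AE)
  show "AE w in \<mu>. w \<in> {peak k z i} \<longleftrightarrow> w \<in> piece k z i"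
    using AE_piece[OF assms] by eventually_elim (use peak_in_piece[OF assms] in auto)
  show "{peak k z i} \<in> sets \<mu>" using peak_in_unit[OF assms(1)] P_prob_sets_iff[OF \<mu>] by auto
qed (rule piece_sets[OF \<mu>])

section \<open>Equality: unique continuation and rigidity\<close>

context
  assumes eig: "f \<in> eigenspace \<mu> (4 * (real k)\<^sup>2)"
begin

text \<open>If the next piece had no energy, f would vanish beyond the zero b up to the end of that
  piece, while strictly between the peak p and b there is no mass, all of it sitting at p. The kink
  condition at b then gives f p = 0, contrary to \<open>peak_nonzero\<close>.\<close>

lemma energy_pos_right:
  assumes i: "Suc i \<le> k" and E: "0 < E i"
  shows "0 < E (Suc i)"
proof (rule ccontr)
  assume "\<not> 0 < E (Suc i)"
  then have E0: "E (Suc i) = 0" using energy_nonneg[OF i] by simp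
  have ik: "i \<le> k" using i by simp
  define p b r where "p = peak k z i" and "b = z (Suc i)" and "r = z (Suc (Suc i))"
  have fb: "f b = 0" using f0[of "Suc i"] i by (simp add: b_def)
  have pp: "p \<in> piece k z i" unfolding p_def using peak_in_piece[OF ik E] .
  have p: "0 \<le> p" "p < b" "z i \<le> p" using pp i piece_subset[OF ik pp] by (auto simp: piece_def b_def)
  have left: "AE w in \<mu>. p < w \<and> w < b \<longrightarrow> f w = 0"
    using AE_piece[OF ik E]
  proof eventually_elim
    case (elim w)
    have "w \<in> piece k z i" if "p < w" "w < b"
      using that pp z_bounds[of "Suc i"] i by (auto simp: piece_def b_def)
    then show ?case using elim by (auto simp: p_def)
  qed
  have right: "f w = 0" if "b \<le> w" "w \<le> r" for w
    using energy_zero_imp_zero[OF i E0] that by (simp add: b_def r_def)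
  have "f p = 0"
  proof (cases "b < r")
    case True
    have "r \<le> 1" using z_bounds[of "Suc (Suc i)"] i by (simp add: r_def)
    moreover have "AE w in \<mu>. p < w \<and> w < r \<longrightarrow> f w = 0"
      using left
    proof eventually_elim
      case (elim w)
      then show ?case using right[of w] by linarith
    qed
    ultimately have "f p / (b - p) + f r / (r - b) = 0"
      using eigenfunction_two_sided[OF \<mu> eig p(1,2) True] fb by blast
    then show ?thesis using right[of r] True p by simp
  next
    \<comment> \<open>The next piece is collapsed, so the zero b is the end point 1 of the
      path.\<close>
    case False
    then have b1: "b = 1" using z_step[OF i] by (auto simp: b_def r_def)
    have "AE w in \<mu>. p < w \<longrightarrow> f w = 0"
      using left AE_space by eventually_elim (use P_prob_space[OF \<mu>] fb b1 in \<open>auto simp: order_le_less\<close>)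
    then show ?thesis
      using eigenfunction_right_end[OF \<mu> eig p(1) _ fb[unfolded b1]] p b1 by simp
  qed
  then show False using peak_nonzero[OF ik E] by (simp add: p_def)
qed

text \<open>The reflected argument, with one case fewer: a collapsed piece cannot precede a piece
  that contains its peak.\<close>

lemma energy_pos_left:
  assumes i: "Suc i \<le> k" and E: "0 < E (Suc i)"
  shows "0 < E i"
proof (rule ccontr)
  assume "\<not> 0 < E i"
  then have E0: "E i = 0" using energy_nonneg[of i] i by simp
  define p b r where "p = z i" and "b = z (Suc i)" and "r = peak k z (Suc i)"
  have fb: "f b = 0" using f0[of "Suc i"] i by (simp add: b_def)
  have rp: "r \<in> piece k z (Suc i)" unfolding r_def using peak_in_piece[OF i E] .
  have r: "b < r" "r \<le> 1" using rp by (auto simp: piece_def b_def)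
  have p: "0 \<le> p" "p < b" using z_bounds[of i] z_step[of i] i r by (auto simp: p_def b_def)
  have left: "f w = 0" if "p \<le> w" "w \<le> b" for w
    using energy_zero_imp_zero[OF _ E0] i that by (simp add: b_def p_def)
  have "AE w in \<mu>. p < w \<and> w < r \<longrightarrow> f w = 0"
    using AE_piece[OF i E] AE_space
  proof eventually_elim
    case (elim w)
    have "w \<in> piece k z (Suc i)" if "b < w" "w < r"
      using that elim rp P_prob_space[OF \<mu>] by (auto simp: piece_def b_def)
    then show ?case using elim left by (cases "w \<le> b") (auto simp: r_def)
  qed
  then have "f p / (b - p) + f r / (r - b) = 0"
    using eigenfunction_two_sided[OF \<mu> eig p r] fb by blast
  then have "f r = 0" using left[of p] p r by simp
  then show False using peak_nonzero[OF i E] by (simp add: r_def)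
qed

text \<open>Some piece has energy; positivity is carried left to the first piece and from there to
  all others.\<close>

lemma energy_pos:
  assumes "0 < q f f" "i \<le> k"
  shows "0 < E i"
proof -
  have "\<exists>j\<le>k. 0 < E j"
  proof (rule ccontr)
    assume "\<not> ?thesis"
    then have "(\<Sum>i\<le>k. E i) \<le> 0" by (intro sum_nonpos) auto
    then show False using energy_sum assms by simp
  qed
  then obtain j where j: "j \<le> k" "0 < E j" by auto
  have "0 < E 0" using j
  proof (induction j)
    case 0
    then show ?case by simp
  next
    case (Suc j)
    then show ?case using energy_pos_left[of j] by simp
  qed
  show ?thesis using assms(2)
  proof (induction i)
    case (Suc i)
    then show ?case using energy_pos_right[of i] by simp
  qed (use \<open>0 < E 0\<close> in simp)
qed

text \<open>Equality in the balance condition makes length times mass equal to weight^2 on every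
  piece, so length + mass \<ge> 2 * weight by the inequality of arithmetic and geometric means.
  Lengths add up to 1, masses to at most 1 and weights to 1; hence length = mass = weight
  throughout, which fixes the partition and puts the peaks at i/k.\<close>

lemma equality_atoms:
  assumes pos: "0 < q f f" and i: "i \<le> k"
  shows "measure \<mu> {real i / real k} = weight k i"
proof -
  note E = energy_pos[OF pos]
  interpret prob_space \<mu> using P_prob_prob_space[OF \<mu>] .
  define m where "m i = measure \<mu> (piece k z i)" for i
  define len where "len i = z (Suc i) - z i" for i
  have m0: "0 \<le> m i" for i by (simp add: m_def)
  have l0: "0 \<le> len i" if "i \<le> k" for i using z_mono[of i "Suc i"] that by (simp add: len_def)
  \<comment> \<open>The factor 1/4 in the capacity of an inner piece turns the common value 1/(4k^2)
    into 1/k^2 for length times mass.\<close>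
  have lm: "len i * m i = (weight k i)\<^sup>2" if i: "i \<le> k" for i
    using capacity_mass_eq[OF i E[OF i]] k z_first z_last k_pos
    by (auto simp: capacity_def weight_def m_def len_def power_divide power_mult_distrib field_simps split: if_splits)
  have w0: "0 \<le> weight k i" for i by (simp add: weight_def)
  have square: "(2 * weight k i)\<^sup>2 \<le> (len i + m i)\<^sup>2" if i: "i \<le> k" for i
  proof -
    have "(len i + m i)\<^sup>2 - (2 * weight k i)\<^sup>2 = (len i - m i)\<^sup>2"
      using lm[OF i] by (simp add: power2_eq_square algebra_simps)
    then show ?thesis by (metis diff_ge_0_iff_ge zero_le_power2)
  qed
  have le: "2 * weight k i \<le> len i + m i" if i: "i \<le> k" for i
    using square[OF i] by (rule power2_le_imp_le) (use l0[OF i] m0 in simp)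
  have "(\<Sum>i\<le>k. len i) = 1"
    using sum_lessThan_telescope[of z "Suc k"] z_first z_last
    by (simp only: lessThan_Suc_atMost len_def)
  moreover have "(\<Sum>i\<le>k. m i) \<le> 1"
  proof -
    have "disjoint_family_on (piece k z) {..k}"
      unfolding disjoint_family_on_def
      using piece_disjoint by (metis Int_commute atMost_iff linorder_neqE_nat)
    then have "(\<Sum>i\<le>k. m i) = measure \<mu> (\<Union>i\<le>k. piece k z i)"
      unfolding m_def using piece_sets[OF \<mu>] by (intro finite_measure_finite_Union[symmetric]) auto
    then show ?thesis by simp
  qed
  ultimately have le0: "(\<Sum>i\<le>k. len i + m i - 2 * weight k i) \<le> 0"
    using sum_weight[OF k] by (simp add: sum.distrib sum_subtractf flip: sum_distrib_left)
  have nn: "0 \<le> len i + m i - 2 * weight k i" if "i \<in> {..k}" for i using le that by simp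
  have "(\<Sum>i\<le>k. len i + m i - 2 * weight k i) = 0" by (intro antisym[OF le0] sum_nonneg nn)
  then have z0: "\<forall>i\<in>{..k}. len i + m i - 2 * weight k i = 0"
    by (subst (asm) sum_nonneg_eq_0_iff[OF finite_atMost]) (fact nn)+
  have eqs: "len i = weight k i" "m i = weight k i" if i: "i \<le> k" for i
  proof -
    have s: "len i + m i = 2 * weight k i" using z0 i by simp
    have "(len i - m i)\<^sup>2 = (len i + m i)\<^sup>2 - 4 * (len i * m i)" by (simp add: power2_eq_square algebra_simps)
    also have "\<dots> = 0" unfolding s lm[OF i] by (simp add: power2_eq_square)
    finally have "len i = m i" by simp
    then show "len i = weight k i" "m i = weight k i" using s by auto
  qed
  \<comment> \<open>Adding up the lengths: the zeros are the midpoints between consecutive nodes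
    i/k.\<close>
  have z: "z (Suc j) = (2 * real j + 1) / (2 * real k)" if "j < k" for j using that
  proof (induction j)
    case 0
    then show ?case using eqs(1)[of 0] z_first by (simp add: len_def weight_def)
  next
    case (Suc j)
    have "z (Suc (Suc j)) = z (Suc j) + 1 / real k"
      using eqs(1)[of "Suc j"] Suc by (simp add: len_def weight_def)
    then show ?case using Suc k_pos by (simp add: field_simps)
  qed
  have "peak k z i = real i / real k"
  proof (cases "i = 0 \<or> i = k")
    case True
    then show ?thesis using k by (auto simp: peak_def)
  next
    case False
    then obtain j where j: "i = Suc j" by (cases i) auto
    then show ?thesis using False i z[of j] z[of "Suc j"] k_pos by (simp add: peak_def field_simps)
  qed
  then show ?thesis using measure_peak[OF i E[OF i]] eqs(2)[OF i] by (simp add: m_def)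
qed

end
end
end
end

section \<open>The optimal measure\<close>

text \<open>Formulated for a finite set of eigenvalues instead of \<open>eigval\<close>, which is an
  infimum: the equality case at t = 4k^2 refers to an actual family of eigenfunctions.\<close>

lemma eigenvalue_sum_lower_bound:
  assumes \<mu>: "\<mu> \<in> P_prob_measures" and k: "1 \<le> k" and F: "finite F" "F \<subseteq> {..t}"
    and n: "enat (Suc k) \<le> (\<Sum>l\<in>F. L2_dim \<mu> (eigenspace \<mu> l))"
  shows "4 * (real k)\<^sup>2 \<le> t"
    and "t = 4 * (real k)\<^sup>2 \<Longrightarrow> i \<le> k \<Longrightarrow> measure \<mu> {real i / real k} = weight k i"
proof -
  obtain z where z: "unit_partition k z"
    and b: "\<And>i. i \<le> k \<Longrightarrow> capacity k z i * measure \<mu> (piece k z i) \<le> 1 / (4 * (real k)\<^sup>2)"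
    using exists_balanced_partition[OF \<mu> k] by blast
  interpret unit_partition k z by fact
  interpret balanced_partition k z \<mu> by unfold_locales (fact \<mu>, fact b)
  obtain f where f: "f \<in> H1" "\<And>j. j < k \<Longrightarrow> f (z (Suc j)) = 0" "0 < (LINT x|\<mu>. (f x)\<^sup>2)"
    "q f f \<le> t * (LINT x|\<mu>. (f x)\<^sup>2)"
    "q f f = t * (LINT x|\<mu>. (f x)\<^sup>2) \<Longrightarrow> f \<in> eigenspace \<mu> t"
    using eigenfunction_combination[OF \<mu> F n, of "\<lambda>j. z (Suc j)"] by blast
  have f0: "f (z i) = 0" if "1 \<le> i" "i \<le> k" for i using f(2)[of "i - 1"] that by simp
  obtain e :: "real \<Rightarrow> real" where e: "e 0 = 0" "e 1 = q f f"
    "\<And>a b. 0 \<le> a \<Longrightarrow> a \<le> b \<Longrightarrow> b \<le> 1 \<Longrightarrow> e a \<le> e b"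
    "\<And>a b. 0 \<le> a \<Longrightarrow> a \<le> b \<Longrightarrow> b \<le> 1 \<Longrightarrow> (f b - f a)\<^sup>2 \<le> (b - a) * (e b - e a)"
    using H1_energy[OF f(1)] by blast
  have le: "4 * (real k)\<^sup>2 * (LINT x|\<mu>. (f x)\<^sup>2) \<le> q f f"
    by (rule energy_lower_bound[OF f(1) f0 e])
  then have "4 * (real k)\<^sup>2 * (LINT x|\<mu>. (f x)\<^sup>2) \<le> t * (LINT x|\<mu>. (f x)\<^sup>2)" using f(4) by linarith
  then show "4 * (real k)\<^sup>2 \<le> t" using f(3) by (rule mult_right_le_imp_le)
  assume t: "t = 4 * (real k)\<^sup>2" and i: "i \<le> k"
  have eq: "q f f = 4 * (real k)\<^sup>2 * (LINT x|\<mu>. (f x)\<^sup>2)" using le f(4) t by simp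
  have eig: "f \<in> eigenspace \<mu> (4 * (real k)\<^sup>2)" using f(5) eq t by simp
  have pos: "0 < q f f" unfolding eq using f(3) k by simp
  show "measure \<mu> {real i / real k} = weight k i"
    by (rule equality_atoms[OF f(1) f0 e eq eig pos i])
qed

lemma eigval_lower_bound:
  assumes \<mu>: "\<mu> \<in> P_prob_measures"
  shows "ereal (4 * (real k)\<^sup>2) \<le> eigval k \<mu>"
proof -
  have "4 * (real k)\<^sup>2 \<le> t" if t: "enat (Suc k) \<le> eigenvalue_count \<mu> t" for t
  proof -
    obtain F where F: "finite F" "F \<subseteq> {..t}" "enat (Suc k) \<le> (\<Sum>l\<in>F. L2_dim \<mu> (eigenspace \<mu> l))"
      using eigenvalue_count_witness[OF t] .
    show ?thesis
    proof (cases "k = 0")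
      case False
      then show ?thesis using eigenvalue_sum_lower_bound(1)[OF \<mu> _ F] by simp
    next
      case True
      \<comment> \<open>For k = 0 there are no zeros to prescribe; nonnegativity of the form
        replaces the partition argument.\<close>
      obtain f where f: "0 < (LINT x|\<mu>. (f x)\<^sup>2)" "q f f \<le> t * (LINT x|\<mu>. (f x)\<^sup>2)"
        using eigenfunction_combination[OF \<mu> F, of "\<lambda>_. 0"] by blast
      have "0 \<le> q f f" unfolding q_def by (rule Bochner_Integration.integral_nonneg) simp
      then have "0 \<le> t" using f by (meson order_trans zero_le_mult_iff not_less)
      then show ?thesis using True by simp
    qed
  qed
  then show ?thesis by (auto simp: eigval_def intro!: INF_greatest)
qed

text \<open>The lower bound for all indices makes the number of eigenvalues below any threshold finite, which
  yields attainment of the infimum in \<open>eigval\<close> without compactness.\<close>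

lemma eigval_attained:
  assumes \<mu>: "\<mu> \<in> P_prob_measures" and l: "eigval k \<mu> = ereal l"
  obtains F where "finite F" "F \<subseteq> {..l}" "enat (Suc k) \<le> (\<Sum>l\<in>F. L2_dim \<mu> (eigenspace \<mu> l))"
proof -
  define L where "L = {s. s \<le> l + 1 \<and> L2_dim \<mu> (eigenspace \<mu> s) \<noteq> 0}"
  have "finite L"
  proof (rule ccontr)
    assume inf: "infinite L"
    \<comment> \<open>If infinitely many eigenvalues were at most l + 1, then N + 1 of them would
      give 4N^2 \<le> l + 1, impossible for large N.\<close>
    obtain N :: nat where N: "\<bar>l\<bar> + 1 < real N" using reals_Archimedean2 by blast
    then have N1: "1 \<le> N" by (cases N) auto
    obtain F where F: "finite F" "card F = Suc N" "F \<subseteq> L"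
      using infinite_arbitrarily_large[OF inf] by blast
    have "enat (Suc N) = (\<Sum>s\<in>F. 1)" using F by (simp add: of_nat_eq_enat)
    also have "\<dots> \<le> (\<Sum>s\<in>F. L2_dim \<mu> (eigenspace \<mu> s))"
    proof (rule sum_mono)
      fix s assume "s \<in> F"
      then have "L2_dim \<mu> (eigenspace \<mu> s) \<noteq> 0" using F by (auto simp: L_def)
      then show "1 \<le> L2_dim \<mu> (eigenspace \<mu> s)" by (simp add: one_eSuc ileI1)
    qed
    finally have "4 * (real N)\<^sup>2 \<le> l + 1"
      by (rule eigenvalue_sum_lower_bound(1)[OF \<mu> N1 F(1), rotated]) (use F in \<open>auto simp: L_def\<close>)
    moreover have "real N * 1 \<le> real N * real N" using N1 by (intro mult_left_mono) auto
    ultimately show False using N by (simp add: power2_eq_square)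
  qed
  \<comment> \<open>No eigenvalue lies strictly between l and u, so a threshold t < u counts nothing
    that is not already counted at l.\<close>
  define u where "u = Min (insert (l + 1) {s \<in> L. l < s})"
  have u: "l < u" "u \<le> l + 1" unfolding u_def using \<open>finite L\<close> by (auto simp: Min_gr_iff)
  have gap: "s \<notin> L" if "l < s" "s < u" for s
  proof
    assume "s \<in> L"
    then have "u \<le> s" unfolding u_def using \<open>finite L\<close> that by (intro Min_le) auto
    then show False using that by simp
  qed
  have "Inf (ereal ` {t. enat (Suc k) \<le> eigenvalue_count \<mu> t}) < ereal u"
    using l u by (auto simp: eigval_def split: if_splits)
  then obtain t where t: "enat (Suc k) \<le> eigenvalue_count \<mu> t" "t < u"
    by (auto simp: INF_less_iff)
  obtain F where F: "finite F" "F \<subseteq> {..t}" "enat (Suc k) \<le> (\<Sum>l\<in>F. L2_dim \<mu> (eigenspace \<mu> l))"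
    using eigenvalue_count_witness[OF t(1)] .
  have "(\<Sum>s\<in>F. L2_dim \<mu> (eigenspace \<mu> s)) = (\<Sum>s\<in>F \<inter> {..l}. L2_dim \<mu> (eigenspace \<mu> s))"
  proof (rule sum.mono_neutral_right)
    show "\<forall>s\<in>F - F \<inter> {..l}. L2_dim \<mu> (eigenspace \<mu> s) = 0"
    proof
      fix s assume s: "s \<in> F - F \<inter> {..l}"
      then have "l < s" "s < u" using F t by auto
      then show "L2_dim \<mu> (eigenspace \<mu> s) = 0" using gap[of s] u by (auto simp: L_def)
    qed
  qed (use F in auto)
  then show ?thesis using that[of "F \<inter> {..l}"] F by simp
qed

section \<open>Measures with the optimal atoms\<close>

lemma AE_atom:
  assumes "\<mu> \<in> P_prob_measures" "0 < measure \<mu> {a}" "AE x in \<mu>. P x"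
  shows "P a"
proof (rule ccontr)
  assume "\<not> P a"
  then have "AE x in \<mu>. x \<notin> {a}" using assms(3) by (auto elim!: eventually_mono)
  moreover have "{a} \<in> sets \<mu>" using assms(2) measure_notin_sets by fastforce
  ultimately have "measure \<mu> {a} = measure \<mu> {}" by (intro measure_eq_AE) auto
  then show False using assms(2) by simp
qed

lemma weight_pos: "1 \<le> k \<Longrightarrow> 0 < weight k i"
  by (simp add: weight_def)

text \<open>The weights sum to 1, so these atoms exhaust the mass and determine \<mu>. Both
  \<open>mu_opt\<close> and any minimizer coming from the equality case are instances, which yields
  uniqueness.\<close>

locale optimal_atoms =
  fixes k :: nat and \<mu> :: "real measure"
  assumes k: "1 \<le> k" and \<mu>: "\<mu> \<in> P_prob_measures"
    and atoms: "i \<le> k \<Longrightarrow> measure \<mu> {real i / real k} = weight k i"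
begin

lemma k_pos: "0 < real k"
  using k by simp

lemma node_in_unit: "i \<le> k \<Longrightarrow> real i / real k \<in> {0..1}"
  using k_pos by simp

lemma node_sets: "i \<le> k \<Longrightarrow> {real i / real k} \<in> sets \<mu>"
  using node_in_unit by (auto simp: P_prob_sets_iff[OF \<mu>])

lemma node_in_supp: "i \<le> k \<Longrightarrow> real i / real k \<in> supp \<mu>"
  by (rule atom_in_supp[OF \<mu> node_in_unit]) (use atoms weight_pos[OF k] in auto)

lemma AE_nodes: "AE x in \<mu>. x \<in> (\<lambda>i. real i / real k) ` {..k}"
proof -
  interpret prob_space \<mu> using P_prob_prob_space[OF \<mu>] .
  let ?K = "(\<lambda>i. real i / real k) ` {..k}"
  have inj: "inj_on (\<lambda>i. real i / real k) {..k}" using k_pos by (auto simp: inj_on_def)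
  have K: "?K \<in> sets \<mu>" using node_in_unit by (auto simp: P_prob_sets_iff[OF \<mu>] intro!: borel_closed finite_imp_closed)
  have "measure \<mu> ?K = (\<Sum>x\<in>?K. measure \<mu> {x})"
    using node_sets by (intro finite_measure_eq_sum_singleton) auto
  also have "\<dots> = (\<Sum>i\<le>k. weight k i)"
    unfolding sum.reindex[OF inj] using atoms by (intro sum.cong) auto
  finally have "measure \<mu> ?K = 1" using sum_weight[OF k] by simp
  then show ?thesis using AE_prob_1 by blast
qed

lemma integral_eq:
  fixes g :: "real \<Rightarrow> real"
  assumes g: "g \<in> borel_measurable \<mu>"
  shows "(LINT x|\<mu>. g x) = (\<Sum>i\<le>k. weight k i * g (real i / real k))"
proof -
  interpret finite_measure \<mu> using P_prob_finite_measure[OF \<mu>] .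
  have ind: "integrable \<mu> (indicator {real i / real k} :: real \<Rightarrow> real)" if "i \<le> k" for i
    using node_sets[OF that] by (intro integrable_real_indicator) (auto simp: less_top[symmetric] emeasure_finite)
  have m: "(\<lambda>x. \<Sum>i\<le>k. g (real i / real k) * indicator {real i / real k} x) \<in> borel_measurable \<mu>"
    using ind by (intro borel_measurable_sum borel_measurable_times) auto
  have "(LINT x|\<mu>. g x) = (LINT x|\<mu>. (\<Sum>i\<le>k. g (real i / real k) * indicator {real i / real k} x))"
  proof (rule integral_cong_AE[OF g m])
    show "AE x in \<mu>. g x = (\<Sum>i\<le>k. g (real i / real k) * indicator {real i / real k} x)"
      using AE_nodes
    proof eventually_elim
      case (elim x)
      then obtain j where j: "j \<le> k" "x = real j / real k" by auto
      have "(\<Sum>i\<le>k. g (real i / real k) * indicator {real i / real k} x) = (\<Sum>i\<le>k. if i = j then g x else 0)"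
        using j k_pos by (intro sum.cong) (auto simp: indicator_def)
      then show ?case using j by simp
    qed
  qed
  also have "\<dots> = (\<Sum>i\<le>k. LINT x|\<mu>. g (real i / real k) * indicator {real i / real k} x)"
    using ind by (intro Bochner_Integration.integral_sum) auto
  also have "\<dots> = (\<Sum>i\<le>k. weight k i * g (real i / real k))"
    using atoms node_in_unit P_prob_space[OF \<mu>] by (intro sum.cong) (auto simp: Int_absorb2)
  finally show ?thesis .
qed

lemma measure_eq:
  assumes "A \<in> sets \<mu>"
  shows "measure \<mu> A = (\<Sum>i\<le>k. weight k i * indicator A (real i / real k))"
  using integral_eq[of "indicator A"] assms sets.sets_into_space[OF assms]
  by (simp add: Int_absorb2)

end

lemma optimal_atoms_unique:
  assumes "optimal_atoms k \<mu>" "optimal_atoms k \<nu>"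
  shows "\<mu> = \<nu>"
proof (rule measure_eqI)
  interpret M: optimal_atoms k \<mu> by fact
  interpret N: optimal_atoms k \<nu> by fact
  show sets: "sets \<mu> = sets \<nu>" using M.\<mu> N.\<mu> by (simp add: P_prob_measures_def)
  fix A assume A: "A \<in> sets \<mu>"
  interpret M': finite_measure \<mu> using P_prob_finite_measure[OF M.\<mu>] .
  interpret N': finite_measure \<nu> using P_prob_finite_measure[OF N.\<mu>] .
  show "emeasure \<mu> A = emeasure \<nu> A"
    using M.measure_eq[OF A] N.measure_eq[of A] A sets
    by (simp add: M'.emeasure_eq_measure N'.emeasure_eq_measure)
qed

text \<open>\<open>measure_of\<close> keeps its set function only if that function is countably
  additive. This is obtained by recognising it as the push-forward N of a point measure on {..k},
  which is a measure by construction.\<close>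

lemma optimal_atoms_mu_opt:
  assumes k: "1 \<le> k"
  shows "optimal_atoms k (mu_opt k)"
proof -
  have k0: "0 < real k" using k by simp
  define w where "w i = ennreal (weight k i)" for i
  define N where "N = distr (point_measure {..k} w) P_borel (\<lambda>i. real i / real k)"
  have meas: "(\<lambda>i. real i / real k) \<in> measurable (point_measure {..k} w) P_borel"
    using k0 by (auto simp: measurable_point_measure_eq1 space_restrict_space)
  have N: "emeasure N A = (\<Sum>i | i \<le> k \<and> real i / real k \<in> A. w i)" if "A \<in> sets P_borel" for A
  proof -
    have "emeasure N A = emeasure (point_measure {..k} w) ((\<lambda>i. real i / real k) -` A \<inter> {..k})"
      unfolding N_def using emeasure_distr[OF meas that] by (simp add: space_point_measure)
    also have "(\<lambda>i. real i / real k) -` A \<inter> {..k} = {i. i \<le> k \<and> real i / real k \<in> A}" by auto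
    also have "emeasure (point_measure {..k} w) \<dots> = (\<Sum>i | i \<le> k \<and> real i / real k \<in> A. w i)"
      by (intro emeasure_point_measure_finite) auto
    finally show ?thesis .
  qed
  have "mu_opt k = measure_of {0..1} (sets P_borel) (emeasure N)"
    unfolding mu_opt_def
  proof (rule measure_of_eq)
    show "sets P_borel \<subseteq> Pow {0..1}" by (auto simp: sets_restrict_space)
    fix A assume "A \<in> sigma_sets {0..1} (sets P_borel)"
    then have A: "A \<in> sets P_borel"
      using sets.sigma_sets_eq[of P_borel] by (simp add: space_restrict_space)
    have set_split: "{..k} = insert 0 (insert k {1..k - 1})" using k by auto
    have split: "sum g {..k} = g 0 + (g k + sum g {1..k - 1})" for g :: "nat \<Rightarrow> ennreal"
      unfolding set_split using k by simp
    have "emeasure N A = (\<Sum>i\<le>k. w i * indicator A (real i / real k))"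
    proof -
      have "(\<Sum>i\<le>k. w i * indicator A (real i / real k)) = (\<Sum>i\<le>k. if real i / real k \<in> A then w i else 0)"
        by (intro sum.cong) auto
      also have "\<dots> = (\<Sum>i | i \<in> {..k} \<and> real i / real k \<in> A. w i)"
        by (rule sum.inter_filter[symmetric]) simp
      finally show ?thesis unfolding N[OF A] by simp
    qed
    also have "\<dots> = w 0 * indicator A 0 + (w k * indicator A 1 + (\<Sum>i\<in>{1..k - 1}. w i * indicator A (real i / real k)))"
      unfolding split using k0 by simp
    also have "(\<Sum>i\<in>{1..k - 1}. w i * indicator A (real i / real k)) =
        (\<Sum>i\<in>{1..k - 1}. ennreal (1 / real k) * indicator A (real i / real k))"
      using k by (intro sum.cong) (auto simp: w_def weight_def)
    finally show "ennreal (1 / (2 * real k)) * emeasure (return P_borel 0) A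
        + ennreal (1 / (2 * real k)) * emeasure (return P_borel 1) A
        + (\<Sum>j\<in>{1..k - 1}. ennreal (1 / real k) * emeasure (return P_borel (real j / real k)) A) = emeasure N A"
      using A by (simp add: w_def weight_def add.assoc)
  qed
  also have "\<dots> = N"
    using measure_of_of_measure[of N] by (simp add: N_def space_restrict_space)
  finally have eq: "mu_opt k = N" .
  have setsN: "sets N = sets P_borel" by (simp add: N_def)
  have total: "emeasure N {0..1} = 1"
  proof -
    have "emeasure N {0..1} = (\<Sum>i | i \<le> k \<and> real i / real k \<in> {0..1}. w i)"
      by (rule N) (simp add: sets_restrict_space_iff)
    also have "{i. i \<le> k \<and> real i / real k \<in> {0..1}} = {..k}" using k0 by auto
    also have "(\<Sum>i\<le>k. w i) = ennreal (\<Sum>i\<le>k. weight k i)"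
      unfolding w_def by (rule sum_ennreal) (simp add: weight_def)
    finally show ?thesis using sum_weight[OF k] by simp
  qed
  show ?thesis unfolding eq
  proof
    have "space N = {0..1}" by (simp add: N_def space_restrict_space)
    then show "N \<in> P_prob_measures"
      using setsN total by (auto simp: P_prob_measures_def intro: prob_spaceI)
    fix i assume i: "i \<le> k"
    have "emeasure N {real i / real k} = (\<Sum>j | j \<le> k \<and> real j / real k \<in> {real i / real k}. w j)"
      using i k0 by (intro N) (auto simp: sets_restrict_space_iff)
    also have "{j. j \<le> k \<and> real j / real k \<in> {real i / real k}} = {i}" using i k0 by auto
    finally show "measure N {real i / real k} = weight k i"
      by (simp add: measure_def w_def weight_def)
  qed fact
qed

text \<open>The conditions on \<open>v 1\<close> and \<open>v (k - 1)\<close> are the recurrence at the end nodes \<open>0\<close> and \<open>k\<close> after even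
  reflection, that is, Neumann conditions.\<close>

lemma discrete_summation_by_parts:
  fixes v \<phi> :: "nat \<Rightarrow> real"
  assumes k: "1 \<le> k" and v1: "v 1 = c * v 0" and rec: "\<And>m. v (Suc (Suc m)) + v m = 2 * c * v (Suc m)"
    and vk: "v (k - 1) = c * v k"
  shows "(\<Sum>i<k. real k * (v (Suc i) - v i) * (\<phi> (Suc i) - \<phi> i)) =
    2 * (real k)\<^sup>2 * (1 - c) * (\<Sum>i\<le>k. weight k i * v i * \<phi> i)"
proof -
  define K where "K = real k"
  have K: "K \<noteq> 0" using k by (simp add: K_def)
  define D where "D = 2 * K\<^sup>2 * (1 - c)"
  have D: "D * (1 / (2 * K)) = K * (1 - c)" "D * (1 / K) = 2 * K * (1 - c)"
    using K by (auto simp: D_def power2_eq_square)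
  \<comment> \<open>The boundary term is the flux across the edge from n to n + 1. The recurrence
    absorbs it into the next summand; the condition on \<open>v (k - 1)\<close> finally turns it
    into the summand at node k, where the weight is halved.\<close>
  have partial: "n < k \<Longrightarrow> (\<Sum>i<Suc n. K * (v (Suc i) - v i) * (\<phi> (Suc i) - \<phi> i)) =
      D * (\<Sum>i\<le>n. weight k i * v i * \<phi> i) + K * (v (Suc n) - v n) * \<phi> (Suc n)" for n
  proof (induction n)
    case 0
    have "D * weight k 0 = K * (1 - c)" using D(1) by (simp add: weight_def K_def)
    then have "D * (weight k 0 * v 0 * \<phi> 0) = K * (1 - c) * v 0 * \<phi> 0" by (metis mult.assoc)
    then show ?case using v1 by (simp add: algebra_simps)
  next
    case (Suc n)
    have "D * weight k (Suc n) = 2 * K * (1 - c)" using D(2) Suc by (simp add: weight_def K_def)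
    then have w: "D * (weight k (Suc n) * v (Suc n) * \<phi> (Suc n)) = 2 * K * (1 - c) * v (Suc n) * \<phi> (Suc n)"
      by (metis mult.assoc)
    have r: "v (Suc (Suc n)) = 2 * c * v (Suc n) - v n" using rec[of n] by simp
    have "(\<Sum>i<Suc (Suc n). K * (v (Suc i) - v i) * (\<phi> (Suc i) - \<phi> i)) =
        D * (\<Sum>i\<le>n. weight k i * v i * \<phi> i) + K * (v (Suc n) - v n) * \<phi> (Suc n)
        + K * (v (Suc (Suc n)) - v (Suc n)) * (\<phi> (Suc (Suc n)) - \<phi> (Suc n))"
      using Suc by simp
    also have "\<dots> = D * (\<Sum>i\<le>n. weight k i * v i * \<phi> i) + 2 * K * (1 - c) * v (Suc n) * \<phi> (Suc n)
        + K * (v (Suc (Suc n)) - v (Suc n)) * \<phi> (Suc (Suc n))"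
      unfolding r by (simp add: algebra_simps)
    also have "\<dots> = D * (\<Sum>i\<le>Suc n. weight k i * v i * \<phi> i)
        + K * (v (Suc (Suc n)) - v (Suc n)) * \<phi> (Suc (Suc n))"
      unfolding w[symmetric] by (simp add: distrib_left)
    finally show ?case .
  qed
  obtain n where n: "k = Suc n" using k by (cases k) auto
  have "D * weight k k = K * (1 - c)" using D(1) by (simp add: weight_def K_def)
  then have w: "D * (weight k k * v k * \<phi> k) = K * (1 - c) * v k * \<phi> k" by (metis mult.assoc)
  have "(\<Sum>i<k. K * (v (Suc i) - v i) * (\<phi> (Suc i) - \<phi> i)) =
      D * (\<Sum>i\<le>n. weight k i * v i * \<phi> i) + K * (v k - v (k - 1)) * \<phi> k"
    using partial[of n] n by simp
  also have "K * (v k - v (k - 1)) * \<phi> k = D * (weight k k * v k * \<phi> k)"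
    unfolding vk w by (simp add: algebra_simps)
  also have "D * (\<Sum>i\<le>n. weight k i * v i * \<phi> i) + D * (weight k k * v k * \<phi> k) = D * (\<Sum>i\<le>k. weight k i * v i * \<phi> i)"
    by (simp add: n distrib_left)
  finally show ?thesis by (simp add: K_def D_def)
qed

section \<open>Eigenfunctions of the optimal measure\<close>

context optimal_atoms
begin

definition cosine_mode :: "nat \<Rightarrow> nat \<Rightarrow> real" where
  "cosine_mode j i = cos (pi * real j / real k * real i)"

text \<open>The piecewise linear interpolation, written as the value 1 at node 0 plus one ramp of
  final height 1/k per edge, scaled by k times the increment. All kinks then lie in the support, and
  pairing in \<open>q\<close> is immediate.\<close>

definition eigenfunction :: "nat \<Rightarrow> real \<Rightarrow> real" where
  "eigenfunction j x = (\<Sum>i<k. real k * (cosine_mode j (Suc i) - cosine_mode j i) *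
     ramp (real i / real k) (real (Suc i) / real k) x) + 1"

text \<open>Equal to 4k^2 * sin^2 (pi * j / (2k)), the spectrum of the discrete Neumann Laplacian on
  k edges of length 1/k; j = k gives 4k^2.\<close>

definition mode_eigenvalue :: "nat \<Rightarrow> real" where
  "mode_eigenvalue j = 2 * (real k)\<^sup>2 * (1 - cos (pi * real j / real k))"

lemma eigenfunction_node:
  assumes m: "m \<le> k"
  shows "eigenfunction j (real m / real k) = cosine_mode j m"
proof -
  have "real k * ramp (real i / real k) (real (Suc i) / real k) (real m / real k) = (if i < m then 1 else 0)" for i
  proof (cases "i < m")
    case True
    then have "real (Suc i) / real k \<le> real m / real k" using k_pos by (intro divide_right_mono) auto
    moreover have "real i / real k \<le> real (Suc i) / real k" by (intro divide_right_mono) auto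
    ultimately have "ramp (real i / real k) (real (Suc i) / real k) (real m / real k) = real (Suc i) / real k - real i / real k"
      unfolding ramp_def by linarith
    also have "\<dots> = 1 / real k" by (simp flip: diff_divide_distrib)
    finally show ?thesis using True k_pos by simp
  next
    case False
    then have "real m / real k \<le> real i / real k" using k_pos by (intro divide_right_mono) auto
    then have "ramp (real i / real k) (real (Suc i) / real k) (real m / real k) = 0"
      unfolding ramp_def by linarith
    then show ?thesis using False by simp
  qed
  then have "eigenfunction j (real m / real k) =
      (\<Sum>i<k. (cosine_mode j (Suc i) - cosine_mode j i) * (if i < m then 1 else 0)) + 1"
    unfolding eigenfunction_def by (simp only: mult.assoc mult.left_commute[of "real k"])
  also have "(\<Sum>i<k. (cosine_mode j (Suc i) - cosine_mode j i) * (if i < m then 1 else 0)) =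
      (\<Sum>i<m. cosine_mode j (Suc i) - cosine_mode j i)"
    using m by (intro sum.mono_neutral_cong_right) auto
  finally show ?thesis unfolding sum_lessThan_telescope by (simp add: cosine_mode_def)
qed

lemma eigenfunction_in_H1_mu: "eigenfunction j \<in> H1_mu \<mu>"
  unfolding eigenfunction_def[abs_def]
  by (rule H1_mu_add[OF H1_mu_sum[OF H1_mu_cmult[OF H1_mu_ramp]] H1_mu_const])
    (auto simp del: of_nat_Suc intro!: node_in_supp divide_right_mono)

text \<open>Pairing with the ramps turns the form into a sum over the edges, the integral is a
  weighted sum over the nodes, and \<open>discrete_summation_by_parts\<close> matches the
  two.\<close>

lemma eigenfunction_in_eigenspace: "eigenfunction j \<in> eigenspace \<mu> (mode_eigenvalue j)"
  unfolding eigenspace_iff[OF \<mu>]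
proof (intro conjI ballI)
  fix \<phi> assume \<phi>: "\<phi> \<in> H1_mu \<mu>"
  then have \<phi>H: "\<phi> \<in> H1" by (simp add: H1_mu_iff)
  let ?\<theta> = "pi * real j / real k"
  let ?r = "\<lambda>i. ramp (real i / real k) (real (Suc i) / real k)"
  have le: "real i / real k \<le> real (Suc i) / real k" for i using k_pos by (simp add: divide_right_mono)
  have rH: "(\<lambda>x. c * ?r i x) \<in> H1" for c i by (rule H1_cmult[OF H1_ramp[OF le]])
  have "q (eigenfunction j) \<phi> = q (\<lambda>x. \<Sum>i<k. real k * (cosine_mode j (Suc i) - cosine_mode j i) * ?r i x) \<phi> + q (\<lambda>x. 1) \<phi>"
    unfolding eigenfunction_def[abs_def] by (rule q_add_left[OF H1_sum[OF rH] H1_const \<phi>H])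
  also have "\<dots> = (\<Sum>i<k. q (\<lambda>x. real k * (cosine_mode j (Suc i) - cosine_mode j i) * ?r i x) \<phi>)"
    using q_sum_left[OF rH \<phi>H] q_const_left[OF \<phi>H] by simp
  also have "\<dots> = (\<Sum>i<k. real k * (cosine_mode j (Suc i) - cosine_mode j i) * (\<phi> (real (Suc i) / real k) - \<phi> (real i / real k)))"
  proof (rule sum.cong[OF refl])
    fix i assume "i \<in> {..<k}"
    then have "real (Suc i) / real k \<le> 1" using k_pos by simp
    then show "q (\<lambda>x. real k * (cosine_mode j (Suc i) - cosine_mode j i) * ?r i x) \<phi> =
      real k * (cosine_mode j (Suc i) - cosine_mode j i) * (\<phi> (real (Suc i) / real k) - \<phi> (real i / real k))"
      unfolding q_cmult_left[OF H1_ramp[OF le] \<phi>H] using q_ramp_left[OF _ le _ \<phi>H] by simp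
  qed
  also have "\<dots> = 2 * (real k)\<^sup>2 * (1 - cos ?\<theta>) * (\<Sum>i\<le>k. weight k i * cosine_mode j i * \<phi> (real i / real k))"
  proof (rule discrete_summation_by_parts[OF k])
    show "cosine_mode j 1 = cos ?\<theta> * cosine_mode j 0" by (simp add: cosine_mode_def)
    show "cosine_mode j (Suc (Suc m)) + cosine_mode j m = 2 * cos ?\<theta> * cosine_mode j (Suc m)" for m
    proof -
      have "?\<theta> * real (Suc (Suc m)) = ?\<theta> * real (Suc m) + ?\<theta>" "?\<theta> * real m = ?\<theta> * real (Suc m) - ?\<theta>"
        by (simp_all add: algebra_simps add_divide_distrib)
      then show ?thesis unfolding cosine_mode_def by (simp only: cos_add cos_diff) simp
    qed
    have a: "?\<theta> * real (k - 1) = pi * real j - ?\<theta>" "?\<theta> * real k = pi * real j"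
      using k k_pos by (simp_all add: of_nat_diff algebra_simps diff_divide_distrib)
    \<comment> \<open>Integrality of j enters here: it makes the reflection condition hold at the
      last node.\<close>
    have s: "sin (pi * real j) = 0" by (simp add: mult.commute)
    show "cosine_mode j (k - 1) = cos ?\<theta> * cosine_mode j k"
      unfolding cosine_mode_def a by (simp only: cos_diff s) simp
  qed
  also have "(\<Sum>i\<le>k. weight k i * cosine_mode j i * \<phi> (real i / real k)) = (LINT x|\<mu>. eigenfunction j x * \<phi> x)"
  proof -
    have "(\<lambda>x. eigenfunction j x * \<phi> x) \<in> borel_measurable \<mu>"
      using H1_mult_integrable[OF \<mu> _ \<phi>H] eigenfunction_in_H1_mu by (auto simp: H1_mu_iff)
    from integral_eq[OF this] show ?thesis by (simp add: eigenfunction_node mult.assoc)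
  qed
  finally show "q (eigenfunction j) \<phi> = mode_eigenvalue j * (LINT x|\<mu>. eigenfunction j x * \<phi> x)"
    unfolding mode_eigenvalue_def .
qed (rule eigenfunction_in_H1_mu)

text \<open>The eigenfunction takes the value 1 at the node 0, which is an atom, so it is not
  null.\<close>

lemma eigenspace_dim_pos: "1 \<le> L2_dim \<mu> (eigenspace \<mu> (mode_eigenvalue j))"
proof -
  have "L2_independent \<mu> {eigenfunction j}"
    unfolding L2_independent_def
  proof (intro conjI allI impI)
    fix c :: "(real \<Rightarrow> real) \<Rightarrow> real"
    assume AE: "AE x in \<mu>. (\<Sum>f\<in>{eigenfunction j}. c f * f x) = 0"
    have "(\<Sum>f\<in>{eigenfunction j}. c f * f (real 0 / real k)) = 0"
      by (rule AE_atom[OF \<mu> _ AE]) (use atoms[of 0] weight_pos[OF k, of 0] in simp)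
    then show "\<forall>f\<in>{eigenfunction j}. c f = 0"
      using eigenfunction_node[of 0 j] by (simp add: cosine_mode_def)
  qed simp
  then have "enat (card {eigenfunction j}) \<le> L2_dim \<mu> (eigenspace \<mu> (mode_eigenvalue j))"
    unfolding L2_dim_def using eigenfunction_in_eigenspace by (intro SUP_upper) simp
  then show ?thesis by (simp add: one_enat_def)
qed

text \<open>Excludes the convention that makes the k-th eigenvalue infinite: the indicators of the k
  + 1 atoms are independent.\<close>

lemma L2_dim_ge: "enat (Suc k) \<le> L2_dim \<mu> (square_integrable \<mu>)"
proof -
  define u :: "nat \<Rightarrow> real \<Rightarrow> real" where "u i = indicator {real i / real k}" for i
  have ind: "u i (real j / real k) = (if i = j then 1 else 0)" for i j
    using k_pos by (auto simp: u_def indicator_def)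
  have inj: "inj_on u {..k}"
  proof (rule inj_onI)
    fix i j assume "u i = u j"
    then have "u i (real i / real k) = u j (real i / real k)" by (rule fun_cong)
    then show "i = j" unfolding ind by (simp split: if_splits)
  qed
  have "u i \<in> square_integrable \<mu>" if "i \<le> k" for i
  proof -
    interpret finite_measure \<mu> using P_prob_finite_measure[OF \<mu>] .
    have "(\<lambda>x. (u i x)\<^sup>2) = u i" by (auto simp: u_def indicator_def)
    moreover have "integrable \<mu> (u i)" unfolding u_def
      using node_sets[OF that] by (intro integrable_real_indicator) (auto simp: less_top[symmetric] emeasure_finite)
    ultimately show ?thesis by (simp add: square_integrable_def)
  qed
  moreover have "L2_independent \<mu> (u ` {..k})"
    unfolding L2_independent_def
  proof (intro conjI allI impI ballI)
    fix c :: "(real \<Rightarrow> real) \<Rightarrow> real" and f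
    assume AE: "AE x in \<mu>. (\<Sum>f\<in>u ` {..k}. c f * f x) = 0" and "f \<in> u ` {..k}"
    then obtain i where i: "i \<le> k" "f = u i" by auto
    have "(\<Sum>f\<in>u ` {..k}. c f * f (real i / real k)) = 0"
      by (rule AE_atom[OF \<mu> _ AE]) (use atoms[OF i(1)] weight_pos[OF k, of i] in simp)
    also have "(\<Sum>f\<in>u ` {..k}. c f * f (real i / real k)) = (\<Sum>j\<le>k. if j = i then c (u i) else 0)"
      unfolding sum.reindex[OF inj] by (intro sum.cong) (auto simp: ind)
    finally show "c f = 0" using i by simp
  qed simp
  ultimately have "enat (card (u ` {..k})) \<le> L2_dim \<mu> (square_integrable \<mu>)"
    unfolding L2_dim_def by (intro SUP_upper) auto
  then show ?thesis by (simp add: card_image[OF inj])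
qed

text \<open>The modes 0, ..., k have distinct eigenvalues, the cosine being injective on [0, \<pi>],
  and none exceeds 4k^2. One dimension from each eigenspace already gives the count k + 1.\<close>

lemma eigval_le: "eigval k \<mu> \<le> ereal (4 * (real k)\<^sup>2)"
proof -
  let ?F = "mode_eigenvalue ` {..k}"
  have inj: "inj_on mode_eigenvalue {..k}"
  proof (rule inj_onI)
    fix i j assume ij: "i \<in> {..k}" "j \<in> {..k}" "mode_eigenvalue i = mode_eigenvalue j"
    have b: "0 \<le> pi * real i / real k" "pi * real i / real k \<le> pi" if "i \<le> k" for i
      using that k_pos by (auto simp: divide_le_eq)
    have "cos (pi * real i / real k) = cos (pi * real j / real k)"
      using ij k_pos by (simp add: mode_eigenvalue_def)
    then have "pi * real i / real k = pi * real j / real k"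
      using b[of i] b[of j] ij by (intro cos_inj_pi[of "pi * real i / real k" "pi * real j / real k"]) auto
    then show "i = j" using k_pos by simp
  qed
  have "mode_eigenvalue j \<le> 4 * (real k)\<^sup>2" for j
  proof -
    have "2 * (real k)\<^sup>2 * (1 - cos (pi * real j / real k)) \<le> 2 * (real k)\<^sup>2 * 2"
      using cos_ge_minus_one[of "pi * real j / real k"] by (intro mult_left_mono) auto
    then show ?thesis by (simp add: mode_eigenvalue_def)
  qed
  then have F: "finite ?F" "?F \<subseteq> {..4 * (real k)\<^sup>2}" by auto
  have "enat (Suc k) = (\<Sum>l\<in>?F. 1)" using inj by (simp add: card_image of_nat_eq_enat)
  also have "\<dots> \<le> (\<Sum>l\<in>?F. L2_dim \<mu> (eigenspace \<mu> l))"
    using eigenspace_dim_pos by (intro sum_mono) auto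
  also have "\<dots> \<le> eigenvalue_count \<mu> (4 * (real k)\<^sup>2)"
    unfolding eigenvalue_count_def using F by (intro SUP_upper) simp
  finally have "enat (Suc k) \<le> eigenvalue_count \<mu> (4 * (real k)\<^sup>2)" .
  moreover have "\<not> L2_dim \<mu> (square_integrable \<mu>) \<le> enat k"
  proof
    assume "L2_dim \<mu> (square_integrable \<mu>) \<le> enat k"
    with L2_dim_ge have "enat (Suc k) \<le> enat k" by (rule order_trans)
    then show False by simp
  qed
  ultimately show ?thesis by (auto simp: eigval_def intro!: INF_lower)
qed

end

lemma eigval_zero_le:
  assumes \<mu>: "\<mu> \<in> P_prob_measures"
  shows "eigval 0 \<mu> \<le> 0"
proof -
  interpret prob_space \<mu> using P_prob_prob_space[OF \<mu>] .
  have ind: "L2_independent \<mu> {\<lambda>x. 1}"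
    unfolding L2_independent_def by (simp add: AE_const)
  have one: "(\<lambda>x. 1) \<in> eigenspace \<mu> 0" "(\<lambda>x. 1) \<in> square_integrable \<mu>"
    using H1_square_integrable[OF \<mu> H1_const]
    by (auto simp: eigenspace_iff[OF \<mu>] H1_mu_const q_const_left H1_mu_iff)
  have dim: "enat (card {\<lambda>x::real. 1::real}) \<le> L2_dim \<mu> V" if "(\<lambda>x. 1) \<in> V" for V
    unfolding L2_dim_def using ind that by (intro SUP_upper) simp
  have "enat (Suc 0) \<le> (\<Sum>l\<in>{0}. L2_dim \<mu> (eigenspace \<mu> l))" using dim[OF one(1)] by simp
  also have "\<dots> \<le> eigenvalue_count \<mu> 0"
    unfolding eigenvalue_count_def by (intro SUP_upper) simp
  finally have "enat (Suc 0) \<le> eigenvalue_count \<mu> 0" .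
  moreover have "\<not> L2_dim \<mu> (square_integrable \<mu>) \<le> enat 0"
    using dim[OF one(2)] by (auto dest: order_trans)
  ultimately show ?thesis by (auto simp: eigval_def zero_ereal_def intro!: INF_lower)
qed

lemma return_in_P_prob_measures: "x \<in> {0..1} \<Longrightarrow> return P_borel x \<in> P_prob_measures"
  by (auto simp: P_prob_measures_def space_restrict_space intro!: prob_space_return)

theorem theorem7p1:
  fixes k :: nat
  shows "lambda_min k = ereal (4 * (real k)\<^sup>2) \<and>
    (\<exists>\<mu>\<in>P_prob_measures. eigval k \<mu> = lambda_min k) \<and>
    (1 \<le> k \<longrightarrow> {\<mu> \<in> P_prob_measures. eigval k \<mu> = lambda_min k} = {mu_opt k})"
proof -
  have opt: "mu_opt k \<in> P_prob_measures" "eigval k (mu_opt k) = ereal (4 * (real k)\<^sup>2)" if k: "1 \<le> k"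
  proof -
    interpret optimal_atoms k "mu_opt k" by (rule optimal_atoms_mu_opt[OF k])
    show "mu_opt k \<in> P_prob_measures" by (rule \<mu>)
    show "eigval k (mu_opt k) = ereal (4 * (real k)\<^sup>2)"
      by (rule antisym[OF eigval_le eigval_lower_bound[OF \<mu>]])
  qed
  have ex: "\<exists>\<mu>\<in>P_prob_measures. eigval k \<mu> = ereal (4 * (real k)\<^sup>2)"
  proof (cases "k = 0")
    \<comment> \<open>For k = 0 every probability measure gives 0, but \<open>mu_opt 0\<close> is
      the zero measure because 1 / 0 evaluates to 0; a Dirac measure serves as witness.\<close>
    case True
    have r: "return P_borel 0 \<in> P_prob_measures" by (rule return_in_P_prob_measures) simp
    show ?thesis
      using r eigval_lower_bound[OF r, of 0] eigval_zero_le[OF r] True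
      by (intro bexI[of _ "return P_borel 0"]) (auto simp: zero_ereal_def intro: antisym)
  qed (use opt in auto)
  have min: "lambda_min k = ereal (4 * (real k)\<^sup>2)"
    unfolding lambda_min_def
  proof (rule antisym)
    show "(INF \<mu>\<in>P_prob_measures. eigval k \<mu>) \<le> ereal (4 * (real k)\<^sup>2)"
      using ex by (metis INF_lower)
  qed (rule INF_greatest, rule eigval_lower_bound)
  moreover have "\<mu> = mu_opt k" if k: "1 \<le> k" and \<mu>: "\<mu> \<in> P_prob_measures" and eq: "eigval k \<mu> = lambda_min k" for \<mu>
  proof -
    \<comment> \<open>Attainment places k + 1 eigenvalues at or below 4k^2 itself, so the equality
      case applies with t = 4k^2.\<close>
    obtain F where F: "finite F" "F \<subseteq> {..4 * (real k)\<^sup>2}"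
      "enat (Suc k) \<le> (\<Sum>l\<in>F. L2_dim \<mu> (eigenspace \<mu> l))"
      using eigval_attained[OF \<mu> eq[unfolded min]] .
    have "optimal_atoms k \<mu>"
      by unfold_locales (use k \<mu> eigenvalue_sum_lower_bound(2)[OF \<mu> k F refl] in auto)
    then show ?thesis using optimal_atoms_mu_opt[OF k] by (rule optimal_atoms_unique)
  qed
  ultimately show ?thesis using ex opt by auto
qed

end
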